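(* There is a formula $\varphi(X,Y)$ of MSO+$\nabla$, with $X,Y$ free set-of-nodes variables, such that for all sets of nodes $X,Y\subseteq\{0,1\}^*$, $\varphi(X,Y)$ is true in the full binary tree if and only if there is a family of pairwise disjoint intervals $\mathcal{I}$ with $X=\mathrm{source}(\mathcal{I})$, $Y=\mathrm{target}(\mathcal{I})$ and $\mathbb{P}[\{\pi : \mathcal{I}(\pi)\text{ is eventually constant}\}]=1$.
   Context: The full binary tree has node set $\{0,1\}^*$, ancestor order $\le$ the prefix relation, $|x|$ the length of $x$. MSO over it has node variables and set-of-nodes variables, atoms $x\in X$, $x\le y$, $x=y0$, $x=y1$, Boolean connectives and quantifiers over nodes and sets. A branch is an element of $\{0,1\}^\omega$, identified with its set of finite prefixes; $\mathbb{P}$ is the coin-tossing measure (the complete probability measure on $\{0,1\}^\omega$ with $\mathbb{P}[x\{0,1\}^\omega]=2^{-|x|}$). MSO+$\nabla$ adds branch variables, atoms $x\in\pi$, and the quantifier $\nabla\pi.\,\varphi(\pi)$, true iff some $R\subseteq\{0,1\}^\omega$ with $\mathbb{P}(R)=1$ has all its branches satisfying $\varphi$. An interval is a set $[x,y]=\{z: x\le z\le y\}$ with $x<y$; $x$ is its source, $y$ its target, its interior is $\{z : x<z<y\}$ and its length is the cardinality of its interior. A family of intervals is a set of pairwise disjoint intervals $\mathcal{I}$; $\mathrm{source}(\mathcal{I})$ and $\mathrm{target}(\mathcal{I})$ are the sets of its sources and targets (which determine $\mathcal{I}$). For a source $x$, $\mathcal{I}(x)$ is the length of the interval of $\mathcal{I}$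 with source $x$. For a branch $\pi$, $\mathcal{I}(\pi)$ is the (finite or infinite) sequence $\mathcal{I}(x_1),\mathcal{I}(x_2),\dots$ where $x_1,x_2,\dots$ are the sources of $\mathcal{I}$ lying on $\pi$, in order of increasing depth. A sequence of naturals is eventually constant if it is infinite and takes the same value at all but finitely many positions. *)

theory Defs
  imports "HOL-Probability.Probability" "HOL-Library.Sublist"
begin

type_synonym node = "bool list"
type_synonym branch = "nat \<Rightarrow> bool"

text \<open>
  The letters \<open>0\<close> and \<open>1\<close> are \<open>False\<close> and \<open>True\<close>; the ancestor order is \<^const>\<open>prefix\<close>, its
  strict version \<^const>\<open>strict_prefix\<close>. The node of depth \<open>n\<close> on a branch is its prefix of length \<open>n\<close>.
\<close>

definition branch_node :: "branch \<Rightarrow> nat \<Rightarrow> node" where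
  "branch_node \<pi> n = map \<pi> [0..<n]"

definition nodes_of :: "branch \<Rightarrow> node set" where
  "nodes_of \<pi> = range (branch_node \<pi>)"

definition coin_measure :: "branch measure" where
  "coin_measure = completion (\<Pi>\<^sub>M i\<in>(UNIV :: nat set). measure_pmf (bernoulli_pmf (1/2)))"

lemma space_coin_measure [simp]: "space coin_measure = UNIV"
  by (simp add: coin_measure_def space_PiM)

lemma prob_space_coin_measure: "prob_space coin_measure"
  unfolding coin_measure_def
  by (intro prob_spaceI) (simp add: prob_space.emeasure_space_1 prob_space_PiM measure_pmf.prob_space_axioms)

lemma nodes_of_iff: "x \<in> nodes_of \<pi> \<longleftrightarrow> (\<forall>i<length x. \<pi> i = x ! i)"
proof
  assume "\<forall>i<length x. \<pi> i = x ! i"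
  then have "branch_node \<pi> (length x) = x"
    by (intro nth_equalityI) (auto simp: branch_node_def)
  then show "x \<in> nodes_of \<pi>" unfolding nodes_of_def by (metis rangeI)
qed (auto simp: nodes_of_def branch_node_def)

lemma
  shows sets_cylinder: "{\<pi>. x \<in> nodes_of \<pi>} \<in> sets coin_measure"
    and measure_cylinder: "measure coin_measure {\<pi>. x \<in> nodes_of \<pi>} = 1 / 2 ^ length x"
proof -
  let ?B = "\<lambda>_::nat. measure_pmf (bernoulli_pmf (1/2))"
  let ?P = "Pi\<^sub>M UNIV ?B"
  let ?E = "prod_emb UNIV ?B {..<length x} (\<Pi>\<^sub>E i\<in>{..<length x}. {x ! i})"
  interpret product_prob_space ?B UNIV
    by unfold_locales
  have "?E = {\<pi>. \<forall>i. \<pi> i \<in> (if i < length x then {x ! i} else UNIV)}"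
    by (subst prod_emb_PiE) (simp_all only: subset_UNIV space_measure_pmf PiE_UNIV_domain
        Pi_def lessThan_iff UNIV_I simp_thms)
  then have eq: "{\<pi>. x \<in> nodes_of \<pi>} = ?E"
    by (simp only: nodes_of_iff if_split_mem2 singleton_iff UNIV_I simp_thms)
  have sets: "?E \<in> sets ?P"
    by (rule sets_PiM_I) auto
  then show "{\<pi>. x \<in> nodes_of \<pi>} \<in> sets coin_measure"
    unfolding coin_measure_def eq by (rule sets_completionI_sets)
  have half: "measure (measure_pmf (bernoulli_pmf (1/2))) {b} = 1/2" for b
    by (cases b) (simp_all add: measure_pmf_single)
  have "measure ?P ?E = (\<Prod>i<length x. measure (?B i) {x ! i})"
    by (rule measure_PiM_emb) auto
  also have "\<dots> = (\<Prod>i<length x. 1/2)"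
    by (simp only: half)
  also have "\<dots> = 1 / 2 ^ length x"
    by (simp add: power_one_over)
  finally show "measure coin_measure {\<pi>. x \<in> nodes_of \<pi>} = 1 / 2 ^ length x"
    unfolding coin_measure_def eq measure_completion[OF sets] .
qed

text \<open>
  Each of the three sorts (nodes, sets of nodes, branches) has its own supply of variables,
  named by natural numbers.
\<close>

datatype formula =
    InSet nat nat
  | Ancestor nat nat
  | LeftChild nat nat
  | RightChild nat nat
  | OnBranch nat nat
  | Neg formula
  | Conj formula formula
  | Disj formula formula
  | ExNode nat formula
  | AllNode nat formula
  | ExSet nat formula
  | AllSet nat formula
  | Nabla nat formula

text \<open>The valuations \<open>v\<close>, \<open>V\<close>, \<open>b\<close> interpret the node, set and branch variables, respectively.\<close>

primrec sat :: "(nat \<Rightarrow> node) \<Rightarrow> (nat \<Rightarrow> node set) \<Rightarrow> (nat \<Rightarrow> branch) \<Rightarrow> formula \<Rightarrow> bool" where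
  "sat v V b (InSet x X) \<longleftrightarrow> v x \<in> V X"
| "sat v V b (Ancestor x y) \<longleftrightarrow> prefix (v x) (v y)"
| "sat v V b (LeftChild x y) \<longleftrightarrow> v x = v y @ [False]"
| "sat v V b (RightChild x y) \<longleftrightarrow> v x = v y @ [True]"
| "sat v V b (OnBranch x p) \<longleftrightarrow> v x \<in> nodes_of (b p)"
| "sat v V b (Neg \<phi>) \<longleftrightarrow> \<not> sat v V b \<phi>"
| "sat v V b (Conj \<phi> \<psi>) \<longleftrightarrow> sat v V b \<phi> \<and> sat v V b \<psi>"
| "sat v V b (Disj \<phi> \<psi>) \<longleftrightarrow> sat v V b \<phi> \<or> sat v V b \<psi>"
| "sat v V b (ExNode x \<phi>) \<longleftrightarrow> (\<exists>u. sat (v(x := u)) V b \<phi>)"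
| "sat v V b (AllNode x \<phi>) \<longleftrightarrow> (\<forall>u. sat (v(x := u)) V b \<phi>)"
| "sat v V b (ExSet X \<phi>) \<longleftrightarrow> (\<exists>U. sat v (V(X := U)) b \<phi>)"
| "sat v V b (AllSet X \<phi>) \<longleftrightarrow> (\<forall>U. sat v (V(X := U)) b \<phi>)"
| "sat v V b (Nabla p \<phi>) \<longleftrightarrow>
    (\<exists>R \<in> sets coin_measure. measure coin_measure R = 1 \<and> (\<forall>\<pi>\<in>R. sat v V (b(p := \<pi>)) \<phi>))"

primrec free_node_vars :: "formula \<Rightarrow> nat set" where
  "free_node_vars (InSet x X) = {x}"
| "free_node_vars (Ancestor x y) = {x, y}"
| "free_node_vars (LeftChild x y) = {x, y}"
| "free_node_vars (RightChild x y) = {x, y}"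
| "free_node_vars (OnBranch x p) = {x}"
| "free_node_vars (Neg \<phi>) = free_node_vars \<phi>"
| "free_node_vars (Conj \<phi> \<psi>) = free_node_vars \<phi> \<union> free_node_vars \<psi>"
| "free_node_vars (Disj \<phi> \<psi>) = free_node_vars \<phi> \<union> free_node_vars \<psi>"
| "free_node_vars (ExNode x \<phi>) = free_node_vars \<phi> - {x}"
| "free_node_vars (AllNode x \<phi>) = free_node_vars \<phi> - {x}"
| "free_node_vars (ExSet X \<phi>) = free_node_vars \<phi>"
| "free_node_vars (AllSet X \<phi>) = free_node_vars \<phi>"
| "free_node_vars (Nabla p \<phi>) = free_node_vars \<phi>"

primrec free_set_vars :: "formula \<Rightarrow> nat set" where
  "free_set_vars (InSet x X) = {X}"
| "free_set_vars (Ancestor x y) = {}"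
| "free_set_vars (LeftChild x y) = {}"
| "free_set_vars (RightChild x y) = {}"
| "free_set_vars (OnBranch x p) = {}"
| "free_set_vars (Neg \<phi>) = free_set_vars \<phi>"
| "free_set_vars (Conj \<phi> \<psi>) = free_set_vars \<phi> \<union> free_set_vars \<psi>"
| "free_set_vars (Disj \<phi> \<psi>) = free_set_vars \<phi> \<union> free_set_vars \<psi>"
| "free_set_vars (ExNode x \<phi>) = free_set_vars \<phi>"
| "free_set_vars (AllNode x \<phi>) = free_set_vars \<phi>"
| "free_set_vars (ExSet X \<phi>) = free_set_vars \<phi> - {X}"
| "free_set_vars (AllSet X \<phi>) = free_set_vars \<phi> - {X}"
| "free_set_vars (Nabla p \<phi>) = free_set_vars \<phi>"

primrec free_branch_vars :: "formula \<Rightarrow> nat set" where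
  "free_branch_vars (InSet x X) = {}"
| "free_branch_vars (Ancestor x y) = {}"
| "free_branch_vars (LeftChild x y) = {}"
| "free_branch_vars (RightChild x y) = {}"
| "free_branch_vars (OnBranch x p) = {p}"
| "free_branch_vars (Neg \<phi>) = free_branch_vars \<phi>"
| "free_branch_vars (Conj \<phi> \<psi>) = free_branch_vars \<phi> \<union> free_branch_vars \<psi>"
| "free_branch_vars (Disj \<phi> \<psi>) = free_branch_vars \<phi> \<union> free_branch_vars \<psi>"
| "free_branch_vars (ExNode x \<phi>) = free_branch_vars \<phi>"
| "free_branch_vars (AllNode x \<phi>) = free_branch_vars \<phi>"
| "free_branch_vars (ExSet X \<phi>) = free_branch_vars \<phi>"
| "free_branch_vars (AllSet X \<phi>) = free_branch_vars \<phi>"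
| "free_branch_vars (Nabla p \<phi>) = free_branch_vars \<phi> - {p}"


definition interval :: "node \<Rightarrow> node \<Rightarrow> node set" where
  "interval x y = {z. prefix x z \<and> prefix z y}"

definition interval_family :: "node set set \<Rightarrow> bool" where
  "interval_family \<I> \<longleftrightarrow>
    (\<forall>I\<in>\<I>. \<exists>x y. strict_prefix x y \<and> I = interval x y) \<and> disjoint \<I>"

definition sources :: "node set set \<Rightarrow> node set" where
  "sources \<I> = {x. \<exists>y. strict_prefix x y \<and> interval x y \<in> \<I>}"

definition targets :: "node set set \<Rightarrow> node set" where
  "targets \<I> = {y. \<exists>x. strict_prefix x y \<and> interval x y \<in> \<I>}"

definition interval_length :: "node \<Rightarrow> node \<Rightarrow> nat" where
  "interval_length x y = card {z. strict_prefix x z \<and> strict_prefix z y}"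

text \<open>Meaningful only for a source \<open>x\<close> of a family of intervals; the target is then unique.\<close>

definition length_at :: "node set set \<Rightarrow> node \<Rightarrow> nat" where
  "length_at \<I> x = interval_length x (THE y. strict_prefix x y \<and> interval x y \<in> \<I>)"

definition source_depths :: "node set set \<Rightarrow> branch \<Rightarrow> nat set" where
  "source_depths \<I> \<pi> = {n. branch_node \<pi> n \<in> sources \<I>}"

text \<open>
  A finite or infinite sequence is a function to \<open>nat option\<close> that is \<open>None\<close> exactly beyond its end.
  Positions count from \<open>0\<close>, and \<open>enumerate D k\<close> is the \<open>k\<close>-th smallest element of \<open>D\<close>.
\<close>

definition lengths_along :: "node set set \<Rightarrow> branch \<Rightarrow> nat \<Rightarrow> nat option" where
  "lengths_along \<I> \<pi> k =
    (if infinite (source_depths \<I> \<pi>) \<or> k < card (source_depths \<I> \<pi>)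
     then Some (length_at \<I> (branch_node \<pi> (enumerate (source_depths \<I> \<pi>) k)))
     else None)"

definition eventually_constant :: "(nat \<Rightarrow> nat option) \<Rightarrow> bool" where
  "eventually_constant s \<longleftrightarrow> (\<forall>k. s k \<noteq> None) \<and> (\<exists>c. finite {k. s k \<noteq> Some c})"

end

theory Submission
  imports Defs "HOL-Real_Asymp.Real_Asymp"
begin

text \<open>
  Write \<open>d\<close> for the length of an interval. Eventual constancy fails with positive probability iff
  \<open>d\<close> tends to infinity or some \<open>A = {d \<le> k}\<close> and its complement both recur with positive
  probability. The former is excluded by asking that every recurring set of sources has recurring hits
  of targets (Borel--Cantelli).

  For the latter one counts along the intervals. A set \<open>E\<close> that picks a node in every interval is
  advanced by moving each pick one step down, stopping at the last interior node. Starting from the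
  sources, after \<open>k\<close> steps \<open>E\<close> has arrived exactly at the sources in \<open>A\<close>. So it suffices to exhibit
  a definable class of sets \<open>E\<close> that contains the set of sources, is closed under advancing, and has no
  member that has arrived on \<open>A\<close> but not outside \<open>A\<close>.

  If lengths are eventually constant, such a class is obtained as follows. Select sparse sources alternating
  between \<open>A\<close> and its complement, let \<open>N\<close> be a slowly growing function of their index, and below
  the exit from an interval after its \<open>j\<close>-th node put a label that is reached with probability
  \<open>2\<^bsup>-jN\<^esup>\<close>. A pick at position \<open>j\<close> then has a label below it reached with probability about
  \<open>2\<^bsup>-j(N+1)\<^esup>\<close>. The class consists of those \<open>E\<close> for which this probability at a selected source in
  \<open>A\<close> asymptotically dominates the one at the next selected source outside \<open>A\<close>. By Levy's
  conditional Borel--Cantelli lemma, domination is expressed by comparing, for every set \<open>P\<close> of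
  selected sources, whether the respective hits recur. Advancing multiplies both probabilities by
  about \<open>2\<^bsup>-(N+1)\<^esup>\<close>, and since \<open>N\<close> tends to infinity slowly, a difference in position violates
  domination.
\<close>

section \<open>Branches\<close>

text \<open>The number \<open>k\<close> of advancing steps has no bound in advance, so it stays
  outside the formula, which quantifies over all sets \<open>E\<close> of a class closed under
  advancing. Iterates are formed only in the soundness argument, and that argument asks nothing
  about the origin of \<open>Z\<close> and \<open>T\<close>. These are constructed only when the
  lengths are known to settle. Recurrence distinguishes only convergence from divergence of sums of
  conditional probabilities, so domination holds up to a constant that depends on the branch. One
  position of difference must outweigh every constant, which forces \<open>N\<close> to tend to
  infinity. Yet the sum of \<open>(1/2) ^ (d * (N + 1))\<close> over the index must diverge for
  every \<open>d\<close>, or a violation would be invisible. Hence \<open>N\<close> is about the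
  iterated logarithm of the index. A pick stalls at the end of its interval. If the next interval
  outside \<open>A\<close> were shorter, its pick would stall first and domination would be lost. So
  an interval outside \<open>A\<close> carries labels only if it has the length of the preceding
  selected one.\<close>

lemma length_branch_node [simp]: "length (branch_node \<pi> n) = n"
  by (simp add: branch_node_def)

lemma branch_node_in_nodes_of [simp]: "branch_node \<pi> n \<in> nodes_of \<pi>"
  by (simp add: nodes_of_def)

lemma in_nodes_of_eq: "x \<in> nodes_of \<pi> \<longleftrightarrow> x = branch_node \<pi> (length x)"
  by (auto simp: nodes_of_def)

lemma prefix_in_nodes_of: "x \<in> nodes_of \<pi> \<Longrightarrow> prefix u x \<Longrightarrow> u \<in> nodes_of \<pi>"
  by (auto simp: nodes_of_iff prefix_def nth_append)

lemma prefix_nodes_of: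
  assumes "x \<in> nodes_of \<pi>" "y \<in> nodes_of \<pi>" "length x \<le> length y"
  shows "prefix x y"
proof -
  have "x = take (length x) y"
    using assms by (intro nth_equalityI) (auto simp: nodes_of_iff)
  then show ?thesis by (metis take_is_prefix)
qed

lemma strict_prefix_nodes_of:
  assumes "x \<in> nodes_of \<pi>" "y \<in> nodes_of \<pi>" "length x < length y"
  shows "strict_prefix x y"
  using prefix_nodes_of[OF assms(1,2)] assms(3) by (auto simp: strict_prefix_def)

text \<open>Phrased with nodes and prefixes so that \<open>f_io\<close> can copy it;
  \<open>io_iff\<close> is the version by depths.\<close>

definition io :: "branch \<Rightarrow> (node \<Rightarrow> bool) \<Rightarrow> bool" where
  "io \<pi> Q \<longleftrightarrow> (\<forall>u\<in>nodes_of \<pi>. \<exists>x\<in>nodes_of \<pi>. prefix u x \<and> Q x)"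

lemma io_iff: "io \<pi> Q \<longleftrightarrow> (\<forall>m. \<exists>n\<ge>m. Q (branch_node \<pi> n))"
proof
  assume *: "io \<pi> Q"
  show "\<forall>m. \<exists>n\<ge>m. Q (branch_node \<pi> n)"
  proof
    fix m
    obtain x where "x \<in> nodes_of \<pi>" "prefix (branch_node \<pi> m) x" "Q x"
      using * unfolding io_def by (meson branch_node_in_nodes_of)
    then show "\<exists>n\<ge>m. Q (branch_node \<pi> n)"
      by (metis in_nodes_of_eq length_branch_node prefix_length_le)
  qed
next
  assume *: "\<forall>m. \<exists>n\<ge>m. Q (branch_node \<pi> n)"
  show "io \<pi> Q"
    unfolding io_def
  proof
    fix u assume u: "u \<in> nodes_of \<pi>"
    obtain n where n: "n \<ge> length u" "Q (branch_node \<pi> n)" using * by blast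
    then have "prefix u (branch_node \<pi> n)"
      by (intro prefix_nodes_of[OF u]) auto
    then show "\<exists>x\<in>nodes_of \<pi>. prefix u x \<and> Q x"
      using n by (intro bexI[of _ "branch_node \<pi> n"]) auto
  qed
qed

lemma not_io_iff: "\<not> io \<pi> Q \<longleftrightarrow> (\<exists>m. \<forall>n\<ge>m. \<not> Q (branch_node \<pi> n))"
  by (auto simp: io_iff)

lemma io_mono: "io \<pi> Q \<Longrightarrow> (\<And>x. x \<in> nodes_of \<pi> \<Longrightarrow> Q x \<Longrightarrow> Q' x) \<Longrightarrow> io \<pi> Q'"
  unfolding io_def by blast

lemma io_iff_infinite: "io \<pi> Q \<longleftrightarrow> infinite {n. Q (branch_node \<pi> n)}"
  by (simp add: io_iff infinite_nat_iff_unbounded_le)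

lemma io_disj: "io \<pi> (\<lambda>x. Q x \<or> R x) \<longleftrightarrow> io \<pi> Q \<or> io \<pi> R"
proof
  assume *: "io \<pi> (\<lambda>x. Q x \<or> R x)"
  show "io \<pi> Q \<or> io \<pi> R"
  proof (rule ccontr)
    assume "\<not> (io \<pi> Q \<or> io \<pi> R)"
    then obtain m m' where "\<forall>n\<ge>m. \<not> Q (branch_node \<pi> n)" "\<forall>n\<ge>m'. \<not> R (branch_node \<pi> n)"
      by (auto simp: not_io_iff)
    with * show False by (auto simp: io_iff dest: spec[of _ "max m m'"])
  qed
qed (auto elim: io_mono)

section \<open>Cylinders and conditional probabilities\<close>

interpretation coin: prob_space coin_measure
  by (rule prob_space_coin_measure)

text \<open>The right-hand side is the semantics of \<open>Nabla\<close>, which from here on is read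
  as "almost everywhere".\<close>

lemma AE_coin_iff:
  "(AE \<pi> in coin_measure. Q \<pi>) \<longleftrightarrow>
    (\<exists>R\<in>sets coin_measure. measure coin_measure R = 1 \<and> (\<forall>\<pi>\<in>R. Q \<pi>))"
proof
  assume "AE \<pi> in coin_measure. Q \<pi>"
  then obtain N where N: "{\<pi>\<in>space coin_measure. \<not> Q \<pi>} \<subseteq> N" "emeasure coin_measure N = 0"
      "N \<in> sets coin_measure"
    by (rule AE_E)
  then have "measure coin_measure (space coin_measure - N) = 1"
    by (subst coin.prob_compl) (auto simp: measure_def)
  with N show "\<exists>R\<in>sets coin_measure. measure coin_measure R = 1 \<and> (\<forall>\<pi>\<in>R. Q \<pi>)"
    by (intro bexI[of _ "space coin_measure - N"] sets.compl_sets) auto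
next
  assume "\<exists>R\<in>sets coin_measure. measure coin_measure R = 1 \<and> (\<forall>\<pi>\<in>R. Q \<pi>)"
  then obtain R where R: "R \<in> sets coin_measure" "measure coin_measure R = 1" "\<forall>\<pi>\<in>R. Q \<pi>"
    by blast
  have "AE \<pi> in coin_measure. \<pi> \<in> R"
    using R by (simp add: coin.prob_eq_1)
  then show "AE \<pi> in coin_measure. Q \<pi>" using R(3) by auto
qed

text \<open>\<open>coin_measure\<close> is complete, so the exceptional set, contained in a null
  set, is itself measurable. This yields the measurability claim of the theorem.\<close>

lemma AE_coin_iff_prob_1:
  "(AE \<pi> in coin_measure. Q \<pi>) \<longleftrightarrow>
    {\<pi>. Q \<pi>} \<in> sets coin_measure \<and> measure coin_measure {\<pi>. Q \<pi>} = 1"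
proof
  assume *: "AE \<pi> in coin_measure. Q \<pi>"
  obtain N where N: "{\<pi>\<in>space coin_measure. \<not> Q \<pi>} \<subseteq> N" "emeasure coin_measure N = 0"
      "N \<in> sets coin_measure"
    using * by (rule AE_E)
  then have null: "N \<in> null_sets coin_measure" by auto
  have sub: "{\<pi>. \<not> Q \<pi>} \<subseteq> N" using N(1) by simp
  have "{\<pi>. \<not> Q \<pi>} \<in> null_sets coin_measure"
    using null unfolding coin_measure_def by (rule null_sets_completion_subset[OF sub])
  then have "{\<pi>. \<not> Q \<pi>} \<in> sets coin_measure" by auto
  from sets.compl_sets[OF this] have "{\<pi>. Q \<pi>} \<in> sets coin_measure"
    by (simp add: Diff_eq Collect_neg_eq Compl_eq_Diff_UNIV[symmetric])
  with * show "{\<pi>. Q \<pi>} \<in> sets coin_measure \<and> measure coin_measure {\<pi>. Q \<pi>} = 1"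
    by (simp add: coin.prob_eq_1)
next
  assume "{\<pi>. Q \<pi>} \<in> sets coin_measure \<and> measure coin_measure {\<pi>. Q \<pi>} = 1"
  then show "AE \<pi> in coin_measure. Q \<pi>"
    by (auto simp: AE_coin_iff)
qed

definition cyl :: "node \<Rightarrow> branch set" where
  "cyl x = {\<pi>. x \<in> nodes_of \<pi>}"

lemma cyl_sets [measurable, simp]: "cyl x \<in> sets coin_measure"
  by (simp add: cyl_def sets_cylinder)

lemma prob_cyl: "measure coin_measure (cyl x) = 1 / 2 ^ length x"
  by (simp add: cyl_def measure_cylinder)

lemma cyl_mono: "prefix x y \<Longrightarrow> cyl y \<subseteq> cyl x"
  by (auto simp: cyl_def dest: prefix_in_nodes_of)

lemma cyl_disjoint:
  assumes "\<not> prefix x y" "\<not> prefix y x"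
  shows "cyl x \<inter> cyl y = {}"
  using assms prefix_nodes_of[of x _ y] prefix_nodes_of[of y _ x] by (fastforce simp: cyl_def)

lemma mem_cyl_branch_node [simp]: "\<pi> \<in> cyl (branch_node \<pi> n)"
  by (simp add: cyl_def)

lemma cyl_Nil [simp]: "cyl [] = UNIV"
  by (simp add: cyl_def nodes_of_iff)

definition visit :: "node set \<Rightarrow> branch set" where
  "visit U = (\<Union>t\<in>U. cyl t)"

lemma mem_visit_iff: "\<pi> \<in> visit U \<longleftrightarrow> (\<exists>t\<in>nodes_of \<pi>. t \<in> U)"
  by (auto simp: visit_def cyl_def)

lemma visit_sets [measurable, simp]: "visit U \<in> sets coin_measure"
  unfolding visit_def by (intro sets.countable_UN'') auto

text \<open>The conditional probability of \<open>H\<close> given the cylinder at \<open>x\<close>,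
  whose measure is \<open>1 / 2 ^ length x\<close>.\<close>

definition cprob :: "node \<Rightarrow> branch set \<Rightarrow> real" where
  "cprob x H = measure coin_measure (cyl x \<inter> H) * 2 ^ length x"

lemma prob_cyl_Int: "measure coin_measure (cyl x \<inter> H) = cprob x H / 2 ^ length x"
  by (simp add: cprob_def)

lemma cprob_nonneg [simp]: "0 \<le> cprob x H"
  by (simp add: cprob_def)

lemma cprob_le_1 [simp]: "cprob x H \<le> 1"
proof -
  have "measure coin_measure (cyl x \<inter> H) \<le> measure coin_measure (cyl x)"
    by (intro coin.finite_measure_mono) auto
  then show ?thesis by (simp add: cprob_def prob_cyl field_simps)
qed

lemma cprob_empty: "cprob x {} = 0"
  by (simp add: cprob_def)

lemma cprob_mono: "H \<in> sets coin_measure \<Longrightarrow> cyl x \<inter> G \<subseteq> H \<Longrightarrow> cprob x G \<le> cprob x H"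
  unfolding cprob_def by (intro mult_right_mono coin.finite_measure_mono) auto

lemma cprob_compl:
  assumes "H \<in> sets coin_measure"
  shows "cprob x (- H) = 1 - cprob x H"
proof -
  have "measure coin_measure (cyl x - (cyl x \<inter> H)) = measure coin_measure (cyl x) - measure coin_measure (cyl x \<inter> H)"
    using assms by (intro coin.finite_measure_Diff) auto
  moreover have "cyl x - (cyl x \<inter> H) = cyl x \<inter> - H" by auto
  ultimately show ?thesis by (simp add: cprob_def prob_cyl field_simps)
qed

lemma measurable_branch_node [measurable]:
  "(\<lambda>\<pi>. branch_node \<pi> n) \<in> measurable coin_measure (count_space UNIV)"
proof (subst measurable_count_space_eq_countable, safe)
  fix x :: node
  have "(\<lambda>\<pi>. branch_node \<pi> n) -` {x} \<inter> space coin_measure = (if length x = n then cyl x else {})"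
    by (auto simp: cyl_def in_nodes_of_eq)
  then show "(\<lambda>\<pi>. branch_node \<pi> n) -` {x} \<inter> space coin_measure \<in> sets coin_measure"
    by simp
qed auto

section \<open>Sums along a branch and the convergent half of conditional Borel-Cantelli\<close>

definition bsum :: "(node \<Rightarrow> ennreal) \<Rightarrow> branch \<Rightarrow> ennreal" where
  "bsum f \<pi> = (\<Sum>n. f (branch_node \<pi> n))"

lemma bsum_mono: "(\<And>x. x \<in> nodes_of \<pi> \<Longrightarrow> f x \<le> g x) \<Longrightarrow> bsum f \<pi> \<le> bsum g \<pi>"
  unfolding bsum_def by (intro suminf_le) auto

lemma bsum_add: "bsum (\<lambda>x. f x + g x) \<pi> = bsum f \<pi> + bsum g \<pi>"
  unfolding bsum_def by (intro suminf_add[symmetric]) auto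

lemma bsum_cmult: "bsum (\<lambda>x. c * f x) \<pi> = c * bsum f \<pi>"
  unfolding bsum_def by (intro ennreal_suminf_cmult)

lemma bsum_finite_support:
  assumes "\<And>n. n \<ge> m \<Longrightarrow> f (branch_node \<pi> n) = 0" "\<And>x. f x < \<infinity>"
  shows "bsum f \<pi> < \<infinity>"
proof -
  have "bsum f \<pi> = (\<Sum>n<m. f (branch_node \<pi> n))"
    unfolding bsum_def using assms(1) by (intro suminf_finite) auto
  also have "\<dots> < \<infinity>" using assms(2) by (auto simp: less_top)
  finally show ?thesis .
qed

lemma bsum_tail:
  assumes "\<And>x. f x < \<infinity>" "bsum f \<pi> = \<infinity>"
  shows "bsum (\<lambda>x. if m \<le> length x then f x else 0) \<pi> = \<infinity>"
proof -
  have "bsum f \<pi> = bsum (\<lambda>x. (if m \<le> length x then f x else 0) + (if m \<le> length x then 0 else f x)) \<pi>"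
    unfolding bsum_def by (intro arg_cong[where f = suminf] ext) auto
  also have "\<dots> = bsum (\<lambda>x. if m \<le> length x then f x else 0) \<pi> + bsum (\<lambda>x. if m \<le> length x then 0 else f x) \<pi>"
    by (rule bsum_add)
  finally have "\<dots> = \<infinity>" using assms(2) by simp
  moreover have "bsum (\<lambda>x. if m \<le> length x then 0 else f x) \<pi> < \<infinity>"
    using assms(1) by (intro bsum_finite_support[of m]) auto
  ultimately show ?thesis by auto
qed

lemma measurable_bsum [measurable]: "bsum f \<in> borel_measurable coin_measure"
  unfolding bsum_def[abs_def] by measurable

text \<open>Exactly one of the finitely many nodes of level \<open>n\<close> lies on \<pi>. This
  turns integrals over the node at depth \<open>n\<close> into finite sums over cylinders.\<close>

lemma branch_node_split:
  fixes g :: "node \<Rightarrow> branch \<Rightarrow> ennreal"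
  shows "g (branch_node \<pi> n) \<pi> = (\<Sum>x | length x = n. indicator (cyl x) \<pi> * g x \<pi>)"
proof -
  have fin: "finite {x :: node. length x = n}"
    using finite_lists_length_eq[of "UNIV :: bool set" n] by simp
  have "(\<Sum>x | length x = n. indicator (cyl x) \<pi> * g x \<pi>)
      = (\<Sum>x | length x = n. if branch_node \<pi> n = x then g x \<pi> else 0)"
    by (intro sum.cong) (auto simp: indicator_def cyl_def in_nodes_of_eq)
  also have "\<dots> = g (branch_node \<pi> n) \<pi>"
    by (subst sum.delta'[OF fin]) auto
  finally show ?thesis by simp
qed

lemma sets_hit_at [measurable]:
  assumes "\<And>x. H x \<in> sets coin_measure"
  shows "{\<pi>. \<pi> \<in> H (branch_node \<pi> n)} \<in> sets coin_measure"
proof -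
  have "{\<pi>. \<pi> \<in> H (branch_node \<pi> n)} = (\<Union>x\<in>{x. length x = n}. cyl x \<inter> H x)"
    by (auto simp: cyl_def in_nodes_of_eq)
  also have "\<dots> \<in> sets coin_measure"
    using assms by (intro sets.countable_UN'') auto
  finally show ?thesis .
qed

lemma emeasure_hit_at:
  assumes [measurable]: "\<And>x. H x \<in> sets coin_measure"
  shows "emeasure coin_measure {\<pi>. \<pi> \<in> H (branch_node \<pi> n)} =
    (\<integral>\<^sup>+\<pi>. ennreal (cprob (branch_node \<pi> n) (H (branch_node \<pi> n))) \<partial>coin_measure)"
proof -
  have "emeasure coin_measure {\<pi>. \<pi> \<in> H (branch_node \<pi> n)}
      = (\<integral>\<^sup>+\<pi>. indicator {\<pi>. \<pi> \<in> H (branch_node \<pi> n)} \<pi> \<partial>coin_measure)"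
    using sets_hit_at[OF assms] by simp
  also have "\<dots> = (\<integral>\<^sup>+\<pi>. indicator (H (branch_node \<pi> n)) \<pi> \<partial>coin_measure)"
    by (intro nn_integral_cong) (auto simp: indicator_def)
  also have "\<dots> = (\<integral>\<^sup>+\<pi>. (\<Sum>x | length x = n. indicator (cyl x) \<pi> * indicator (H x) \<pi>) \<partial>coin_measure)"
    by (subst branch_node_split[of "\<lambda>x. indicator (H x)"]) (rule refl)
  also have "\<dots> = (\<Sum>x | length x = n. \<integral>\<^sup>+\<pi>. indicator (cyl x) \<pi> * indicator (H x) \<pi> \<partial>coin_measure)"
    by (intro nn_integral_sum) measurable
  also have "\<dots> = (\<Sum>x | length x = n. emeasure coin_measure (cyl x \<inter> H x))"
    by (intro sum.cong refl) (simp add: indicator_inter_arith[symmetric])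
  also have "\<dots> = (\<Sum>x | length x = n. ennreal (cprob x (H x)) * emeasure coin_measure (cyl x))"
    by (intro sum.cong refl)
       (simp add: coin.emeasure_eq_measure prob_cyl_Int prob_cyl ennreal_mult[symmetric])
  also have "\<dots> = (\<Sum>x | length x = n. \<integral>\<^sup>+\<pi>. indicator (cyl x) \<pi> * ennreal (cprob x (H x)) \<partial>coin_measure)"
    by (intro sum.cong refl) (simp add: nn_integral_multc mult.commute)
  also have "\<dots> = (\<integral>\<^sup>+\<pi>. (\<Sum>x | length x = n. indicator (cyl x) \<pi> * ennreal (cprob x (H x))) \<partial>coin_measure)"
    by (intro nn_integral_sum[symmetric]) measurable
  also have "\<dots> = (\<integral>\<^sup>+\<pi>. ennreal (cprob (branch_node \<pi> n) (H (branch_node \<pi> n))) \<partial>coin_measure)"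
    by (simp only: branch_node_split[of "\<lambda>x _. ennreal (cprob x (H x))"])
  finally show ?thesis .
qed

text \<open>Integrating the bound over all branches shows that the probabilities of a hit at depth
  \<open>n\<close> are summable in \<open>n\<close>, so the classical first Borel-Cantelli lemma
  applies.\<close>

lemma borel_cantelli_bounded:
  assumes H: "\<And>x. H x \<in> sets coin_measure"
    and le: "\<And>\<pi>. bsum (\<lambda>x. ennreal (cprob x (H x))) \<pi> \<le> ennreal c"
  shows "AE \<pi> in coin_measure. \<not> io \<pi> (\<lambda>x. \<pi> \<in> H x)"
proof -
  let ?A = "\<lambda>n. {\<pi>. \<pi> \<in> H (branch_node \<pi> n)}"
  have "(\<Sum>n. ennreal (measure coin_measure (?A n))) =
      (\<Sum>n. \<integral>\<^sup>+\<pi>. ennreal (cprob (branch_node \<pi> n) (H (branch_node \<pi> n))) \<partial>coin_measure)"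
    by (simp only: emeasure_hit_at[of H, OF H] coin.emeasure_eq_measure[symmetric])
  also have "\<dots> = (\<integral>\<^sup>+\<pi>. bsum (\<lambda>x. ennreal (cprob x (H x))) \<pi> \<partial>coin_measure)"
    unfolding bsum_def by (intro nn_integral_suminf[symmetric]) measurable
  also have "\<dots> \<le> (\<integral>\<^sup>+\<pi>. ennreal c \<partial>coin_measure)"
    by (intro nn_integral_mono le)
  also have "\<dots> < \<infinity>"
    using coin.emeasure_space_1 by simp
  finally have "summable (\<lambda>n. measure coin_measure (?A n))"
    by (intro summable_suminf_not_top) auto
  then have "AE \<pi> in coin_measure. eventually (\<lambda>n. \<pi> \<in> space coin_measure - ?A n) sequentially"
    using sets_hit_at[OF H] by (intro borel_cantelli_AE1) (auto simp: less_top[symmetric])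
  then show ?thesis
    by eventually_elim (auto simp: not_io_iff eventually_sequentially)
qed

text \<open>The hypothesis of the previous lemma is enforced by discarding the nodes above which the
  sum already exceeds \<open>c\<close>.\<close>

lemma borel_cantelli_finite:
  assumes H: "\<And>x. H x \<in> sets coin_measure"
  shows "AE \<pi> in coin_measure. bsum (\<lambda>x. ennreal (cprob x (H x))) \<pi> < \<infinity> \<longrightarrow> \<not> io \<pi> (\<lambda>x. \<pi> \<in> H x)"
proof -
  \<comment> \<open>The sum includes the term of \<open>x\<close> itself, so the terms that survive
    in \<open>G c\<close> never add up to more than \<open>c\<close>.\<close>
  define s where "s x = (\<Sum>k\<le>length x. cprob (take k x) (H (take k x)))" for x
  define G where "G c x = (if s x \<le> real c then H x else {})" for c :: nat and x
  have take: "take k (branch_node \<pi> n) = branch_node \<pi> k" if "k \<le> n" for k n \<pi>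
    using that by (simp add: branch_node_def take_map)
  have s: "s (branch_node \<pi> n) = (\<Sum>k\<le>n. cprob (branch_node \<pi> k) (H (branch_node \<pi> k)))" for \<pi> n
    by (simp add: s_def take)
  have "bsum (\<lambda>x. ennreal (cprob x (G c x))) \<pi> \<le> ennreal (real c)" for c \<pi>
  proof -
    have "(\<Sum>n<N. ennreal (cprob (branch_node \<pi> n) (G c (branch_node \<pi> n)))) \<le> ennreal (real c)" for N
    proof (induction N)
      case (Suc N)
      show ?case
      proof (cases "s (branch_node \<pi> N) \<le> real c")
        case True
        have "(\<Sum>n<Suc N. ennreal (cprob (branch_node \<pi> n) (G c (branch_node \<pi> n))))
            \<le> (\<Sum>n<Suc N. ennreal (cprob (branch_node \<pi> n) (H (branch_node \<pi> n))))"
          using H by (intro sum_mono ennreal_leI cprob_mono) (auto simp: G_def)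
        also have "\<dots> = ennreal (s (branch_node \<pi> N))"
          by (simp add: s lessThan_Suc_atMost del: sum.lessThan_Suc)
        also have "\<dots> \<le> ennreal (real c)" using True by (rule ennreal_leI)
        finally show ?thesis .
      next
        case False
        then show ?thesis using Suc by (simp add: G_def cprob_def)
      qed
    qed simp
    then show ?thesis unfolding bsum_def by (intro ennreal_suminf_bound_add[where y = 0, simplified]) auto
  qed
  then have "AE \<pi> in coin_measure. \<not> io \<pi> (\<lambda>x. \<pi> \<in> G c x)" for c
    using H by (intro borel_cantelli_bounded[of "G c" "real c"]) (simp_all add: G_def)
  then have "AE \<pi> in coin_measure. \<forall>c. \<not> io \<pi> (\<lambda>x. \<pi> \<in> G c x)"
    by (simp add: AE_all_countable)
  then show ?thesis
  proof eventually_elim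
    case (elim \<pi>)
    show ?case
    proof (intro impI notI)
      assume fin: "bsum (\<lambda>x. ennreal (cprob x (H x))) \<pi> < \<infinity>" and io: "io \<pi> (\<lambda>x. \<pi> \<in> H x)"
      obtain r where r: "bsum (\<lambda>x. ennreal (cprob x (H x))) \<pi> = ennreal r" "r \<ge> 0"
        using fin by (cases "bsum (\<lambda>x. ennreal (cprob x (H x))) \<pi>") auto
      obtain c :: nat where c: "r \<le> real c" using real_arch_simple by blast
      have "s (branch_node \<pi> n) \<le> real c" for n
      proof -
        have "ennreal (s (branch_node \<pi> n)) = (\<Sum>k<Suc n. ennreal (cprob (branch_node \<pi> k) (H (branch_node \<pi> k))))"
          by (simp add: s lessThan_Suc_atMost del: sum.lessThan_Suc)
        also have "\<dots> \<le> ennreal r"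
          unfolding r(1)[symmetric] bsum_def by (intro sum_le_suminf) auto
        finally show ?thesis using c r by (simp add: ennreal_le_iff)
      qed
      then have "io \<pi> (\<lambda>x. \<pi> \<in> G c x)"
        using io by (simp add: io_iff G_def)
      with elim show False by blast
    qed
  qed
qed

section \<open>The divergent half of conditional Borel-Cantelli\<close>

definition settled :: "node set \<Rightarrow> (node \<Rightarrow> branch set) \<Rightarrow> bool" where
  "settled S H \<longleftrightarrow> (\<forall>x\<in>S. \<forall>y\<in>S. strict_prefix x y \<longrightarrow> cyl y \<subseteq> H x \<or> cyl y \<inter> H x = {})"

lemma settled_subset: "settled S H \<Longrightarrow> S' \<subseteq> S \<Longrightarrow> settled S' H"
  unfolding settled_def by blast

lemma settled_compl: "settled S H \<Longrightarrow> settled S (\<lambda>x. - H x)"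
  unfolding settled_def by blast

text \<open>\<open>settled\<close> plays the part of adaptedness to a filtration: a branch that
  reaches a later node \<open>y\<close> of \<open>S\<close> already knows whether it lies in
  \<open>H x\<close>. Here either some label of \<open>x\<close> lies above \<open>y\<close> and has
  been passed, or all of them are incomparable with \<open>y\<close> and are missed.\<close>

lemma settled_visit:
  assumes "\<And>x y t. x \<in> S \<Longrightarrow> y \<in> S \<Longrightarrow> strict_prefix x y \<Longrightarrow> t \<in> U x \<Longrightarrow> \<not> prefix y t"
  shows "settled S (\<lambda>x. visit (U x))"
  unfolding settled_def
proof (intro ballI impI)
  fix x y assume *: "x \<in> S" "y \<in> S" "strict_prefix x y"
  show "cyl y \<subseteq> visit (U x) \<or> cyl y \<inter> visit (U x) = {}"
  proof (cases "\<exists>t\<in>U x. prefix t y")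
    case True
    then show ?thesis using cyl_mono by (auto simp: visit_def)
  next
    case False
    then have "cyl y \<inter> cyl t = {}" if "t \<in> U x" for t
      using assms[OF * that] that by (intro cyl_disjoint) auto
    then show ?thesis by (auto simp: visit_def)
  qed
qed

context
  fixes S :: "node set" and H :: "node \<Rightarrow> branch set" and f :: "node \<Rightarrow> real" and V :: "branch set"
  assumes H: "\<And>x. H x \<in> sets coin_measure"
    and settled: "settled S H"
  defines "f \<equiv> \<lambda>x. if x \<in> S then cprob x (H x) else 0"
    and "V \<equiv> {\<pi>. \<forall>x\<in>nodes_of \<pi>. x \<in> S \<longrightarrow> \<pi> \<notin> H x}"
begin

lemma sets_no_hit: "V \<in> sets coin_measure"
proof -
  have "V = space coin_measure - (\<Union>x\<in>S. cyl x \<inter> H x)"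
    by (auto simp: V_def cyl_def)
  also have "\<dots> \<in> sets coin_measure"
    using H by (intro sets.Diff sets.top sets.countable_UN'') auto
  finally show ?thesis .
qed

lemma sets_partial_sum [measurable]:
  "{\<pi>. (\<Sum>k=m..<n. f (branch_node \<pi> k)) \<ge> c} \<in> sets coin_measure"
proof -
  have "(\<lambda>\<pi>. \<Sum>k=m..<n. f (branch_node \<pi> k)) \<in> borel_measurable coin_measure"
    by measurable
  from borel_measurable_pred_less[OF _ this]
  have "{\<pi>\<in>space coin_measure. c \<le> (\<Sum>k=m..<n. f (branch_node \<pi> k))} \<in> sets coin_measure"
    by measurable
  then show ?thesis by simp
qed

text \<open>An exponential supermartingale: missing an event of conditional probability
  \<open>h\<close> has probability \<open>1 - h\<close>, which is at most \<open>exp (- h)\<close>,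
  and this pays for the growth of the sum by \<open>h\<close>. The induction is on the number of
  levels left before \<open>n\<close>.\<close>

lemma no_hit_bound_aux:
  assumes "x \<in> S"
  shows "measure coin_measure (cyl x \<inter> V \<inter> {\<pi>. (\<Sum>k=length x..<n. f (branch_node \<pi> k)) \<ge> c})
    \<le> exp (- c) / 2 ^ length x"
  using assms
proof (induction "n - length x" arbitrary: x c rule: less_induct)
  case less
  let ?s = "\<lambda>y \<pi>. \<Sum>k=length y..<n. f (branch_node \<pi> k)"
  let ?W = "cyl x \<inter> V \<inter> {\<pi>. ?s x \<pi> \<ge> c}"
  note V [measurable] = sets_no_hit
  note H [measurable]
  show ?case
  proof (cases "length x < n")
    case False
    then have "?W \<subseteq> (if c \<le> 0 then cyl x else {})" by auto
    then have "measure coin_measure ?W \<le> measure coin_measure (if c \<le> 0 then cyl x else {})"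
      by (intro coin.finite_measure_mono) auto
    also have "\<dots> \<le> exp (- c) / 2 ^ length x"
      by (auto simp: prob_cyl divide_simps)
    finally show ?thesis .
  next
    case len: True
    \<comment> \<open>\<open>N\<close> consists of the first nodes of \<open>S\<close> below
      \<open>x\<close> at which \<open>H x\<close> is known to have failed. As \<open>H\<close> is
      settled, a branch that avoids \<open>H x\<close> and meets \<open>S\<close> again before depth
      \<open>n\<close> enters one of their cylinders. The remaining branches that avoid
      \<open>H x\<close> form \<open>Q\<close>; there the sum is just \<open>h\<close>.\<close>
    define N where "N = {y\<in>S. strict_prefix x y \<and> length y < n \<and> cyl y \<inter> H x = {} \<and>
      (\<forall>u\<in>S. strict_prefix x u \<longrightarrow> \<not> strict_prefix u y)}"
    define Q where "Q = (cyl x - H x) - (\<Union>y\<in>N. cyl y)"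
    define h where "h = cprob x (H x)"
    have [measurable]: "Q \<in> sets coin_measure"
      unfolding Q_def by (intro sets.Diff sets.countable_UN'') auto
    have fin: "finite N"
    proof (rule finite_subset)
      show "N \<subseteq> {y. set y \<subseteq> UNIV \<and> length y \<le> n}" unfolding N_def by auto
      show "finite {y :: node. set y \<subseteq> UNIV \<and> length y \<le> n}" by (rule finite_lists_length_le) simp
    qed
    have disj: "disjoint_family_on cyl N"
      unfolding disjoint_family_on_def
    proof (intro ballI impI)
      fix y z assume "y \<in> N" "z \<in> N" "y \<noteq> z"
      then show "cyl y \<inter> cyl z = {}"
        by (intro cyl_disjoint) (auto simp: N_def strict_prefix_def)
    qed
    have step: "?s x \<pi> = h + ?s y \<pi>" if "y \<in> N" "\<pi> \<in> cyl y" for y \<pi>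
    proof -
      have y: "y \<in> S" "strict_prefix x y" "length y < n" "\<And>u. u \<in> S \<Longrightarrow> strict_prefix x u \<Longrightarrow> \<not> strict_prefix u y"
        using that by (auto simp: N_def)
      have \<pi>y: "y \<in> nodes_of \<pi>" using that by (simp add: cyl_def)
      have \<pi>x: "x \<in> nodes_of \<pi>" using prefix_in_nodes_of[OF \<pi>y] y(2) by (simp add: strict_prefix_def)
      have lt: "length x < length y" using y(2) by (rule prefix_length_less)
      have zero: "f (branch_node \<pi> k) = 0" if "k \<in> {Suc (length x)..<length y}" for k
      proof -
        have "strict_prefix x (branch_node \<pi> k)" "strict_prefix (branch_node \<pi> k) y"
          using that by (auto intro!: strict_prefix_nodes_of \<pi>x \<pi>y)
        then show ?thesis using y(4) by (auto simp: f_def)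
      qed
      have "?s x \<pi> = (\<Sum>k=length x..<length y. f (branch_node \<pi> k)) + ?s y \<pi>"
        using y(3) lt by (intro sum.atLeastLessThan_concat[symmetric]) auto
      also have "(\<Sum>k=length x..<length y. f (branch_node \<pi> k)) = f (branch_node \<pi> (length x)) + (\<Sum>k=Suc (length x)..<length y. f (branch_node \<pi> k))"
        using lt by (rule sum.atLeast_Suc_lessThan)
      also have "(\<Sum>k=Suc (length x)..<length y. f (branch_node \<pi> k)) = 0"
        using zero by (intro sum.neutral) blast
      also have "f (branch_node \<pi> (length x)) = h"
        using \<pi>x less.prems by (simp add: in_nodes_of_eq[symmetric] f_def h_def) (metis in_nodes_of_eq)
      finally show ?thesis by simp
    qed
    have last: "?s x \<pi> = h" if "\<pi> \<in> ?W" "\<pi> \<notin> (\<Union>y\<in>N. cyl y)" for \<pi>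
    proof -
      have \<pi>x: "x \<in> nodes_of \<pi>" and nh: "\<pi> \<notin> H x" using that less.prems by (auto simp: cyl_def V_def)
      have zero: "f (branch_node \<pi> k) = 0" if k: "k \<in> {Suc (length x)..<n}" for k
      proof (rule ccontr)
        assume "f (branch_node \<pi> k) \<noteq> 0"
        then have "\<exists>k. length x < k \<and> k < n \<and> branch_node \<pi> k \<in> S"
          using k by (intro exI[of _ k]) (auto simp: f_def split: if_splits)
        then obtain l where l: "length x < l" "l < n" "branch_node \<pi> l \<in> S"
          and least: "\<And>j. j < l \<Longrightarrow> \<not> (length x < j \<and> j < n \<and> branch_node \<pi> j \<in> S)"
          using exists_least_iff[of "\<lambda>k. length x < k \<and> k < n \<and> branch_node \<pi> k \<in> S"] by blast
        let ?y = "branch_node \<pi> l"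
        have xy: "strict_prefix x ?y" using l \<pi>x by (intro strict_prefix_nodes_of) auto
        have "cyl ?y \<inter> H x = {}"
          using settled less.prems l(3) xy nh mem_cyl_branch_node[of \<pi> l] unfolding settled_def by blast
        moreover have "\<not> strict_prefix u ?y" if "u \<in> S" "strict_prefix x u" for u
        proof
          assume *: "strict_prefix u ?y"
          then have "u \<in> nodes_of \<pi>"
            by (intro prefix_in_nodes_of[OF branch_node_in_nodes_of]) (auto simp: strict_prefix_def)
          then have "u = branch_node \<pi> (length u)" by (simp add: in_nodes_of_eq)
          moreover have "length x < length u" "length u < l"
            using prefix_length_less[OF that(2)] prefix_length_less[OF *] by auto
          ultimately show False using least[of "length u"] that(1) l(2) by auto
        qed
        ultimately have "?y \<in> N" using l xy by (auto simp: N_def)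
        then show False using \<open>\<pi> \<notin> (\<Union>y\<in>N. cyl y)\<close> by (auto simp del: mem_cyl_branch_node intro: mem_cyl_branch_node)
      qed
      have "?s x \<pi> = f (branch_node \<pi> (length x)) + (\<Sum>k=Suc (length x)..<n. f (branch_node \<pi> k))"
        using len by (rule sum.atLeast_Suc_lessThan)
      also have "(\<Sum>k=Suc (length x)..<n. f (branch_node \<pi> k)) = 0"
        using zero by (intro sum.neutral) blast
      also have "f (branch_node \<pi> (length x)) = h"
        using \<pi>x less.prems by (metis in_nodes_of_eq f_def h_def)
      finally show ?thesis by simp
    qed
    define R where "R = (if c \<le> h then Q else {})"
    have sub: "?W \<subseteq> (\<Union>y\<in>N. cyl y \<inter> V \<inter> {\<pi>. ?s y \<pi> \<ge> c - h}) \<union> R"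
    proof
      fix \<pi> assume \<pi>: "\<pi> \<in> ?W"
      show "\<pi> \<in> (\<Union>y\<in>N. cyl y \<inter> V \<inter> {\<pi>. ?s y \<pi> \<ge> c - h}) \<union> R"
      proof (cases "\<pi> \<in> (\<Union>y\<in>N. cyl y)")
        case True
        then obtain y where "y \<in> N" "\<pi> \<in> cyl y" by blast
        with \<pi> step[OF this] show ?thesis by auto
      next
        case False
        then have "c \<le> h" using last[OF \<pi> False] \<pi> by simp
        moreover have "\<pi> \<in> Q" using \<pi> False less.prems by (auto simp: Q_def V_def cyl_def)
        ultimately show ?thesis by (simp add: R_def)
      qed
    qed
    have IH: "measure coin_measure (cyl y \<inter> V \<inter> {\<pi>. ?s y \<pi> \<ge> c - h}) \<le> exp (h - c) * measure coin_measure (cyl y)"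
      if "y \<in> N" for y
    proof -
      have "n - length y < n - length x" "y \<in> S"
        using that len by (auto simp: N_def dest: prefix_length_less)
      from less.hyps[OF this, of "c - h"] show ?thesis by (simp add: prob_cyl)
    qed
    have "measure coin_measure ?W \<le> measure coin_measure ((\<Union>y\<in>N. cyl y \<inter> V \<inter> {\<pi>. ?s y \<pi> \<ge> c - h}) \<union> R)"
      using fin by (intro coin.finite_measure_mono sub) (auto simp: R_def intro!: sets.Un sets.finite_UN)
    also have "\<dots> \<le> measure coin_measure (\<Union>y\<in>N. cyl y \<inter> V \<inter> {\<pi>. ?s y \<pi> \<ge> c - h}) + measure coin_measure R"
      using fin by (intro measure_Un_le) (auto simp: R_def intro!: sets.finite_UN)
    also have "measure coin_measure (\<Union>y\<in>N. cyl y \<inter> V \<inter> {\<pi>. ?s y \<pi> \<ge> c - h}) \<le>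
        (\<Sum>y\<in>N. measure coin_measure (cyl y \<inter> V \<inter> {\<pi>. ?s y \<pi> \<ge> c - h}))"
      using fin by (intro coin.finite_measure_subadditive_finite) auto
    also have "\<dots> \<le> (\<Sum>y\<in>N. exp (h - c) * measure coin_measure (cyl y))"
      by (intro sum_mono IH)
    also have "\<dots> = exp (h - c) * measure coin_measure (\<Union>y\<in>N. cyl y)"
      using fin disj by (subst coin.finite_measure_finite_Union) (auto simp: sum_distrib_left)
    also have "measure coin_measure R \<le> exp (h - c) * measure coin_measure Q"
      by (auto simp: R_def intro!: mult_left_mono mult_right_mono[of 1 "exp (h - c)", simplified])
    also have "exp (h - c) * measure coin_measure (\<Union>y\<in>N. cyl y) + exp (h - c) * measure coin_measure Q
        = exp (h - c) * measure coin_measure ((\<Union>y\<in>N. cyl y) \<union> Q)"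
      using fin by (subst coin.finite_measure_Union) (auto simp: Q_def distrib_left intro!: sets.finite_UN)
    also have "\<dots> \<le> exp (h - c) * measure coin_measure (cyl x - H x)"
    proof (intro mult_left_mono coin.finite_measure_mono)
      show "(\<Union>y\<in>N. cyl y) \<union> Q \<subseteq> cyl x - H x"
        using cyl_mono by (fastforce simp: N_def Q_def strict_prefix_def)
    qed auto
    also have "measure coin_measure (cyl x - H x) = (1 - h) / 2 ^ length x"
      using cprob_compl[OF H, of x x] by (simp add: h_def cprob_def Diff_eq field_simps)
    also have "exp (h - c) * ((1 - h) / 2 ^ length x) \<le> exp (- c) / 2 ^ length x"
    proof -
      have "1 - h \<le> exp (- h)" using exp_ge_add_one_self[of "- h"] by simp
      then have "exp (h - c) * (1 - h) \<le> exp (h - c) * exp (- h)" by (intro mult_left_mono) auto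
      also have "\<dots> = exp (- c)" by (simp add: exp_add[symmetric])
      finally show ?thesis by (simp add: divide_right_mono)
    qed
    finally show ?thesis by simp
  qed
qed

end

lemma no_hit_bound:
  assumes H: "\<And>x. H x \<in> sets coin_measure" and settled: "settled S H"
  shows "measure coin_measure ({\<pi>. \<forall>x\<in>nodes_of \<pi>. x \<in> S \<longrightarrow> \<pi> \<notin> H x} \<inter>
    {\<pi>. (\<Sum>k<n. if branch_node \<pi> k \<in> S then cprob (branch_node \<pi> k) (H (branch_node \<pi> k)) else 0) \<ge> c})
    \<le> exp (- c)"
proof -
  define H' where "H' x = (if x \<in> S then H x else {})" for x
  \<comment> \<open>The root is adjoined, with the empty event unless it belongs to
    \<open>S\<close>, so that \<open>no_hit_bound_aux\<close> can start there; neither the sum nor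
    the absence of hits changes.\<close>
  define S' where "S' = insert [] S"
  have H': "H' x \<in> sets coin_measure" for x using H by (simp add: H'_def)
  have settled': "settled S' H'"
    using settled by (auto simp: settled_def S'_def H'_def)
  have 1: "(if x \<in> S' then cprob x (H' x) else 0) = (if x \<in> S then cprob x (H x) else 0)" for x
    by (auto simp: S'_def H'_def cprob_def)
  have 2: "(\<forall>x\<in>nodes_of \<pi>. x \<in> S' \<longrightarrow> \<pi> \<notin> H' x) \<longleftrightarrow> (\<forall>x\<in>nodes_of \<pi>. x \<in> S \<longrightarrow> \<pi> \<notin> H x)" for \<pi>
    by (auto simp: S'_def H'_def)
  have "[] \<in> S'" by (simp add: S'_def)
  from no_hit_bound_aux[OF H' settled' this, of c n] show ?thesis
    unfolding 1 2 by (simp add: atLeast0LessThan)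
qed

text \<open>Missing all events while the sum reaches \<open>c\<close> has probability at most
  \<open>exp (- c)\<close>, so a divergent sum forces at least one hit. Divergence survives the
  removal of all nodes of depth below \<open>m\<close>; doing this for every \<open>m\<close> gives
  infinitely many hits.\<close>

lemma borel_cantelli_infinite:
  assumes H: "\<And>x. H x \<in> sets coin_measure" and settled: "settled S H"
  shows "AE \<pi> in coin_measure.
    bsum (\<lambda>x. if x \<in> S then ennreal (cprob x (H x)) else 0) \<pi> = \<infinity> \<longrightarrow> io \<pi> (\<lambda>x. x \<in> S \<and> \<pi> \<in> H x)"
proof -
  define f where "f S x = (if x \<in> S then cprob x (H x) else 0)" for S :: "node set" and x
  have once: "AE \<pi> in coin_measure. bsum (\<lambda>x. ennreal (f S x)) \<pi> = \<infinity> \<longrightarrow>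
      (\<exists>x\<in>nodes_of \<pi>. x \<in> S \<and> \<pi> \<in> H x)" if settled: "settled S H" for S
  proof -
    define V where "V = {\<pi>. \<forall>x\<in>nodes_of \<pi>. x \<in> S \<longrightarrow> \<pi> \<notin> H x}"
    define B where "B n c = {\<pi>. (\<Sum>k<n. f S (branch_node \<pi> k)) \<ge> c}" for n c
    have V [measurable]: "V \<in> sets coin_measure"
      unfolding V_def by (rule sets_no_hit[OF H settled])
    have B [measurable]: "B n c \<in> sets coin_measure" for n c
      using sets_partial_sum[OF H settled, of c 0 n] unfolding B_def f_def
      by (simp add: atLeast0LessThan)
    have bound: "measure coin_measure (V \<inter> B n c) \<le> exp (- c)" for n c
      unfolding V_def B_def f_def by (rule no_hit_bound[OF H settled])
    have bound_UN: "measure coin_measure (\<Union>n. V \<inter> B n c) \<le> exp (- c)" for c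
    proof (rule LIMSEQ_le_const2)
      show "(\<lambda>n. measure coin_measure (V \<inter> B n c)) \<longlonglongrightarrow> measure coin_measure (\<Union>n. V \<inter> B n c)"
      proof (intro coin.finite_Lim_measure_incseq)
        show "incseq (\<lambda>n. V \<inter> B n c)"
        proof (rule incseq_SucI)
          fix n
          have "f S x \<ge> 0" for x by (simp add: f_def)
          then show "V \<inter> B n c \<subseteq> V \<inter> B (Suc n) c"
            by (auto simp: B_def intro: add_increasing2)
        qed
      qed auto
    qed (auto intro: bound)
    define W where "W = (\<Inter>c::nat. \<Union>n. V \<inter> B n (real c))"
    have [measurable]: "W \<in> sets coin_measure" unfolding W_def by measurable
    have "measure coin_measure W \<le> exp (- real c)" for c
    proof -
      have "measure coin_measure W \<le> measure coin_measure (\<Union>n. V \<inter> B n (real c))"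
        by (intro coin.finite_measure_mono) (auto simp: W_def)
      with bound_UN[of "real c"] show ?thesis by simp
    qed
    moreover have "(\<lambda>c. exp (- real c)) \<longlonglongrightarrow> 0"
      by real_asymp
    ultimately have "measure coin_measure W \<le> 0"
      by (intro LIMSEQ_le_const) auto
    then have "emeasure coin_measure W = 0"
      by (simp add: coin.emeasure_eq_measure measure_le_0_iff)
    then have "AE \<pi> in coin_measure. \<pi> \<notin> W"
      by (intro AE_I'[of W]) auto
    then show ?thesis
    proof eventually_elim
      case (elim \<pi>)
      show ?case
      proof (rule ccontr)
        assume *: "\<not> ?thesis"
        then have inf: "bsum (\<lambda>x. ennreal (f S x)) \<pi> = \<infinity>" and "\<pi> \<in> V" by (auto simp: V_def)
        have "\<exists>n. \<pi> \<in> B n (real c)" for c :: nat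
        proof (rule ccontr)
          assume "\<nexists>n. \<pi> \<in> B n (real c)"
          then have "(\<Sum>k<n. f S (branch_node \<pi> k)) \<le> real c" for n by (auto simp: B_def not_le less_imp_le)
          then have "(\<Sum>k<n. ennreal (f S (branch_node \<pi> k))) \<le> ennreal (real c)" for n
            by (subst sum_ennreal) (auto simp: f_def intro: ennreal_leI)
          then have "bsum (\<lambda>x. ennreal (f S x)) \<pi> \<le> ennreal (real c)"
            unfolding bsum_def by (intro ennreal_suminf_bound_add[where y = 0, simplified]) auto
          with inf show False by (simp add: top_unique)
        qed
        with \<open>\<pi> \<in> V\<close> have "\<pi> \<in> W" by (auto simp: W_def)
        with elim show False by blast
      qed
    qed
  qed
  define T where "T m = {x\<in>S. m \<le> length x}" for m
  have "settled (T m) H" for m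
    using settled by (rule settled_subset) (auto simp: T_def)
  then have "AE \<pi> in coin_measure. bsum (\<lambda>x. ennreal (f (T m) x)) \<pi> = \<infinity> \<longrightarrow>
      (\<exists>x\<in>nodes_of \<pi>. x \<in> T m \<and> \<pi> \<in> H x)" for m
    by (rule once)
  then have "AE \<pi> in coin_measure. \<forall>m. bsum (\<lambda>x. ennreal (f (T m) x)) \<pi> = \<infinity> \<longrightarrow>
      (\<exists>x\<in>nodes_of \<pi>. x \<in> T m \<and> \<pi> \<in> H x)"
    by (simp add: AE_all_countable)
  then show ?thesis
  proof eventually_elim
    case (elim \<pi>)
    show ?case
    proof
      assume inf: "bsum (\<lambda>x. if x \<in> S then ennreal (cprob x (H x)) else 0) \<pi> = \<infinity>"
      have "bsum (\<lambda>x. if m \<le> length x then if x \<in> S then ennreal (cprob x (H x)) else 0 else 0) \<pi> = \<infinity>" for m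
        using inf by (intro bsum_tail) auto
      also have "(\<lambda>x. if m \<le> length x then if x \<in> S then ennreal (cprob x (H x)) else 0 else 0) = (\<lambda>x. ennreal (f (T m) x))" for m
        by (auto simp: f_def T_def)
      finally have "\<exists>x\<in>nodes_of \<pi>. x \<in> T m \<and> \<pi> \<in> H x" for m using elim by blast
      then show "io \<pi> (\<lambda>x. x \<in> S \<and> \<pi> \<in> H x)"
        unfolding io_iff T_def by (metis (no_types, lifting) in_nodes_of_eq mem_Collect_eq)
    qed
  qed
qed

section \<open>Domination of probabilities, read off from the recurrence of hits\<close>

lemma branch_node_Suc: "branch_node \<pi> (Suc n) = branch_node \<pi> n @ [\<pi> n]"
  by (simp add: branch_node_def)

text \<open>The node is given in reversed order. The threshold factor grows with the weight already selected
  above the node, so that the selected values of \<open>a\<close> sum to at most \<open>2\<close> on every branch.\<close>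

primrec selected_weight :: "(node \<Rightarrow> real) \<Rightarrow> (node \<Rightarrow> real) \<Rightarrow> node \<Rightarrow> real" where
  "selected_weight a b [] = 0"
| "selected_weight a b (d # r) = selected_weight a b r +
    (if b (rev r) > exp (selected_weight a b r) * a (rev r) then b (rev r) else 0)"

text \<open>The constant \<open>C\<close> depends on the branch, so the test cannot use a fixed
  threshold. With \<open>g\<close> the weight of \<open>b\<close> selected so far, the selected
  \<open>a\<close> is at most \<open>exp (- g)\<close> times the increment of \<open>g\<close>, and
  these products add up like the integral of \<open>exp (- t)\<close>. If the selected
  \<open>b\<close> has a finite sum, \<open>g\<close> stays bounded by it, and its exponential
  serves as \<open>C\<close>.\<close>

lemma dominating_selection:
  fixes a b :: "node \<Rightarrow> real"
  assumes a: "\<And>x. 0 \<le> a x" and b: "\<And>x. 0 \<le> b x" "\<And>x. b x \<le> 1"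
  obtains P where "\<And>\<pi>. bsum (\<lambda>x. if x \<in> P then ennreal (a x) else 0) \<pi> \<le> ennreal 2"
    and "\<And>x. x \<in> P \<Longrightarrow> 0 < b x"
    and "\<And>\<pi>. bsum (\<lambda>x. if x \<in> P then ennreal (b x) else 0) \<pi> < \<infinity> \<Longrightarrow>
      \<exists>C\<ge>0. \<forall>x\<in>nodes_of \<pi>. b x > C * a x \<longrightarrow> x \<in> P"
proof -
  define g where "g x = selected_weight a b (rev x)" for x
  define P where "P = {x. b x > exp (g x) * a x}"
  have g_0: "g (branch_node \<pi> 0) = 0" for \<pi> by (simp add: g_def branch_node_def)
  have g_Suc: "g (branch_node \<pi> (Suc n)) = g (branch_node \<pi> n) + (if branch_node \<pi> n \<in> P then b (branch_node \<pi> n) else 0)" for \<pi> n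
    by (simp add: g_def branch_node_Suc P_def)
  have g_sum: "g (branch_node \<pi> n) = (\<Sum>k<n. if branch_node \<pi> k \<in> P then b (branch_node \<pi> k) else 0)" for \<pi> n
    by (induction n) (simp_all only: g_0 g_Suc sum.lessThan_Suc lessThan_0 sum.empty)
  show thesis
  proof
    fix \<pi>
    have "(\<Sum>k<n. if branch_node \<pi> k \<in> P then a (branch_node \<pi> k) else 0) \<le> 2 * (1 - exp (- g (branch_node \<pi> n)))" for n
    proof (induction n)
      case (Suc n)
      let ?x = "branch_node \<pi> n"
      have "(if ?x \<in> P then a ?x else 0) \<le> 2 * (exp (- g ?x) - exp (- g (branch_node \<pi> (Suc n))))"
      proof (cases "?x \<in> P")
        case True
        \<comment> \<open>The secant-type bound uses \<open>b \<le> 1\<close> and is the origin of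
          the factor 2 in the bound on the sum of \<open>a\<close>.\<close>
        have e: "exp (- b ?x) \<le> 1 - b ?x / 2"
        proof -
          have "exp (- b ?x) = 1 / exp (b ?x)" by (simp add: exp_minus field_simps)
          also have "\<dots> \<le> 1 / (1 + b ?x)"
            using exp_ge_add_one_self[of "b ?x"] b[of ?x] by (intro divide_left_mono) auto
          also have "\<dots> \<le> 1 - b ?x / 2"
          proof -
            have "b ?x * b ?x \<le> b ?x * 1" using b[of ?x] by (intro mult_left_mono) auto
            then have "1 \<le> (1 - b ?x / 2) * (1 + b ?x)" by (simp add: algebra_simps)
            then show ?thesis using b[of ?x] by (simp add: pos_divide_le_eq)
          qed
          finally show ?thesis .
        qed
        have "exp (g ?x) * a ?x \<le> b ?x" using True by (simp add: P_def)
        then have "exp (- g ?x) * (exp (g ?x) * a ?x) \<le> exp (- g ?x) * b ?x" by (intro mult_left_mono) auto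
        then have "a ?x \<le> exp (- g ?x) * b ?x" by (simp add: mult.assoc[symmetric] exp_add[symmetric])
        also have "\<dots> \<le> exp (- g ?x) * (2 * (1 - exp (- b ?x)))"
          using e by (intro mult_left_mono) auto
        also have "\<dots> = 2 * (exp (- g ?x) - exp (- g (branch_node \<pi> (Suc n))))"
          using True by (simp add: g_Suc exp_diff exp_minus field_simps exp_add)
        finally show ?thesis using True by simp
      qed (simp add: g_Suc)
      with Suc show ?case by (simp add: algebra_simps)
    qed (simp add: g_0)
    then have le2: "(\<Sum>k<n. if branch_node \<pi> k \<in> P then a (branch_node \<pi> k) else 0) \<le> 2" for n
      by (rule order_trans) simp
    have "(\<Sum>k<n. if branch_node \<pi> k \<in> P then ennreal (a (branch_node \<pi> k)) else 0) \<le> ennreal 2" for n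
    proof -
      have "(\<Sum>k<n. if branch_node \<pi> k \<in> P then ennreal (a (branch_node \<pi> k)) else 0)
          = (\<Sum>k<n. ennreal (if branch_node \<pi> k \<in> P then a (branch_node \<pi> k) else 0))"
        by (intro sum.cong) auto
      also have "\<dots> = ennreal (\<Sum>k<n. if branch_node \<pi> k \<in> P then a (branch_node \<pi> k) else 0)"
        using a by (intro sum_ennreal) auto
      finally show ?thesis using ennreal_leI[OF le2[of n]] by simp
    qed
    then show "bsum (\<lambda>x. if x \<in> P then ennreal (a x) else 0) \<pi> \<le> ennreal 2"
      unfolding bsum_def by (intro ennreal_suminf_bound_add[where y = 0, simplified]) auto
  next
    fix x assume "x \<in> P"
    moreover have "0 \<le> exp (g x) * a x" using a by simp
    ultimately show "0 < b x" by (simp add: P_def)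
  next
    fix \<pi> assume fin: "bsum (\<lambda>x. if x \<in> P then ennreal (b x) else 0) \<pi> < \<infinity>"
    obtain r where r: "bsum (\<lambda>x. if x \<in> P then ennreal (b x) else 0) \<pi> = ennreal r" "r \<ge> 0"
      using fin by (cases "bsum (\<lambda>x. if x \<in> P then ennreal (b x) else 0) \<pi>") auto
    have g_le: "g (branch_node \<pi> n) \<le> r" for n
    proof -
      have "ennreal (g (branch_node \<pi> n)) = (\<Sum>k<n. ennreal (if branch_node \<pi> k \<in> P then b (branch_node \<pi> k) else 0))"
        unfolding g_sum using b by (intro sum_ennreal[symmetric]) auto
      also have "\<dots> = (\<Sum>k<n. if branch_node \<pi> k \<in> P then ennreal (b (branch_node \<pi> k)) else 0)"
        by (intro sum.cong) auto
      also have "\<dots> \<le> ennreal r"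
        unfolding r(1)[symmetric] bsum_def by (intro sum_le_suminf) auto
      finally show ?thesis using r by (simp add: ennreal_le_iff)
    qed
    show "\<exists>C\<ge>0. \<forall>x\<in>nodes_of \<pi>. b x > C * a x \<longrightarrow> x \<in> P"
    proof (intro exI[of _ "exp r"] conjI ballI impI)
      fix x assume x: "x \<in> nodes_of \<pi>" "exp r * a x < b x"
      have "exp (g x) * a x \<le> exp r * a x"
        using g_le[of "length x"] x(1) a[of x] by (intro mult_right_mono) (auto simp: in_nodes_of_eq)
      with x(2) show "x \<in> P" by (simp add: P_def)
    qed simp
  qed
qed

text \<open>The formula compares two events at the nodes of \<open>S\<close> by hits only; this says what it means
  for their conditional probabilities.\<close>

lemma hits_dominated_iff:
  assumes A: "\<And>x. HA x \<in> sets coin_measure" "settled S HA"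
    and B: "\<And>x. HB x \<in> sets coin_measure" "settled S HB"
  shows "(\<forall>P\<subseteq>S. AE \<pi> in coin_measure. io \<pi> (\<lambda>x. x \<in> P \<and> \<pi> \<in> HB x) \<longrightarrow> io \<pi> (\<lambda>x. x \<in> P \<and> \<pi> \<in> HA x)) \<longleftrightarrow>
    (AE \<pi> in coin_measure. \<exists>C\<ge>0. bsum (\<lambda>x. if x \<in> S \<and> cprob x (HB x) > C * cprob x (HA x)
      then ennreal (cprob x (HB x)) else 0) \<pi> < \<infinity>)"
    (is "?L \<longleftrightarrow> ?R")
proof
  assume L: ?L
  define a where "a x = cprob x (HA x)" for x
  define b where "b x = (if x \<in> S then cprob x (HB x) else 0)" for x
  \<comment> \<open>On this \<open>P\<close> the probabilities of \<open>HA\<close> have a bounded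
    sum, so hits of \<open>HA\<close> do not recur; by \<open>?L\<close> neither do hits of
    \<open>HB\<close>, and \<open>borel_cantelli_infinite\<close> makes the sum of \<open>HB\<close>
    over \<open>P\<close> finite. Then \<open>P\<close> catches every node where \<open>HB\<close>
    exceeds a multiple of \<open>HA\<close>. Setting \<open>b\<close> to zero off \<open>S\<close>
    keeps \<open>P\<close> inside \<open>S\<close>.\<close>
  obtain P where P: "\<And>\<pi>. bsum (\<lambda>x. if x \<in> P then ennreal (a x) else 0) \<pi> \<le> ennreal 2"
    "\<And>x. x \<in> P \<Longrightarrow> 0 < b x"
    "\<And>\<pi>. bsum (\<lambda>x. if x \<in> P then ennreal (b x) else 0) \<pi> < \<infinity> \<Longrightarrow>
      \<exists>C\<ge>0. \<forall>x\<in>nodes_of \<pi>. b x > C * a x \<longrightarrow> x \<in> P"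
    by (rule dominating_selection[of a b]) (auto simp: a_def b_def)
  have PS: "P \<subseteq> S" using P(2) by (fastforce simp: b_def split: if_splits)
  have "AE \<pi> in coin_measure. \<not> io \<pi> (\<lambda>x. \<pi> \<in> (if x \<in> P then HA x else {}))"
  proof (rule borel_cantelli_bounded[of _ 2])
    fix \<pi>
    have "bsum (\<lambda>x. ennreal (cprob x (if x \<in> P then HA x else {}))) \<pi> = bsum (\<lambda>x. if x \<in> P then ennreal (a x) else 0) \<pi>"
      by (intro arg_cong2[of _ _ _ _ bsum] ext) (auto simp: a_def cprob_def)
    then show "bsum (\<lambda>x. ennreal (cprob x (if x \<in> P then HA x else {}))) \<pi> \<le> ennreal 2"
      using P(1)[of \<pi>] by simp
  qed (use A in auto)
  moreover have "AE \<pi> in coin_measure. io \<pi> (\<lambda>x. x \<in> P \<and> \<pi> \<in> HB x) \<longrightarrow> io \<pi> (\<lambda>x. x \<in> P \<and> \<pi> \<in> HA x)"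
    using L PS by blast
  moreover have "AE \<pi> in coin_measure.
      bsum (\<lambda>x. if x \<in> P then ennreal (cprob x (HB x)) else 0) \<pi> = \<infinity> \<longrightarrow> io \<pi> (\<lambda>x. x \<in> P \<and> \<pi> \<in> HB x)"
    using B(1) settled_subset[OF B(2) PS] by (rule borel_cantelli_infinite)
  ultimately show ?R
  proof eventually_elim
    case (elim \<pi>)
    have "\<not> io \<pi> (\<lambda>x. x \<in> P \<and> \<pi> \<in> HA x)"
      using elim(1) io_mono[of \<pi> "\<lambda>x. x \<in> P \<and> \<pi> \<in> HA x" "\<lambda>x. \<pi> \<in> (if x \<in> P then HA x else {})"] by auto
    with elim have "bsum (\<lambda>x. if x \<in> P then ennreal (cprob x (HB x)) else 0) \<pi> \<noteq> \<infinity>" by blast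
    moreover have "(\<lambda>x. if x \<in> P then ennreal (cprob x (HB x)) else 0) = (\<lambda>x. if x \<in> P then ennreal (b x) else 0)"
      using PS by (auto simp: b_def fun_eq_iff)
    ultimately have fin: "bsum (\<lambda>x. if x \<in> P then ennreal (b x) else 0) \<pi> < \<infinity>"
      by (simp add: less_top)
    from P(3)[OF this] obtain C where C: "C \<ge> 0" "\<And>x. x \<in> nodes_of \<pi> \<Longrightarrow> b x > C * a x \<Longrightarrow> x \<in> P" by blast
    have "bsum (\<lambda>x. if x \<in> S \<and> cprob x (HB x) > C * cprob x (HA x) then ennreal (cprob x (HB x)) else 0) \<pi>
        \<le> bsum (\<lambda>x. if x \<in> P then ennreal (b x) else 0) \<pi>"
      using C(2) by (intro bsum_mono) (auto simp: a_def b_def)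
    with fin C(1) show ?case by (intro exI[of _ C]) (auto intro: le_less_trans)
  qed
next
  assume R: ?R
  show ?L
  proof (intro allI impI)
    fix P assume PS: "P \<subseteq> S"
    have "AE \<pi> in coin_measure. bsum (\<lambda>x. ennreal (cprob x (if x \<in> P then HB x else {}))) \<pi> < \<infinity> \<longrightarrow>
        \<not> io \<pi> (\<lambda>x. \<pi> \<in> (if x \<in> P then HB x else {}))"
      using B by (intro borel_cantelli_finite) auto
    moreover have "AE \<pi> in coin_measure.
      bsum (\<lambda>x. if x \<in> P then ennreal (cprob x (HA x)) else 0) \<pi> = \<infinity> \<longrightarrow> io \<pi> (\<lambda>x. x \<in> P \<and> \<pi> \<in> HA x)"
      using A(1) settled_subset[OF A(2) PS] by (rule borel_cantelli_infinite)
    ultimately show "AE \<pi> in coin_measure. io \<pi> (\<lambda>x. x \<in> P \<and> \<pi> \<in> HB x) \<longrightarrow> io \<pi> (\<lambda>x. x \<in> P \<and> \<pi> \<in> HA x)"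
      using R
    proof eventually_elim
      case (elim \<pi>)
      show ?case
      proof
        assume "io \<pi> (\<lambda>x. x \<in> P \<and> \<pi> \<in> HB x)"
        then have "io \<pi> (\<lambda>x. \<pi> \<in> (if x \<in> P then HB x else {}))" by (rule io_mono) auto
        with elim(1) have "bsum (\<lambda>x. ennreal (cprob x (if x \<in> P then HB x else {}))) \<pi> = \<infinity>"
          by (auto simp: less_top[symmetric])
        also have "(\<lambda>x. ennreal (cprob x (if x \<in> P then HB x else {}))) = (\<lambda>x. if x \<in> P then ennreal (cprob x (HB x)) else 0)"
          by (auto simp: cprob_def)
        finally have inf: "bsum (\<lambda>x. if x \<in> P then ennreal (cprob x (HB x)) else 0) \<pi> = \<infinity>" .
        obtain C where C: "C \<ge> 0" "bsum (\<lambda>x. if x \<in> S \<and> cprob x (HB x) > C * cprob x (HA x)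
            then ennreal (cprob x (HB x)) else 0) \<pi> < \<infinity>" (is "bsum ?G \<pi> < _") using elim(3) by blast
        \<comment> \<open>Off the exceptional nodes \<open>HB\<close> is at most \<open>C\<close>
          times \<open>HA\<close>, and the exceptional ones have a finite sum, so divergence passes
          from \<open>HB\<close> to \<open>HA\<close>.\<close>
        have "bsum (\<lambda>x. if x \<in> P then ennreal (cprob x (HB x)) else 0) \<pi>
            \<le> bsum (\<lambda>x. ?G x + ennreal C * (if x \<in> P then ennreal (cprob x (HA x)) else 0)) \<pi>"
          using PS C(1) by (intro bsum_mono) (auto simp: ennreal_mult[symmetric] intro!: ennreal_leI)
        also have "\<dots> = bsum ?G \<pi> + ennreal C * bsum (\<lambda>x. if x \<in> P then ennreal (cprob x (HA x)) else 0) \<pi>"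
          by (simp only: bsum_add bsum_cmult)
        finally have "bsum ?G \<pi> + ennreal C * bsum (\<lambda>x. if x \<in> P then ennreal (cprob x (HA x)) else 0) \<pi> = \<infinity>"
          using inf by (simp add: top_unique)
        then have "bsum (\<lambda>x. if x \<in> P then ennreal (cprob x (HA x)) else 0) \<pi> = \<infinity>"
          using C(2) by (auto simp: ennreal_mult_eq_top_iff)
        with elim(2) show "io \<pi> (\<lambda>x. x \<in> P \<and> \<pi> \<in> HA x)" by blast
      qed
    qed
  qed
qed

lemma sum_half_powers: "(\<Sum>k<n. (1/2) ^ Suc k) = 1 - (1/2 :: real) ^ n"
  by (induction n) simp_all

lemma sum_half_powers_from: "(\<Sum>j=m..n. (1/2 :: real) ^ Suc j) \<le> (1/2) ^ m"
proof (cases "m \<le> n")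
  case True
  then have "(\<Sum>j=m..n. (1/2 :: real) ^ Suc j) = (1/2) ^ m - (1/2) ^ Suc n"
    by (induction n rule: dec_induct) (simp_all add: sum.atLeast_Suc_atMost)
  then show ?thesis by simp
qed simp

section \<open>Families of intervals\<close>

text \<open>Recovers the intervals from their end points: a target belongs to the last source above
  it. A source at \<open>y\<close> itself is excluded too, as intervals contain both ends.\<close>

definition matched :: "node set \<Rightarrow> node set \<Rightarrow> node \<Rightarrow> node \<Rightarrow> bool" where
  "matched X Y x y \<longleftrightarrow> x \<in> X \<and> y \<in> Y \<and> strict_prefix x y \<and>
    (\<forall>u\<in>X. \<not> (strict_prefix x u \<and> prefix u y))"

definition is_family :: "node set \<Rightarrow> node set \<Rightarrow> bool" where
  "is_family X Y \<longleftrightarrow> (\<forall>x\<in>X. \<exists>y. matched X Y x y) \<and> (\<forall>y\<in>Y. \<exists>x. matched X Y x y) \<and>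
    (\<forall>x y x' y' u. matched X Y x y \<longrightarrow> matched X Y x' y' \<longrightarrow>
      prefix x u \<longrightarrow> prefix u y \<longrightarrow> prefix x' u \<longrightarrow> prefix u y' \<longrightarrow> x = x' \<and> y = y')"

lemma is_familyD:
  assumes "is_family X Y" "matched X Y x y" "matched X Y x' y'"
    "prefix x u" "prefix u y" "prefix x' u" "prefix u y'"
  shows "x = x' \<and> y = y'"
  using assms unfolding is_family_def by blast

definition target_of :: "node set \<Rightarrow> node set \<Rightarrow> node \<Rightarrow> node" where
  "target_of X Y x = (THE y. matched X Y x y)"

definition len_of :: "node set \<Rightarrow> node set \<Rightarrow> node \<Rightarrow> nat" where
  "len_of X Y x = length (target_of X Y x) - length x - 1"

lemma interval_inject:
  assumes "interval x y = interval x' y'" "prefix x y" "prefix x' y'"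
  shows "x = x' \<and> y = y'"
proof -
  have "x \<in> interval x' y'" "y \<in> interval x' y'" using assms by (auto simp: interval_def)
  moreover have "x' \<in> interval x y" "y' \<in> interval x y" using assms by (auto simp: interval_def)
  ultimately show ?thesis by (auto simp: interval_def intro: prefix_order.antisym)
qed

lemma interval_length_eq: "strict_prefix x y \<Longrightarrow> interval_length x y = length y - length x - 1"
proof -
  assume xy: "strict_prefix x y"
  have "{z. strict_prefix x z \<and> strict_prefix z y} = (\<lambda>k. take k y) ` {length x<..<length y}"
  proof (intro equalityI subsetI)
    fix z assume "z \<in> {z. strict_prefix x z \<and> strict_prefix z y}"
    then have z: "strict_prefix x z" "strict_prefix z y" by auto
    then have "z = take (length z) y" by (auto simp: strict_prefix_def prefix_def)
    then show "z \<in> (\<lambda>k. take k y) ` {length x<..<length y}"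
      using prefix_length_less[OF z(1)] prefix_length_less[OF z(2)] by (intro image_eqI) auto
  next
    fix z assume "z \<in> (\<lambda>k. take k y) ` {length x<..<length y}"
    then obtain k where k: "z = take k y" "length x < k" "k < length y" by auto
    from xy obtain r where r: "y = x @ r" by (auto simp: strict_prefix_def prefix_def)
    have "strict_prefix x z" using k r by (auto simp: strict_prefix_def)
    moreover have "strict_prefix z y"
      using k by (auto simp: strict_prefix_def take_is_prefix)
    ultimately show "z \<in> {z. strict_prefix x z \<and> strict_prefix z y}" by blast
  qed
  moreover have "inj_on (\<lambda>k. take k y) {length x<..<length y}"
    by (rule inj_on_inverseI[where g = length]) auto
  ultimately show ?thesis
    by (simp add: interval_length_def card_image)
qed

text \<open>If \<open>x\<close> is matched with \<open>y\<close> and the interval ending in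
  \<open>y\<close> starts at \<open>x'\<close>, then \<open>x'\<close> cannot lie strictly below
  \<open>x\<close>. So \<open>x\<close> lies in that interval as well as in its own, and
  disjointness makes them equal.\<close>

lemma matched_sources_targets:
  assumes I: "interval_family \<I>"
  shows "matched (sources \<I>) (targets \<I>) x y \<longleftrightarrow> strict_prefix x y \<and> interval x y \<in> \<I>"
proof -
  have disj: "interval x y = interval x' y'"
    if "interval x y \<in> \<I>" "interval x' y' \<in> \<I>" "u \<in> interval x y" "u \<in> interval x' y'" for x y x' y' u
    using I that unfolding interval_family_def disjoint_def by blast
  have same: "x = x'"
    if "interval x y \<in> \<I>" "interval x' y' \<in> \<I>" "u \<in> interval x y" "u \<in> interval x' y'"
      "strict_prefix x y" "strict_prefix x' y'" for x y x' y' u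
    using interval_inject disj[OF that(1-4)] that(5,6) by (auto simp: strict_prefix_def)
  show ?thesis
  proof
    assume m: "matched (sources \<I>) (targets \<I>) x y"
    then obtain x' where x': "strict_prefix x' y" "interval x' y \<in> \<I>"
      by (auto simp: matched_def targets_def)
    obtain w where w: "strict_prefix x w" "interval x w \<in> \<I>"
      using m by (auto simp: matched_def sources_def)
    have xy: "strict_prefix x y" using m by (simp add: matched_def)
    have "x' \<in> sources \<I>" using x' by (auto simp: sources_def)
    then have "\<not> strict_prefix x x'" using m x'(1) by (auto simp: matched_def strict_prefix_def)
    moreover have "prefix x x' \<or> prefix x' x"
      using xy x'(1) by (meson prefix_same_cases strict_prefix_def)
    ultimately consider "x' = x" | "prefix x' x" by (auto simp: strict_prefix_def)
    then have "x' = x"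
    proof cases
      case 2
      then show ?thesis
        using same[OF x'(2) w(2), of x] x'(1) w(1) xy by (auto simp: interval_def strict_prefix_def)
    qed
    with x' show "strict_prefix x y \<and> interval x y \<in> \<I>" by blast
  next
    assume xy: "strict_prefix x y \<and> interval x y \<in> \<I>"
    have "\<not> (strict_prefix x u \<and> prefix u y)" if "u \<in> sources \<I>" for u
    proof
      assume u: "strict_prefix x u \<and> prefix u y"
      obtain w where w: "strict_prefix u w" "interval u w \<in> \<I>" using \<open>u \<in> sources \<I>\<close> by (auto simp: sources_def)
      have "x = u"
        using same[of x y u w u] xy w u by (auto simp: interval_def strict_prefix_def)
      with u show False by simp
    qed
    with xy show "matched (sources \<I>) (targets \<I>) x y"
      by (auto simp: matched_def sources_def targets_def)
  qed
qed

lemma is_family_iff: "is_family X Y \<longleftrightarrow> (\<exists>\<I>. interval_family \<I> \<and> X = sources \<I> \<and> Y = targets \<I>)"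
proof
  assume F: "is_family X Y"
  define \<I> where "\<I> = {interval x y | x y. matched X Y x y}"
  have eq: "strict_prefix x y \<and> interval x y \<in> \<I> \<longleftrightarrow> matched X Y x y" for x y
  proof
    assume xy: "strict_prefix x y \<and> interval x y \<in> \<I>"
    then obtain x' y' where *: "interval x y = interval x' y'" "matched X Y x' y'" by (auto simp: \<I>_def)
    then have "x = x' \<and> y = y'"
      using xy by (intro interval_inject) (auto simp: matched_def strict_prefix_def)
    with * show "matched X Y x y" by simp
  qed (auto simp: \<I>_def matched_def)
  have "interval_family \<I>"
    unfolding interval_family_def
  proof
    show "\<forall>I\<in>\<I>. \<exists>x y. strict_prefix x y \<and> I = interval x y"
      by (auto simp: \<I>_def matched_def)
    show "disjoint \<I>"
      unfolding disjoint_def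
    proof (intro ballI impI)
      fix I J assume "I \<in> \<I>" "J \<in> \<I>" "I \<noteq> J"
      then obtain x y x' y' where xy: "I = interval x y" "matched X Y x y" "J = interval x' y'" "matched X Y x' y'"
        by (auto simp: \<I>_def)
      have "u \<notin> J" if "u \<in> I" for u
      proof
        assume "u \<in> J"
        then have "x = x' \<and> y = y'"
          using that xy(1,3) by (intro is_familyD[OF F xy(2,4), of u]) (auto simp: interval_def)
        with \<open>I \<noteq> J\<close> xy show False by simp
      qed
      then show "I \<inter> J = {}" by blast
    qed
  qed
  moreover have "sources \<I> = X" "targets \<I> = Y"
    unfolding sources_def targets_def eq using F by (auto simp: is_family_def matched_def)
  ultimately show "\<exists>\<I>. interval_family \<I> \<and> X = sources \<I> \<and> Y = targets \<I>" by blast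
next
  assume "\<exists>\<I>. interval_family \<I> \<and> X = sources \<I> \<and> Y = targets \<I>"
  then obtain \<I> where \<I>: "interval_family \<I>" "X = sources \<I>" "Y = targets \<I>" by blast
  note m = matched_sources_targets[OF \<I>(1), folded \<I>(2,3)]
  show "is_family X Y"
    unfolding is_family_def
  proof (intro conjI allI impI)
    show "\<forall>x\<in>X. \<exists>y. matched X Y x y" "\<forall>y\<in>Y. \<exists>x. matched X Y x y"
      unfolding m by (auto simp: \<I> sources_def targets_def)
  next
    fix x y x' y' u
    assume *: "matched X Y x y" "matched X Y x' y'" "prefix x u" "prefix u y" "prefix x' u" "prefix u y'"
    then have "interval x y \<in> \<I>" "interval x' y' \<in> \<I>" "u \<in> interval x y \<inter> interval x' y'"
      by (auto simp: m interval_def)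
    then have "interval x y = interval x' y'"
      using \<I>(1) unfolding interval_family_def disjoint_def by blast
    with * show "x = x'" "y = y'" using interval_inject[of x y x' y'] by (auto simp: m strict_prefix_def)
  qed
qed

locale interval_nodes =
  fixes X Y :: "node set"
  assumes family: "is_family X Y"
begin

abbreviation match where "match \<equiv> matched X Y"
abbreviation tgt where "tgt \<equiv> target_of X Y"
abbreviation len where "len \<equiv> len_of X Y"

lemma match_unique: "match x y \<Longrightarrow> match x y' \<Longrightarrow> y = y'"
proof -
  assume *: "match x y" "match x y'"
  then have "prefix x y" "prefix x y'" by (auto simp: matched_def strict_prefix_def)
  with is_familyD[OF family *, of x] show "y = y'" by simp
qed

lemma match_tgt: "x \<in> X \<Longrightarrow> match x (tgt x)"
  unfolding target_of_def using family match_unique by (metis is_family_def theI')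

lemma match_iff: "match x y \<longleftrightarrow> x \<in> X \<and> y = tgt x"
  using match_tgt match_unique by (auto simp: matched_def)

lemma tgt_strict: "x \<in> X \<Longrightarrow> strict_prefix x (tgt x)"
  using match_tgt by (auto simp: matched_def)

lemma length_tgt: "x \<in> X \<Longrightarrow> length (tgt x) = length x + len x + 1"
  using prefix_length_less[OF tgt_strict, of x] by (simp add: len_of_def)

lemma no_source_inside: "x \<in> X \<Longrightarrow> u \<in> X \<Longrightarrow> strict_prefix x u \<Longrightarrow> \<not> prefix u (tgt x)"
  using match_tgt by (auto simp: matched_def)

end

definition settles :: "node set \<Rightarrow> node set \<Rightarrow> branch \<Rightarrow> bool" where
  "settles X Y \<pi> \<longleftrightarrow> io \<pi> (\<lambda>x. x \<in> X) \<and> (\<exists>c. \<not> io \<pi> (\<lambda>x. x \<in> X \<and> len_of X Y x \<noteq> c))"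

lemma eventually_constant_iff_settles:
  assumes "interval_family \<I>"
  shows "eventually_constant (lengths_along \<I> \<pi>) \<longleftrightarrow> settles (sources \<I>) (targets \<I>) \<pi>"
proof -
  define D where "D = source_depths \<I> \<pi>"
  have D: "n \<in> D \<longleftrightarrow> branch_node \<pi> n \<in> sources \<I>" for n by (simp add: D_def source_depths_def)
  interpret interval_nodes "sources \<I>" "targets \<I>"
    using assms by unfold_locales (auto simp: is_family_iff)
  have len: "length_at \<I> x = len x" if "x \<in> sources \<I>" for x
    using tgt_strict[OF that]
    unfolding length_at_def matched_sources_targets[OF assms, symmetric] target_of_def[symmetric] len_of_def
    by (rule interval_length_eq)
  have io: "io \<pi> (\<lambda>x. x \<in> sources \<I>) \<longleftrightarrow> infinite D"
    by (simp add: io_iff_infinite D_def source_depths_def)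
  show ?thesis
  proof (cases "infinite D")
    case False
    then have "lengths_along \<I> \<pi> (card D) = None"
      by (simp add: lengths_along_def D_def[symmetric])
    then show ?thesis
      using False io by (auto simp: eventually_constant_def settles_def)
  next
    case True
    let ?e = "enumerate D"
    have e: "?e k \<in> D" for k using True by (rule enumerate_in_set)
    have s: "lengths_along \<I> \<pi> k = Some (len (branch_node \<pi> (?e k)))" for k
      using True e[of k] by (simp add: lengths_along_def D_def[symmetric] len D[symmetric])
    have "finite {k. lengths_along \<I> \<pi> k \<noteq> Some c} \<longleftrightarrow> \<not> io \<pi> (\<lambda>x. x \<in> sources \<I> \<and> len x \<noteq> c)" for c
    proof -
      have "{n. branch_node \<pi> n \<in> sources \<I> \<and> len (branch_node \<pi> n) \<noteq> c} = ?e ` {k. lengths_along \<I> \<pi> k \<noteq> Some c}"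
        using e bij_enumerate[OF True] by (force simp: D[symmetric] s bij_betw_def)
      moreover have "inj_on ?e A" for A
        using bij_enumerate[OF True] by (auto simp: bij_betw_def intro: inj_on_subset)
      ultimately show ?thesis by (simp add: io_iff_infinite finite_image_iff)
    qed
    then show ?thesis
      using io True by (simp add: eventually_constant_def settles_def) (simp add: s)
  qed
qed

section \<open>The properties expressed by the formula\<close>

text \<open>Read \<open>T\<close> as a set of labels below the exits of the intervals whose sources form \<open>Z\<close>, and \<open>E\<close>
  as a choice of nodes in these intervals. The deeper the choice at \<open>x\<close>, the less likely a hit.\<close>

definition hits :: "node set \<Rightarrow> node set \<Rightarrow> node set \<Rightarrow> node set \<Rightarrow> node set \<Rightarrow> node \<Rightarrow> node \<Rightarrow> bool" where
  "hits X Y Z T E x t \<longleftrightarrow> t \<in> T \<and>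
    (\<exists>z\<in>E. \<exists>y. matched X Y x y \<and> prefix x z \<and> strict_prefix z y \<and> prefix z t) \<and>
    (\<forall>u\<in>Z. strict_prefix x u \<longrightarrow> \<not> prefix u t)"

text \<open>The event is attached to \<open>x\<close> although it takes place at the next selected
  source. Its conditional probability at \<open>x\<close> thus averages over all candidates
  \<open>w\<close> below \<open>x\<close>, including those off the branch under
  consideration.\<close>

definition hits_next ::
  "node set \<Rightarrow> node set \<Rightarrow> node set \<Rightarrow> node set \<Rightarrow> node set \<Rightarrow> node set \<Rightarrow> node \<Rightarrow> node \<Rightarrow> bool" where
  "hits_next X Y A Z T E x t \<longleftrightarrow> (\<exists>w\<in>Z. w \<notin> A \<and> strict_prefix x w \<and>
    (\<forall>u\<in>Z. strict_prefix x u \<longrightarrow> \<not> strict_prefix u w) \<and> hits X Y Z T E w t)"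

definition tame :: "node set \<Rightarrow> node set \<Rightarrow> node set \<Rightarrow> node set \<Rightarrow> node set \<Rightarrow> node set \<Rightarrow> bool" where
  "tame X Y A Z T E \<longleftrightarrow> (\<forall>P\<subseteq>Z \<inter> A. AE \<pi> in coin_measure.
    io \<pi> (\<lambda>x. x \<in> P \<and> (\<exists>t\<in>nodes_of \<pi>. hits_next X Y A Z T E x t)) \<longrightarrow>
    io \<pi> (\<lambda>x. x \<in> P \<and> (\<exists>t\<in>nodes_of \<pi>. hits X Y Z T E x t)))"

text \<open>\<open>E\<close> may contain several nodes of an interval, and only the topmost counts
  as the pick. So it suffices to take all nodes of the interval strictly below some node of
  \<open>E\<close>: the topmost of them is one step further down. The second alternative keeps a
  pick that has reached the last node before the target, which is the source itself if the length is
  0.\<close>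

definition advance :: "node set \<Rightarrow> node set \<Rightarrow> node set \<Rightarrow> node set \<Rightarrow> node set" where
  "advance X Y Z E = {z. \<exists>x\<in>Z. \<exists>y. matched X Y x y \<and> prefix x z \<and> strict_prefix z y \<and>
    ((\<exists>z'\<in>E. prefix x z' \<and> strict_prefix z' z) \<or>
     (z \<in> E \<and> \<not> (\<exists>u. strict_prefix z u \<and> strict_prefix u y)))}"

definition movable :: "node set \<Rightarrow> node set \<Rightarrow> node set \<Rightarrow> node \<Rightarrow> bool" where
  "movable X Y E x \<longleftrightarrow> (\<exists>z\<in>E. \<exists>y u. matched X Y x y \<and> prefix x z \<and> strict_prefix z u \<and> strict_prefix u y)"

definition separates :: "node set \<Rightarrow> node set \<Rightarrow> node set \<Rightarrow> node set \<Rightarrow> node set \<Rightarrow> branch \<Rightarrow> bool" where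
  "separates X Y A Z E \<pi> \<longleftrightarrow> io \<pi> (\<lambda>x. x \<in> Z) \<and>
    \<not> io \<pi> (\<lambda>x. x \<in> Z \<and> x \<in> A \<and> movable X Y E x) \<and>
    \<not> io \<pi> (\<lambda>x. x \<in> Z \<and> x \<notin> A \<and> \<not> movable X Y E x)"

text \<open>The parameters \<open>Z\<close> and \<open>T\<close> describe the class of sets
  \<open>E\<close>. The first clause ties \<open>Z\<close> to the branches where \<open>A\<close>
  and its complement both recur; otherwise an empty \<open>Z\<close> would satisfy the last clause
  trivially.\<close>

definition certified :: "node set \<Rightarrow> node set \<Rightarrow> bool" where
  "certified X Y \<longleftrightarrow> (\<forall>A\<subseteq>X. \<exists>Z\<subseteq>X. \<exists>T.
    (AE \<pi> in coin_measure. io \<pi> (\<lambda>x. x \<in> A) \<and> io \<pi> (\<lambda>x. x \<in> X \<and> x \<notin> A) \<longrightarrow> io \<pi> (\<lambda>x. x \<in> Z)) \<and>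
    tame X Y A Z T Z \<and>
    (\<forall>E. tame X Y A Z T E \<longrightarrow>
      tame X Y A Z T (advance X Y Z E) \<and> (AE \<pi> in coin_measure. \<not> separates X Y A Z E \<pi>)))"

definition recurrent :: "node set \<Rightarrow> node set \<Rightarrow> bool" where
  "recurrent X Y \<longleftrightarrow> (\<forall>J\<subseteq>X. AE \<pi> in coin_measure.
    io \<pi> (\<lambda>x. x \<in> J) \<longrightarrow> io \<pi> (\<lambda>x. x \<in> J \<and> (\<exists>y\<in>nodes_of \<pi>. matched X Y x y)))"

section \<open>Positions in an interval and soundness of the certificate\<close>

context interval_nodes
begin

text \<open>Positions \<open>0\<close> to \<open>len x\<close> are the source and the interior;
  position \<open>len x + 1\<close> is the target.\<close>

definition nth_node :: "node \<Rightarrow> nat \<Rightarrow> node" where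
  "nth_node x k = take (length x + k) (tgt x)"

lemma length_nth_node: "x \<in> X \<Longrightarrow> k \<le> len x + 1 \<Longrightarrow> length (nth_node x k) = length x + k"
  by (simp add: nth_node_def length_tgt)

lemma nth_node_0: "x \<in> X \<Longrightarrow> nth_node x 0 = x"
  using tgt_strict[of x] by (auto simp: nth_node_def strict_prefix_def prefix_def)

lemma nth_node_prefix_tgt: "prefix (nth_node x k) (tgt x)"
  by (simp add: nth_node_def take_is_prefix)

lemma nth_node_mono: "k \<le> l \<Longrightarrow> prefix (nth_node x k) (nth_node x l)"
  unfolding nth_node_def by (metis add_left_mono take_is_prefix take_take min.absorb1)

lemma prefix_nth_node: "x \<in> X \<Longrightarrow> prefix x (nth_node x k)"
  using nth_node_mono[of 0 k x] by (simp add: nth_node_0)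

lemma nth_node_strict_tgt: "x \<in> X \<Longrightarrow> k \<le> len x \<Longrightarrow> strict_prefix (nth_node x k) (tgt x)"
  using nth_node_prefix_tgt[of x k] length_nth_node[of x k] length_tgt[of x] by (auto simp: strict_prefix_def)

lemma nth_node_strict_mono_iff:
  assumes "x \<in> X" "k \<le> len x + 1" "l \<le> len x + 1"
  shows "strict_prefix (nth_node x k) (nth_node x l) \<longleftrightarrow> k < l"
proof
  assume "strict_prefix (nth_node x k) (nth_node x l)"
  from prefix_length_less[OF this] show "k < l" using assms by (simp add: length_nth_node)
next
  assume "k < l"
  then show "strict_prefix (nth_node x k) (nth_node x l)"
    using nth_node_mono[of k l x] length_nth_node[of x k] length_nth_node[of x l] assms
    by (auto simp: strict_prefix_def)
qed

lemma nth_node_cases: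
  assumes "x \<in> X" "prefix x z" "strict_prefix z (tgt x)"
  obtains k where "k \<le> len x" "z = nth_node x k"
proof
  show "length z - length x \<le> len x"
    using prefix_length_less[OF assms(3)] length_tgt[OF assms(1)] by simp
  have "length x \<le> length z" using assms(2) by (rule prefix_length_le)
  then show "z = nth_node x (length z - length x)"
    using assms(3) by (auto simp: nth_node_def strict_prefix_def prefix_def)
qed

lemma ex_nth_node_iff:
  "x \<in> X \<Longrightarrow> (\<exists>z\<in>E. \<exists>y. matched X Y x y \<and> prefix x z \<and> strict_prefix z y \<and> Q z y) \<longleftrightarrow>
    (\<exists>k\<le>len x. nth_node x k \<in> E \<and> Q (nth_node x k) (tgt x))"
proof
  assume x: "x \<in> X" and "\<exists>z\<in>E. \<exists>y. matched X Y x y \<and> prefix x z \<and> strict_prefix z y \<and> Q z y"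
  then obtain z where z: "z \<in> E" "prefix x z" "strict_prefix z (tgt x)" "Q z (tgt x)"
    by (auto simp: match_iff)
  with nth_node_cases[OF x z(2,3)] show "\<exists>k\<le>len x. nth_node x k \<in> E \<and> Q (nth_node x k) (tgt x)" by metis
next
  assume x: "x \<in> X" and "\<exists>k\<le>len x. nth_node x k \<in> E \<and> Q (nth_node x k) (tgt x)"
  then show "\<exists>z\<in>E. \<exists>y. matched X Y x y \<and> prefix x z \<and> strict_prefix z y \<and> Q z y"
    using match_tgt prefix_nth_node nth_node_strict_tgt by blast
qed

lemma movable_iff: "x \<in> X \<Longrightarrow> movable X Y E x \<longleftrightarrow> (\<exists>k<len x. nth_node x k \<in> E)"
proof
  assume x: "x \<in> X" and "movable X Y E x"
  then obtain z u where z: "z \<in> E" "prefix x z" "strict_prefix z u" "strict_prefix u (tgt x)"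
    by (auto simp: movable_def match_iff)
  have "strict_prefix z (tgt x)" using z(3,4) by (rule prefix_order.less_trans)
  with nth_node_cases[OF x z(2)] obtain k where k: "k \<le> len x" "z = nth_node x k" by blast
  have "prefix x u" using z(2,3) by (auto simp: strict_prefix_def)
  with nth_node_cases[OF x _ z(4)] obtain l where l: "l \<le> len x" "u = nth_node x l" by blast
  have "k < l" using z(3) k l x by (simp add: nth_node_strict_mono_iff)
  with l have "k < len x" by simp
  with k z(1) show "\<exists>k<len x. nth_node x k \<in> E" by blast
next
  assume x: "x \<in> X" and "\<exists>k<len x. nth_node x k \<in> E"
  then obtain k where k: "k < len x" "nth_node x k \<in> E" by blast
  have "strict_prefix (nth_node x k) (nth_node x (len x))" using x k by (simp add: nth_node_strict_mono_iff)
  then show "movable X Y E x"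
    unfolding movable_def using k x match_tgt prefix_nth_node nth_node_strict_tgt[OF x order_refl] by blast
qed

lemma advance_iff:
  assumes "Z \<subseteq> X" "x \<in> Z" "k \<le> len x"
  shows "nth_node x k \<in> advance X Y Z E \<longleftrightarrow> (\<exists>j<k. nth_node x j \<in> E) \<or> (nth_node x k \<in> E \<and> k = len x)"
proof -
  have x: "x \<in> X" using assms by blast
  have "nth_node x k \<in> advance X Y Z E \<longleftrightarrow> (\<exists>z'\<in>E. prefix x z' \<and> strict_prefix z' (nth_node x k)) \<or>
     (nth_node x k \<in> E \<and> \<not> (\<exists>u. strict_prefix (nth_node x k) u \<and> strict_prefix u (tgt x)))"
  proof -
    have "x' = x" if "x' \<in> Z" "matched X Y x' y" "prefix x' (nth_node x k)" "strict_prefix (nth_node x k) y" for x' y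
      using is_familyD[OF family that(2) match_tgt[OF x] that(3)] that(4) nth_node_prefix_tgt prefix_nth_node[OF x]
      by (auto simp: strict_prefix_def)
    then show ?thesis
      unfolding advance_def using x assms(2) match_tgt[OF x] prefix_nth_node[OF x] nth_node_strict_tgt[OF x assms(3)]
      by (auto simp: match_iff)
  qed
  moreover have "(\<exists>z'\<in>E. prefix x z' \<and> strict_prefix z' (nth_node x k)) \<longleftrightarrow> (\<exists>j<k. nth_node x j \<in> E)"
  proof
    assume "\<exists>z'\<in>E. prefix x z' \<and> strict_prefix z' (nth_node x k)"
    then obtain z' where z': "z' \<in> E" "prefix x z'" "strict_prefix z' (nth_node x k)" by blast
    have "strict_prefix z' (tgt x)"
      using z'(3) nth_node_strict_tgt[OF x assms(3)] by (rule prefix_order.less_trans)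
    with nth_node_cases[OF x z'(2)] obtain j where j: "j \<le> len x" "z' = nth_node x j" by blast
    then show "\<exists>j<k. nth_node x j \<in> E" using z' x assms(3) by (auto simp: nth_node_strict_mono_iff)
  next
    assume "\<exists>j<k. nth_node x j \<in> E"
    then show "\<exists>z'\<in>E. prefix x z' \<and> strict_prefix z' (nth_node x k)"
      using x assms(3) prefix_nth_node[OF x] by (metis nth_node_strict_mono_iff le_add1 le_trans less_imp_le_nat)
  qed
  moreover have "\<not> (\<exists>u. strict_prefix (nth_node x k) u \<and> strict_prefix u (tgt x)) \<longleftrightarrow> k = len x"
  proof
    assume *: "\<not> (\<exists>u. strict_prefix (nth_node x k) u \<and> strict_prefix u (tgt x))"
    show "k = len x"
    proof (rule ccontr)
      assume "k \<noteq> len x"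
      then have "strict_prefix (nth_node x k) (nth_node x (len x))"
        using x assms(3) by (simp add: nth_node_strict_mono_iff)
      with * nth_node_strict_tgt[OF x order_refl] show False by blast
    qed
  next
    assume k: "k = len x"
    show "\<not> (\<exists>u. strict_prefix (nth_node x k) u \<and> strict_prefix u (tgt x))"
    proof
      assume "\<exists>u. strict_prefix (nth_node x k) u \<and> strict_prefix u (tgt x)"
      then obtain u where "strict_prefix (nth_node x k) u" "strict_prefix u (tgt x)" by blast
      from this[THEN prefix_length_less] show False
        using k x by (simp add: length_nth_node length_tgt)
    qed
  qed
  ultimately show ?thesis by simp
qed

text \<open>The invariant tracks the topmost pick: it starts at position 0, moves down by one in
  each round and stalls at position \<open>len x\<close>.\<close>

lemma advance_power:
  assumes "Z \<subseteq> X" "x \<in> Z"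
  shows "nth_node x (min j (len x)) \<in> (advance X Y Z ^^ j) Z \<and>
    (\<forall>k\<le>len x. nth_node x k \<in> (advance X Y Z ^^ j) Z \<longrightarrow> min j (len x) \<le> k)"
proof (induction j)
  case 0
  have "x \<in> X" using assms by blast
  then show ?case using assms by (simp add: nth_node_0)
next
  case (Suc j)
  show ?case
  proof (intro conjI allI impI)
    show "nth_node x (min (Suc j) (len x)) \<in> (advance X Y Z ^^ Suc j) Z"
    proof (cases "j < len x")
      case True
      then have "nth_node x j \<in> (advance X Y Z ^^ j) Z" using Suc by (simp add: min_def)
      with True show ?thesis by (auto simp: advance_iff[OF assms] min_def)
    next
      case False
      with Suc show ?thesis by (auto simp: advance_iff[OF assms] min_def split: if_splits)
    qed
    fix k assume k: "k \<le> len x" "nth_node x k \<in> (advance X Y Z ^^ Suc j) Z"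
    then consider i where "i < k" "nth_node x i \<in> (advance X Y Z ^^ j) Z" | "k = len x"
      by (auto simp: advance_iff[OF assms])
    then show "min (Suc j) (len x) \<le> k"
    proof cases
      case 1
      then have "min j (len x) \<le> i" using Suc k by simp
      with 1 show ?thesis by simp
    qed simp
  qed
qed

text \<open>With \<open>A\<close> the sources of length at most \<open>k\<close>, the
  \<open>k\<close>-th iterate of \<open>advance\<close> on \<open>Z\<close> belongs to the class. It
  separates on every branch where \<open>Z\<close> recurs, so almost surely \<open>Z\<close> does
  not recur, and neither do both \<open>A\<close> and its complement.\<close>

lemma len_not_separated:
  assumes "certified X Y"
  shows "AE \<pi> in coin_measure. \<not> (io \<pi> (\<lambda>x. x \<in> X \<and> len x \<le> k) \<and> io \<pi> (\<lambda>x. x \<in> X \<and> k < len x))"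
proof -
  define A where "A = {x\<in>X. len x \<le> k}"
  have "A \<subseteq> X" by (auto simp: A_def)
  then have "\<exists>Z\<subseteq>X. \<exists>T.
    (AE \<pi> in coin_measure. io \<pi> (\<lambda>x. x \<in> A) \<and> io \<pi> (\<lambda>x. x \<in> X \<and> x \<notin> A) \<longrightarrow> io \<pi> (\<lambda>x. x \<in> Z)) \<and>
    tame X Y A Z T Z \<and>
    (\<forall>E. tame X Y A Z T E \<longrightarrow>
      tame X Y A Z T (advance X Y Z E) \<and> (AE \<pi> in coin_measure. \<not> separates X Y A Z E \<pi>))"
    using assms unfolding certified_def by (elim allE impE) assumption+
  then obtain Z T where Z: "Z \<subseteq> X"
    and ae: "AE \<pi> in coin_measure. io \<pi> (\<lambda>x. x \<in> A) \<and> io \<pi> (\<lambda>x. x \<in> X \<and> x \<notin> A) \<longrightarrow> io \<pi> (\<lambda>x. x \<in> Z)"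
    and first: "tame X Y A Z T Z"
    and step: "\<And>E. tame X Y A Z T E \<Longrightarrow> tame X Y A Z T (advance X Y Z E)"
    and bad: "\<And>E. tame X Y A Z T E \<Longrightarrow> AE \<pi> in coin_measure. \<not> separates X Y A Z E \<pi>"
    by blast
  define E where "E j = (advance X Y Z ^^ j) Z" for j
  have "tame X Y A Z T (E j)" for j
    by (induction j) (auto simp: E_def first step)
  from bad[OF this] have "AE \<pi> in coin_measure. \<not> separates X Y A Z (E k) \<pi>" .
  with ae show ?thesis
  proof eventually_elim
    case (elim \<pi>)
    have "\<not> movable X Y (E k) x" if "x \<in> Z" "x \<in> A" for x
    proof -
      have "x \<in> X" "len x \<le> k" using that Z by (auto simp: A_def)
      then have "len x \<le> j" if "j \<le> len x" "nth_node x j \<in> E k" for j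
        using advance_power[OF Z \<open>x \<in> Z\<close>, of k] that by (simp add: E_def min_def split: if_splits)
      then show ?thesis
        unfolding movable_iff[OF \<open>x \<in> X\<close>] by (meson less_imp_le_nat not_le)
    qed
    then have 1: "\<not> io \<pi> (\<lambda>x. x \<in> Z \<and> x \<in> A \<and> movable X Y (E k) x)"
      by (auto simp: io_iff)
    have "movable X Y (E k) x" if "x \<in> Z" "x \<notin> A" for x
    proof -
      have "x \<in> X" "k < len x" using that Z by (auto simp: A_def)
      with advance_power[OF Z \<open>x \<in> Z\<close>, of k] show ?thesis by (auto simp: movable_iff E_def min_def)
    qed
    then have 2: "\<not> io \<pi> (\<lambda>x. x \<in> Z \<and> x \<notin> A \<and> \<not> movable X Y (E k) x)"
      by (auto simp: io_iff)
    have "(\<lambda>x. x \<in> A) = (\<lambda>x. x \<in> X \<and> len x \<le> k)" "(\<lambda>x. x \<in> X \<and> x \<notin> A) = (\<lambda>x. x \<in> X \<and> k < len x)"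
      by (auto simp: A_def)
    with elim 1 2 show ?case by (auto simp: separates_def)
  qed
qed

lemma cprob_cyl_tgt: "x \<in> X \<Longrightarrow> cprob x (cyl (tgt x)) = (1/2) ^ Suc (len x)"
proof -
  assume x: "x \<in> X"
  then have "cyl (tgt x) \<subseteq> cyl x" using tgt_strict[OF x] by (intro cyl_mono) (auto simp: strict_prefix_def)
  then have "cyl x \<inter> cyl (tgt x) = cyl (tgt x)" by blast
  then show ?thesis
    using x by (simp add: cprob_def prob_cyl length_tgt power_add power_divide)
qed

text \<open>Test \<open>recurrent\<close> on the set \<open>J\<close> of record lengths. Records on
  one branch have distinct lengths, so the probabilities of reaching their targets sum to at most 1;
  the targets are not hit infinitely often and \<open>J\<close> does not recur. Lengths tending to
  infinity would produce infinitely many records.\<close>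

lemma short_source_recurs:
  assumes "recurrent X Y"
  shows "AE \<pi> in coin_measure. io \<pi> (\<lambda>x. x \<in> X) \<longrightarrow> (\<exists>k. io \<pi> (\<lambda>x. x \<in> X \<and> len x \<le> k))"
proof -
  define J where "J = {x\<in>X. \<forall>u\<in>X. strict_prefix u x \<longrightarrow> len u < len x}"
  have "J \<subseteq> X" by (auto simp: J_def)
  with assms have "AE \<pi> in coin_measure.
    io \<pi> (\<lambda>x. x \<in> J) \<longrightarrow> io \<pi> (\<lambda>x. x \<in> J \<and> (\<exists>y\<in>nodes_of \<pi>. matched X Y x y))"
    unfolding recurrent_def by blast
  moreover have "AE \<pi> in coin_measure. \<not> io \<pi> (\<lambda>x. \<pi> \<in> (if x \<in> J then cyl (tgt x) else {}))"
  proof (rule borel_cantelli_bounded[of _ 1])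
    fix \<pi>
    have "(\<Sum>n<N. ennreal (cprob (branch_node \<pi> n) (if branch_node \<pi> n \<in> J then cyl (tgt (branch_node \<pi> n)) else {}))) \<le> ennreal 1" for N
    proof -
      let ?F = "{n. n < N \<and> branch_node \<pi> n \<in> J}"
      let ?l = "\<lambda>n. len (branch_node \<pi> n)"
      have mono: "?l m < ?l n" if "m < n" "m \<in> ?F" "n \<in> ?F" for m n
      proof -
        have "strict_prefix (branch_node \<pi> m) (branch_node \<pi> n)"
          using that by (intro strict_prefix_nodes_of[of _ \<pi>]) auto
        with that show ?thesis by (auto simp: J_def)
      qed
      have inj: "inj_on ?l ?F"
      proof (rule inj_onI)
        fix m n assume mn: "m \<in> ?F" "n \<in> ?F" "?l m = ?l n"
        show "m = n" using mono[of m n] mono[of n m] mn by (cases m n rule: linorder_cases) simp_all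
      qed
      have "(\<Sum>n<N. ennreal (cprob (branch_node \<pi> n) (if branch_node \<pi> n \<in> J then cyl (tgt (branch_node \<pi> n)) else {})))
          = (\<Sum>n<N. ennreal (if branch_node \<pi> n \<in> J then (1/2) ^ Suc (?l n) else 0))"
        using \<open>J \<subseteq> X\<close> cprob_cyl_tgt by (intro sum.cong) (auto simp: cprob_empty subset_iff)
      also have "\<dots> = ennreal (\<Sum>n<N. if branch_node \<pi> n \<in> J then (1/2) ^ Suc (?l n) else 0)"
        by (intro sum_ennreal) auto
      also have "(\<Sum>n<N. if branch_node \<pi> n \<in> J then (1/2) ^ Suc (?l n) else 0) = (\<Sum>n\<in>?F. (1/2::real) ^ Suc (?l n))"
        by (subst sum.inter_filter[symmetric]) (auto intro: sum.cong)
      also have "\<dots> = (\<Sum>k\<in>?l ` ?F. (1/2) ^ Suc k)"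
        using inj by (subst sum.reindex) auto
      also have "\<dots> \<le> (\<Sum>k<Suc (Max (insert 0 (?l ` ?F))). (1/2) ^ Suc k)"
        by (intro sum_mono2) (auto simp: less_Suc_eq_le)
      also have "\<dots> \<le> 1"
        by (simp only: sum_half_powers) simp
      finally show ?thesis by (simp add: ennreal_leI del: ennreal_1 ennreal_eq_1)
    qed
    then show "bsum (\<lambda>x. ennreal (cprob x (if x \<in> J then cyl (tgt x) else {}))) \<pi> \<le> ennreal 1"
      unfolding bsum_def by (intro ennreal_suminf_bound_add[where y = 0, simplified]) auto
  qed auto
  ultimately show ?thesis
  proof eventually_elim
    case (elim \<pi>)
    have nJ: "\<not> io \<pi> (\<lambda>x. x \<in> J)"
    proof
      assume "io \<pi> (\<lambda>x. x \<in> J)"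
      with elim(1) have "io \<pi> (\<lambda>x. x \<in> J \<and> (\<exists>y\<in>nodes_of \<pi>. matched X Y x y))" by blast
      then have "io \<pi> (\<lambda>x. \<pi> \<in> (if x \<in> J then cyl (tgt x) else {}))"
        by (rule io_mono) (auto simp: match_iff cyl_def)
      with elim(2) show False by blast
    qed
    show ?case
    proof (intro impI, rule ccontr)
      assume io: "io \<pi> (\<lambda>x. x \<in> X)" and no: "\<nexists>k. io \<pi> (\<lambda>x. x \<in> X \<and> len x \<le> k)"
      have "\<exists>n\<ge>m. branch_node \<pi> n \<in> J" for m
      proof -
        \<comment> \<open>\<open>K\<close> bounds all lengths before depth \<open>m\<close>, so the
          first source longer than \<open>K\<close> is a record at depth at least
          \<open>m\<close>.\<close>
        define K where "K = Max (insert 0 ((\<lambda>n. len (branch_node \<pi> n)) ` {..<m}))"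
        have K: "len (branch_node \<pi> n) \<le> K" if "n < m" for n
          unfolding K_def using that by (intro Max_ge) auto
        obtain l where l: "\<And>n. n \<ge> l \<Longrightarrow> \<not> (branch_node \<pi> n \<in> X \<and> len (branch_node \<pi> n) \<le> K)"
          using no not_io_iff[of \<pi> "\<lambda>x. x \<in> X \<and> len x \<le> K"] by blast
        obtain n0 where "n0 \<ge> l" "branch_node \<pi> n0 \<in> X" using io by (auto simp: io_iff)
        with l have ex: "\<exists>n. branch_node \<pi> n \<in> X \<and> K < len (branch_node \<pi> n)" by (meson not_le)
        define n where "n = (LEAST n. branch_node \<pi> n \<in> X \<and> K < len (branch_node \<pi> n))"
        have n: "branch_node \<pi> n \<in> X" "K < len (branch_node \<pi> n)"
          using LeastI_ex[OF ex] by (auto simp: n_def)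
        have least: "len (branch_node \<pi> i) \<le> K" if "i < n" "branch_node \<pi> i \<in> X" for i
          using not_less_Least[OF that(1)[unfolded n_def]] that(2) by auto
        have "len u < len (branch_node \<pi> n)" if "u \<in> X" "strict_prefix u (branch_node \<pi> n)" for u
        proof -
          have "u \<in> nodes_of \<pi>"
            using that(2) by (intro prefix_in_nodes_of[OF branch_node_in_nodes_of]) (auto simp: strict_prefix_def)
          then have "u = branch_node \<pi> (length u)" by (simp add: in_nodes_of_eq)
          moreover have "length u < n" using prefix_length_less[OF that(2)] by simp
          ultimately show ?thesis using least[of "length u"] that(1) n(2) by simp
        qed
        then have "branch_node \<pi> n \<in> J" using n by (auto simp: J_def)
        moreover have "n \<ge> m" using K[of n] n(2) by (meson not_le)
        ultimately show ?thesis by blast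
      qed
      with nJ show False by (simp add: io_iff)
    qed
  qed
qed

lemma settles_if_certified:
  assumes "AE \<pi> in coin_measure. io \<pi> (\<lambda>x. x \<in> X)" "recurrent X Y" "certified X Y"
  shows "AE \<pi> in coin_measure. settles X Y \<pi>"
proof -
  have "AE \<pi> in coin_measure. \<forall>k. \<not> (io \<pi> (\<lambda>x. x \<in> X \<and> len x \<le> k) \<and> io \<pi> (\<lambda>x. x \<in> X \<and> k < len x))"
    unfolding AE_all_countable using len_not_separated[OF assms(3)] by blast
  with assms(1) short_source_recurs[OF assms(2)] show ?thesis
  proof eventually_elim
    case (elim \<pi>)
    then have ex: "\<exists>k. io \<pi> (\<lambda>x. x \<in> X \<and> len x \<le> k)" by blast
    \<comment> \<open>The limit inferior of the lengths along \<pi>.\<close>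
    define c where "c = (LEAST k. io \<pi> (\<lambda>x. x \<in> X \<and> len x \<le> k))"
    have c: "io \<pi> (\<lambda>x. x \<in> X \<and> len x \<le> c)" unfolding c_def using ex by (rule LeastI_ex)
    have "\<not> io \<pi> (\<lambda>x. x \<in> X \<and> len x < c)"
    proof
      assume io: "io \<pi> (\<lambda>x. x \<in> X \<and> len x < c)"
      then have "c \<noteq> 0" by (auto simp: io_iff)
      have "io \<pi> (\<lambda>x. x \<in> X \<and> len x \<le> c - 1)"
        using io by (rule io_mono) auto
      then have "c \<le> c - 1" unfolding c_def by (rule Least_le)
      with \<open>c \<noteq> 0\<close> show False by simp
    qed
    moreover have "\<not> io \<pi> (\<lambda>x. x \<in> X \<and> c < len x)" using elim c by blast
    ultimately have "\<not> io \<pi> (\<lambda>x. (x \<in> X \<and> len x < c) \<or> (x \<in> X \<and> c < len x))"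
      by (simp add: io_disj)
    then have "\<not> io \<pi> (\<lambda>x. x \<in> X \<and> len x \<noteq> c)"
      by (rule contrapos_nn) (auto elim: io_mono)
    with elim(1) show ?case by (auto simp: settles_def)
  qed
qed

end

text \<open>Take the floor of the binary logarithm of \<open>ln (i + 3)\<close>. Then
  \<open>2 ^ (d * \<nu> i)\<close> is at most a power of the logarithm, which grows more slowly than
  \<open>i\<close>, and comparison with the harmonic series gives divergence. The shift by 3 makes
  the inner logarithm at least 1.\<close>

lemma ex_slow_sequence: "\<exists>\<nu> :: nat \<Rightarrow> nat. (\<forall>K. \<exists>m. \<forall>i\<ge>m. K \<le> \<nu> i) \<and>
  (\<forall>d. \<not> summable (\<lambda>i. (1/2 :: real) ^ (d * Suc (\<nu> i))))"
proof -
  define \<nu> where "\<nu> i = nat \<lfloor>log 2 (ln (real i + 3))\<rfloor>" for i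
  have ln: "1 \<le> ln (real i + 3)" for i
  proof -
    have "exp 1 \<le> real i + 3" using exp_le by linarith
    then show ?thesis by (simp add: ln_ge_iff)
  qed
  have le: "2 ^ \<nu> i \<le> ln (real i + 3)" for i
  proof -
    have "0 \<le> log 2 (ln (real i + 3))" using ln[of i] by simp
    then have "real (\<nu> i) \<le> log 2 (ln (real i + 3))" by (simp add: \<nu>_def)
    then have "2 powr real (\<nu> i) \<le> ln (real i + 3)" using ln[of i] by (simp add: le_log_iff)
    then show ?thesis by (simp add: powr_realpow)
  qed
  have "\<exists>m. \<forall>i\<ge>m. K \<le> \<nu> i" for K
  proof (intro exI allI impI)
    fix i assume "nat \<lceil>exp (2 ^ K :: real)\<rceil> \<le> i"
    then have "exp (2 ^ K) \<le> real i + 3" by linarith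
    then have "2 ^ K \<le> ln (real i + 3)" by (simp add: ln_ge_iff)
    then have "2 powr real K \<le> ln (real i + 3)" by (simp add: powr_realpow)
    then have "real K \<le> log 2 (ln (real i + 3))" using ln[of i] by (simp add: le_log_iff)
    then show "K \<le> \<nu> i" by (simp add: \<nu>_def le_nat_floor)
  qed
  moreover have "\<not> summable (\<lambda>i. (1/2 :: real) ^ (d * Suc (\<nu> i)))" for d
  proof
    assume summ: "summable (\<lambda>i. (1/2 :: real) ^ (d * Suc (\<nu> i)))"
    have "((\<lambda>x. x ^ d / exp x) \<longlongrightarrow> (0::real)) at_top" by (rule tendsto_power_div_exp_0)
    moreover have "filterlim (\<lambda>i. ln (real i + 3)) at_top sequentially" by real_asymp
    ultimately have "(\<lambda>i. ln (real i + 3) ^ d / exp (ln (real i + 3))) \<longlonglongrightarrow> 0"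
      by (rule filterlim_compose)
    then have "eventually (\<lambda>i. ln (real i + 3) ^ d / exp (ln (real i + 3)) < (1/2) ^ d) sequentially"
      by (rule order_tendstoD) auto
    then have "eventually (\<lambda>i. 1 / real (i + 3) \<le> (1/2) ^ (d * Suc (\<nu> i))) sequentially"
    proof eventually_elim
      case (elim i)
      have "2 ^ (d * Suc (\<nu> i)) = 2 ^ d * (2 ^ \<nu> i :: real) ^ d"
        by (simp add: power_add power_mult[symmetric] mult.commute)
      also have "\<dots> \<le> 2 ^ d * ln (real i + 3) ^ d"
        using le[of i] by (intro mult_left_mono power_mono) auto
      also have "\<dots> \<le> real i + 3"
        using elim by (simp add: field_simps power_divide)
      finally show ?case by (simp add: power_one_over frac_le)
    qed
    then have "eventually (\<lambda>i. norm (1 / real (i + 3)) \<le> (1/2) ^ (d * Suc (\<nu> i))) sequentially"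
      by simp
    then have "summable (\<lambda>i. 1 / real (i + 3))"
      using summ by (rule summable_comparison_test_ev)
    then have "summable (\<lambda>i. 1 / real i)" by (subst (asm) summable_iff_shift)
    then show False using not_summable_harmonic[where 'a = real] by (simp add: inverse_eq_divide)
  qed
  ultimately show ?thesis by blast
qed

lemma bsum_eq_top:
  assumes "\<And>i. i \<ge> m \<Longrightarrow> z i \<in> nodes_of \<pi>" "inj_on (\<lambda>i. length (z i)) {m..}"
    and g: "\<And>i. i \<ge> m \<Longrightarrow> ennreal (g i) \<le> f (z i)" "\<And>i. 0 \<le> g i" "\<not> summable g"
  shows "bsum f \<pi> = \<infinity>"
proof (rule ccontr)
  assume "bsum f \<pi> \<noteq> \<infinity>"
  then obtain r where r: "bsum f \<pi> = ennreal r" "r \<ge> 0"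
    by (cases "bsum f \<pi>") auto
  have "(\<Sum>i<n. g (i + m)) \<le> r" for n
  proof -
    have "(\<Sum>i<n. g (i + m)) = (\<Sum>i\<in>{m..<m + n}. g i)"
      using sum.shift_bounds_nat_ivl[of g 0 m n] by (simp add: atLeast0LessThan add.commute)
    then have "ennreal (\<Sum>i<n. g (i + m)) = (\<Sum>i\<in>{m..<m + n}. ennreal (g i))"
      using g(2) by (simp add: sum_ennreal)
    also have "\<dots> \<le> (\<Sum>i\<in>{m..<m + n}. f (z i))" using g(1) by (intro sum_mono) auto
    also have "\<dots> = (\<Sum>i\<in>{m..<m + n}. f (branch_node \<pi> (length (z i))))"
      using assms(1) by (intro sum.cong refl arg_cong[where f = f] in_nodes_of_eq[THEN iffD1]) auto
    also have "\<dots> = (\<Sum>k\<in>(\<lambda>i. length (z i)) ` {m..<m + n}. f (branch_node \<pi> k))"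
      using assms(2) by (subst sum.reindex) (auto intro: inj_on_subset)
    also have "\<dots> \<le> bsum f \<pi>" unfolding bsum_def by (intro sum_le_suminf) auto
    finally show ?thesis using r by (simp add: ennreal_le_iff)
  qed
  then have "summable (\<lambda>i. g (i + m))" using g(2) by (intro summableI_nonneg_bounded) auto
  with g(3) show False by (simp add: summable_iff_shift)
qed

lemma bsum_eq_top_io:
  assumes "io \<pi> (\<lambda>x. ennreal e \<le> f x)" "e > 0"
  shows "bsum f \<pi> = \<infinity>"
proof -
  define D where "D = {n. ennreal e \<le> f (branch_node \<pi> n)}"
  have D: "infinite D" using assms(1) by (simp add: D_def io_iff_infinite)
  show ?thesis
  proof (rule bsum_eq_top[of 0 "\<lambda>i. branch_node \<pi> (enumerate D i)" _ "\<lambda>_. e"])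
    show "inj_on (\<lambda>i. length (branch_node \<pi> (enumerate D i))) {0..}"
      using bij_enumerate[OF D] by (auto simp: bij_betw_def intro: inj_on_subset)
    show "ennreal e \<le> f (branch_node \<pi> (enumerate D i))" for i
      using enumerate_in_set[OF D] by (auto simp: D_def)
    show "\<not> summable (\<lambda>_::nat. e)" using assms(2) by (simp add: summable_const_iff)
  qed (use assms in auto)
qed

text \<open>Total probability over an antichain below \<open>x\<close>; the weight of
  \<open>w\<close> is the conditional probability of its cylinder given that of \<open>x\<close>.
  The sum is an integral over \<open>count_space\<close> because the antichain may be
  infinite.\<close>

lemma cprob_UN:
  assumes "\<And>w. w \<in> N \<Longrightarrow> prefix x w" "disjoint_family_on cyl N"
    and G: "\<And>w. w \<in> N \<Longrightarrow> G w \<in> sets coin_measure" "\<And>w. w \<in> N \<Longrightarrow> G w \<subseteq> cyl w"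
  shows "ennreal (cprob x (\<Union>w\<in>N. G w)) =
    (\<integral>\<^sup>+w. ennreal (2 ^ length x / 2 ^ length w) * ennreal (cprob w (G w)) \<partial>count_space N)"
proof -
  have "cyl x \<inter> (\<Union>w\<in>N. G w) = (\<Union>w\<in>N. G w)"
    using assms(1) G(2) cyl_mono by blast
  then have "ennreal (cprob x (\<Union>w\<in>N. G w)) = ennreal (2 ^ length x) * emeasure coin_measure (\<Union>w\<in>N. G w)"
    by (simp add: cprob_def coin.emeasure_eq_measure ennreal_mult[symmetric] mult.commute)
  also have "emeasure coin_measure (\<Union>w\<in>N. G w) = (\<integral>\<^sup>+w. emeasure coin_measure (G w) \<partial>count_space N)"
  proof (intro emeasure_UN_countable)
    show "disjoint_family_on G N"
      using assms(2) G(2) unfolding disjoint_family_on_def by blast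
  qed (use G in auto)
  also have "ennreal (2 ^ length x) * \<dots> = (\<integral>\<^sup>+w. ennreal (2 ^ length x) * emeasure coin_measure (G w) \<partial>count_space N)"
    by (intro nn_integral_cmult[symmetric]) simp
  also have "\<dots> = (\<integral>\<^sup>+w. ennreal (2 ^ length x / 2 ^ length w) * ennreal (cprob w (G w)) \<partial>count_space N)"
  proof (intro nn_integral_cong)
    fix w assume "w \<in> space (count_space N)"
    then have "cyl w \<inter> G w = G w" using G(2) by auto
    then show "ennreal (2 ^ length x) * emeasure coin_measure (G w) =
        ennreal (2 ^ length x / 2 ^ length w) * ennreal (cprob w (G w))"
      by (simp add: cprob_def coin.emeasure_eq_measure ennreal_mult[symmetric])
  qed
  finally show ?thesis .
qed

text \<open>The weights of the antichain add up to at most 1, so an additive error \<open>e\<close>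
  does not grow under averaging.\<close>

lemma cprob_UN_le:
  assumes "\<And>w. w \<in> N \<Longrightarrow> prefix x w" "disjoint_family_on cyl N"
    and G: "\<And>w. w \<in> N \<Longrightarrow> G w \<in> sets coin_measure" "\<And>w. w \<in> N \<Longrightarrow> G w \<subseteq> cyl w"
    and G': "\<And>w. w \<in> N \<Longrightarrow> G' w \<in> sets coin_measure" "\<And>w. w \<in> N \<Longrightarrow> G' w \<subseteq> cyl w"
    and le: "\<And>w. w \<in> N \<Longrightarrow> cprob w (G w) \<le> c * cprob w (G' w) + e" and "0 \<le> c" "0 \<le> e"
  shows "cprob x (\<Union>w\<in>N. G w) \<le> c * cprob x (\<Union>w\<in>N. G' w) + e"
proof -
  let ?p = "\<lambda>w. ennreal (2 ^ length x / 2 ^ length w)"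
  have "ennreal (cprob x (\<Union>w\<in>N. G w)) = (\<integral>\<^sup>+w. ?p w * ennreal (cprob w (G w)) \<partial>count_space N)"
    using assms by (intro cprob_UN) auto
  also have "\<dots> \<le> (\<integral>\<^sup>+w. ennreal c * (?p w * ennreal (cprob w (G' w))) + ennreal e * (?p w * ennreal (cprob w (cyl w))) \<partial>count_space N)"
  proof (intro nn_integral_mono)
    fix w assume "w \<in> space (count_space N)"
    then have w: "w \<in> N" by simp
    have "cprob w (cyl w) = 1" by (simp add: cprob_def prob_cyl)
    then have "2 ^ length x / 2 ^ length w * cprob w (G w) \<le>
        c * (2 ^ length x / 2 ^ length w * cprob w (G' w)) + e * (2 ^ length x / 2 ^ length w * cprob w (cyl w))"
      using mult_left_mono[OF le[OF w], of "2 ^ length x / 2 ^ length w"] by (simp add: algebra_simps add_divide_distrib)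
    then show "?p w * ennreal (cprob w (G w)) \<le>
        ennreal c * (?p w * ennreal (cprob w (G' w))) + ennreal e * (?p w * ennreal (cprob w (cyl w)))"
      using \<open>0 \<le> c\<close> \<open>0 \<le> e\<close>
      by (simp add: ennreal_mult[symmetric] ennreal_plus[symmetric] del: ennreal_plus)
  qed
  also have "\<dots> = ennreal c * (\<integral>\<^sup>+w. ?p w * ennreal (cprob w (G' w)) \<partial>count_space N) +
      ennreal e * (\<integral>\<^sup>+w. ?p w * ennreal (cprob w (cyl w)) \<partial>count_space N)"
    by (simp add: nn_integral_add nn_integral_cmult)
  also have "\<dots> = ennreal c * ennreal (cprob x (\<Union>w\<in>N. G' w)) + ennreal e * ennreal (cprob x (\<Union>w\<in>N. cyl w))"
    using assms by (intro arg_cong2[of _ _ _ _ "\<lambda>a b. ennreal c * a + ennreal e * b"] cprob_UN[symmetric]) auto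
  also have "\<dots> = ennreal (c * cprob x (\<Union>w\<in>N. G' w) + e * cprob x (\<Union>w\<in>N. cyl w))"
    using \<open>0 \<le> c\<close> \<open>0 \<le> e\<close> by (simp add: ennreal_mult)
  finally have "cprob x (\<Union>w\<in>N. G w) \<le> c * cprob x (\<Union>w\<in>N. G' w) + e * cprob x (\<Union>w\<in>N. cyl w)"
    using \<open>0 \<le> c\<close> \<open>0 \<le> e\<close> by (simp add: ennreal_le_iff del: ennreal_plus)
  also have "e * cprob x (\<Union>w\<in>N. cyl w) \<le> e" using \<open>0 \<le> e\<close> by (simp add: mult_left_le)
  finally show ?thesis by simp
qed

lemma cprob_UN_ge:
  assumes "\<And>w. w \<in> N \<Longrightarrow> prefix x w" "disjoint_family_on cyl N"
    and G: "\<And>w. w \<in> N \<Longrightarrow> G w \<in> sets coin_measure" "\<And>w. w \<in> N \<Longrightarrow> G w \<subseteq> cyl w"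
    and ge: "\<And>w. w \<in> N' \<Longrightarrow> c \<le> cprob w (G w)" and "0 < c" "N' \<subseteq> N"
  shows "c * cprob x (visit N') \<le> cprob x (\<Union>w\<in>N. G w)"
proof -
  have "cprob x (\<Union>w\<in>N'. cyl w) \<le> (1 / c) * cprob x (\<Union>w\<in>N'. G w) + 0"
  proof (intro cprob_UN_le)
    fix w assume "w \<in> N'"
    have "cprob w (cyl w) = 1" by (simp add: cprob_def prob_cyl)
    then show "cprob w (cyl w) \<le> 1 / c * cprob w (G w) + 0"
      using ge[OF \<open>w \<in> N'\<close>] \<open>0 < c\<close> by (simp add: field_simps)
  next
    show "disjoint_family_on cyl N'"
      using \<open>N' \<subseteq> N\<close> assms(2) by (rule disjoint_family_on_mono)
  next
    fix w assume "w \<in> N'"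
    then have "w \<in> N" using \<open>N' \<subseteq> N\<close> by blast
    then show "prefix x w" "G w \<in> sets coin_measure" "G w \<subseteq> cyl w" using assms by auto
  qed (use \<open>0 < c\<close> in auto)
  then have "c * cprob x (visit N') \<le> cprob x (\<Union>w\<in>N'. G w)"
    using \<open>0 < c\<close> by (simp add: visit_def field_simps)
  also have "\<dots> \<le> cprob x (\<Union>w\<in>N. G w)"
    using G(1) \<open>N' \<subseteq> N\<close> by (intro cprob_mono sets.countable_UN'') auto
  finally show ?thesis .
qed

section \<open>Sparse sources and labels\<close>

locale marking = interval_nodes +
  fixes A :: "node set" and \<nu> :: "nat \<Rightarrow> nat"
  assumes A_subset: "A \<subseteq> X"
    and \<nu>_large: "\<And>K. \<exists>m. \<forall>i\<ge>m. K \<le> \<nu> i"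
    and \<nu>_slow: "\<And>d. \<not> summable (\<lambda>i. (1/2 :: real) ^ (d * Suc (\<nu> i)))"
begin

text \<open>One more than the largest distance from \<open>p\<close> to one of its labels, so all
  labels of \<open>p\<close> are shorter than any selected source below \<open>p\<close>. Halving
  the rank gives a source in \<open>A\<close> and its successor outside \<open>A\<close> the same
  value of \<nu>.\<close>

definition gap :: "node \<Rightarrow> nat \<Rightarrow> nat" where
  "gap p i = len p + 2 + len p * \<nu> (i div 2)"

definition follows :: "node \<Rightarrow> nat \<Rightarrow> node \<Rightarrow> bool" where
  "follows p i x \<longleftrightarrow> x \<in> X \<and> strict_prefix p x \<and> (x \<in> A \<longleftrightarrow> p \<notin> A) \<and> length p + gap p i \<le> length x"

text \<open>A greedy selection along every branch. Taking the first admissible source makes sources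
  of equal rank incomparable, and the parity of the rank tells whether the source lies in
  \<open>A\<close>.\<close>

inductive ranked :: "node \<Rightarrow> nat \<Rightarrow> bool" where
  ranked_0: "x \<in> A \<Longrightarrow> (\<And>u. strict_prefix u x \<Longrightarrow> u \<notin> A) \<Longrightarrow> ranked x 0"
| ranked_Suc: "ranked p i \<Longrightarrow> follows p i x \<Longrightarrow> (\<And>u. strict_prefix u x \<Longrightarrow> \<not> follows p i u) \<Longrightarrow>
    ranked x (Suc i)"

definition Z :: "node set" where "Z = {x. \<exists>i. ranked x i}"

lemma ranked_source: "ranked x i \<Longrightarrow> x \<in> X \<and> (x \<in> A \<longleftrightarrow> even i)"
  by (induction rule: ranked.induct) (use A_subset in \<open>auto simp: follows_def\<close>)

lemma ranked_unique:
  assumes "ranked x i" "ranked x' i" "prefix x v" "prefix x' v"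
  shows "x = x'"
  using assms
proof (induction i arbitrary: x x' v rule: nat_induct)
  case 0
  have "prefix x x' \<or> prefix x' x" using 0 prefix_same_cases by blast
  moreover have "x \<in> A" "x' \<in> A" "\<And>u. strict_prefix u x \<Longrightarrow> u \<notin> A" "\<And>u. strict_prefix u x' \<Longrightarrow> u \<notin> A"
    using 0(1,2) by (auto elim: ranked.cases)
  ultimately show ?case by (auto simp: strict_prefix_def)
next
  case (Suc i)
  obtain p where p: "ranked p i" "follows p i x" "\<And>u. strict_prefix u x \<Longrightarrow> \<not> follows p i u"
    using Suc.prems(1) by (auto elim: ranked.cases)
  obtain p' where p': "ranked p' i" "follows p' i x'" "\<And>u. strict_prefix u x' \<Longrightarrow> \<not> follows p' i u"
    using Suc.prems(2) by (auto elim: ranked.cases)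
  have "prefix p v" "prefix p' v"
    using p(2) p'(2) Suc.prems(3,4) by (auto simp: follows_def strict_prefix_def intro: prefix_order.trans)
  then have "p = p'" using Suc.IH p(1) p'(1) by blast
  moreover have "prefix x x' \<or> prefix x' x" using Suc.prems prefix_same_cases by blast
  ultimately show ?case using p p' by (auto simp: strict_prefix_def)
qed

lemma ranked_below:
  assumes "ranked x i" "j < i"
  shows "\<exists>p. ranked p j \<and> strict_prefix p x \<and> length p + gap p j \<le> length x"
  using assms
proof (induction rule: ranked.induct)
  case (ranked_Suc p i x)
  show ?case
  proof (cases "j = i")
    case True
    with ranked_Suc show ?thesis by (auto simp: follows_def)
  next
    case False
    then obtain q where q: "ranked q j" "strict_prefix q p" "length q + gap q j \<le> length p"
      using ranked_Suc by auto
    have "strict_prefix p x" using ranked_Suc by (simp add: follows_def)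
    with q show ?thesis
      using prefix_length_less[of p x] by (intro exI[of _ q]) (auto intro: prefix_order.less_trans)
  qed
qed simp

lemma ranked_less:
  assumes "ranked x i" "ranked x' i'" "strict_prefix x x'"
  shows "i < i'" "length x + gap x i \<le> length x'"
proof -
  have px: "prefix x x'" using assms(3) by (simp add: strict_prefix_def)
  show *: "i < i'"
  proof (rule ccontr)
    assume "\<not> i < i'"
    then obtain p where p: "ranked p i'" "prefix p x"
      using ranked_below[OF assms(1), of i'] assms(1) by (cases "i' = i") (auto simp: strict_prefix_def)
    then have "p = x'"
      using assms(2) px by (intro ranked_unique[of p i' x' x']) (auto intro: prefix_order.trans)
    with p(2) assms(3) show False by (auto simp: strict_prefix_def)
  qed
  obtain p where p: "ranked p i" "strict_prefix p x'" "length p + gap p i \<le> length x'"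
    using ranked_below[OF assms(2) *] by blast
  then have "p = x" using assms(1) px by (intro ranked_unique[of p i x x']) (auto simp: strict_prefix_def)
  with p show "length x + gap x i \<le> length x'" by simp
qed

lemma ranked_rank_unique:
  assumes "ranked x i" "ranked x i'"
  shows "i = i'"
proof -
  have "\<not> j < k" if jk: "ranked x j" "ranked x k" for j k
  proof
    assume "j < k"
    then obtain p where p: "ranked p j" "strict_prefix p x" using ranked_below[OF jk(2)] by blast
    then have "p = x" using jk(1) by (intro ranked_unique[of p j x x]) (auto simp: strict_prefix_def)
    with p show False by simp
  qed
  with assms show ?thesis by (cases i i' rule: linorder_cases) auto
qed

text \<open>The formula cannot mention ranks; it sees only the next element of \<open>Z\<close>,
  which is the one of rank \<open>Suc i\<close>.\<close>

lemma next_iff: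
  assumes "ranked x i" "w \<in> Z" "strict_prefix x w"
  shows "(\<forall>u\<in>Z. strict_prefix x u \<longrightarrow> \<not> strict_prefix u w) \<longleftrightarrow> ranked w (Suc i)"
proof
  assume no: "\<forall>u\<in>Z. strict_prefix x u \<longrightarrow> \<not> strict_prefix u w"
  obtain k where k: "ranked w k" using assms(2) by (auto simp: Z_def)
  have "i < k" using ranked_less(1)[OF assms(1) k assms(3)] .
  show "ranked w (Suc i)"
  proof (cases "k = Suc i")
    case False
    with \<open>i < k\<close> obtain p where p: "ranked p (Suc i)" "strict_prefix p w"
      using ranked_below[OF k, of "Suc i"] by auto
    have "\<not> prefix p x"
    proof
      assume "prefix p x"
      then have "p = x \<or> strict_prefix p x" by (auto simp: strict_prefix_def)
      then show False
        using ranked_rank_unique[of x i "Suc i"] ranked_less(1)[OF p(1) assms(1)] p(1) assms(1) by auto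
    qed
    moreover have "prefix p x \<or> prefix x p"
      using p(2) assms(3) by (meson prefix_same_cases strict_prefix_def)
    ultimately have "strict_prefix x p" by (auto simp: strict_prefix_def)
    with no p show ?thesis by (auto simp: Z_def)
  qed (use k in simp)
next
  assume w: "ranked w (Suc i)"
  show "\<forall>u\<in>Z. strict_prefix x u \<longrightarrow> \<not> strict_prefix u w"
  proof (intro ballI impI notI)
    fix u assume u: "u \<in> Z" "strict_prefix x u" "strict_prefix u w"
    then obtain k where k: "ranked u k" by (auto simp: Z_def)
    with u ranked_less(1)[OF assms(1) k] ranked_less(1)[OF k w] show False by simp
  qed
qed

lemma Z_subset: "Z \<subseteq> X"
  using ranked_source by (auto simp: Z_def)

lemma ranked_on_branch:
  assumes "io \<pi> (\<lambda>x. x \<in> A)" "io \<pi> (\<lambda>x. x \<in> X \<and> x \<notin> A)"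
  shows "\<exists>x\<in>nodes_of \<pi>. ranked x i \<and> i \<le> length x"
proof -
  have minimal: "\<exists>x\<in>nodes_of \<pi>. Q x \<and> (\<forall>u. strict_prefix u x \<longrightarrow> \<not> Q u)" if "\<exists>x\<in>nodes_of \<pi>. Q x" for Q
  proof -
    have ex: "\<exists>n. Q (branch_node \<pi> n)" using that by (auto simp: nodes_of_def)
    let ?n = "LEAST n. Q (branch_node \<pi> n)"
    have "\<not> Q u" if "strict_prefix u (branch_node \<pi> ?n)" for u
    proof -
      have "u \<in> nodes_of \<pi>"
        using that by (intro prefix_in_nodes_of[OF branch_node_in_nodes_of]) (auto simp: strict_prefix_def)
      then have "u = branch_node \<pi> (length u)" by (simp add: in_nodes_of_eq)
      moreover have "length u < ?n" using prefix_length_less[OF that] by simp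
      ultimately show ?thesis using not_less_Least[of "length u" "\<lambda>n. Q (branch_node \<pi> n)"] by simp
    qed
    moreover have "Q (branch_node \<pi> ?n)" using ex by (rule LeastI_ex)
    ultimately show ?thesis using branch_node_in_nodes_of[of \<pi> ?n] by blast
  qed
  show ?thesis
  proof (induction i)
    case 0
    have "\<exists>x\<in>nodes_of \<pi>. x \<in> A" using assms(1) by (auto simp: io_iff intro: branch_node_in_nodes_of)
    from minimal[OF this] show ?case using ranked_0 by blast
  next
    case (Suc i)
    then obtain p where p: "p \<in> nodes_of \<pi>" "ranked p i" "i \<le> length p" by blast
    have "io \<pi> (\<lambda>x. x \<in> X \<and> (x \<in> A \<longleftrightarrow> p \<notin> A))"
      using assms A_subset by (cases "p \<in> A") (auto elim!: io_mono)
    then obtain n where n: "n \<ge> length p + gap p i" "branch_node \<pi> n \<in> X" "branch_node \<pi> n \<in> A \<longleftrightarrow> p \<notin> A"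
      unfolding io_iff by blast
    have "strict_prefix p (branch_node \<pi> n)"
      using n(1) by (intro strict_prefix_nodes_of[OF p(1)]) (auto simp: gap_def)
    then have "\<exists>x\<in>nodes_of \<pi>. follows p i x" using n by (auto simp: follows_def)
    from minimal[OF this] obtain x where x: "x \<in> nodes_of \<pi>" "follows p i x" "\<And>u. strict_prefix u x \<Longrightarrow> \<not> follows p i u"
      by blast
    have "ranked x (Suc i)" using p(2) x(2,3) by (rule ranked_Suc)
    moreover have "Suc i \<le> length x" using x(2) p(3) by (auto simp: follows_def gap_def)
    ultimately show ?case using x(1) by blast
  qed
qed

lemma io_Z:
  assumes "io \<pi> (\<lambda>x. x \<in> A)" "io \<pi> (\<lambda>x. x \<in> X \<and> x \<notin> A)"
  shows "io \<pi> (\<lambda>x. x \<in> Z)"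
  unfolding io_iff
proof
  fix m
  obtain x where "x \<in> nodes_of \<pi>" "ranked x m" "m \<le> length x"
    using ranked_on_branch[OF assms] by blast
  then show "\<exists>n\<ge>m. branch_node \<pi> n \<in> Z"
    by (intro exI[of _ "length x"]) (auto simp: Z_def in_nodes_of_eq)
qed

text \<open>A source outside \<open>A\<close> is active only if its length equals that of its
  predecessor \<open>p\<close>. Lengths that settle along a branch may still differ at successors
  off the branch, and these also enter the conditional probabilities at \<open>p\<close>.\<close>

definition active :: "node \<Rightarrow> nat \<Rightarrow> bool" where
  "active x i \<longleftrightarrow> x \<in> A \<or> (\<exists>p j. i = Suc j \<and> ranked p j \<and> strict_prefix p x \<and> len p = len x)"

text \<open>The flipped bit leaves the interval right after position \<open>j\<close>, so the label
  lies below position \<open>k\<close> exactly if \<open>k \<le> j\<close>. The zeros after it only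
  tune the probability.\<close>

definition label :: "node \<Rightarrow> nat \<Rightarrow> nat \<Rightarrow> node" where
  "label x i j = nth_node x j @ [\<not> tgt x ! (length x + j)] @ replicate (j * \<nu> (i div 2)) False"

definition T :: "node set" where
  "T = {label x i j | x i j. ranked x i \<and> active x i \<and> j \<le> len x}"

lemma length_label: "x \<in> X \<Longrightarrow> j \<le> len x \<Longrightarrow> length (label x i j) = length x + (j + 1 + j * \<nu> (i div 2))"
  by (simp add: label_def length_nth_node)

lemma length_label_less:
  assumes "x \<in> X" "j \<le> len x"
  shows "length (label x i j) < length x + gap x i"
proof -
  have "j * \<nu> (i div 2) \<le> len x * \<nu> (i div 2)" using assms(2) by (rule mult_right_mono) simp
  then show ?thesis
    unfolding gap_def length_label[OF assms] using assms(2) by linarith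
qed

lemma prefix_label: "x \<in> X \<Longrightarrow> prefix x (label x i j)"
  unfolding label_def using prefix_nth_node[of x j] by (auto intro: prefix_prefix)

lemma nth_node_prefix_label_iff:
  assumes x: "x \<in> X" and k: "k \<le> len x" and j: "j \<le> len x"
  shows "prefix (nth_node x k) (label x i j) \<longleftrightarrow> k \<le> j"
proof
  assume p: "prefix (nth_node x k) (label x i j)"
  show "k \<le> j"
  proof (rule ccontr)
    assume "\<not> k \<le> j"
    then have lt: "length x + j < length (nth_node x k)" using x k by (simp add: length_nth_node)
    have "nth_node x k ! (length x + j) = tgt x ! (length x + j)"
      using lt by (simp add: nth_node_def)
    moreover have "label x i j ! (length x + j) = (\<not> tgt x ! (length x + j))"
      using x j by (simp add: label_def nth_append length_nth_node)
    moreover have "nth_node x k ! (length x + j) = label x i j ! (length x + j)"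
      using p lt by (auto simp: prefix_def nth_append)
    ultimately show False by simp
  qed
next
  assume "k \<le> j"
  then show "prefix (nth_node x k) (label x i j)"
    unfolding label_def using nth_node_mono[of k j x] by (auto intro: prefix_prefix)
qed

text \<open>A label counted at \<open>x\<close> must be a label of \<open>x\<close>: those of
  selected sources above \<open>x\<close> are too short by the choice of \<open>gap\<close>, and
  those of selected sources below \<open>x\<close> are excluded by the last clause of
  \<open>hits\<close>.\<close>

lemma hits_iff:
  assumes x: "ranked x i"
  shows "hits X Y Z T E x t \<longleftrightarrow>
    active x i \<and> (\<exists>j\<le>len x. t = label x i j \<and> (\<exists>k\<le>j. nth_node x k \<in> E))"
proof
  have xX: "x \<in> X" using ranked_source[OF x] by simp
  assume h: "hits X Y Z T E x t"
  then obtain x' i' j where t: "t = label x' i' j" "ranked x' i'" "active x' i'" "j \<le> len x'"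
    by (auto simp: hits_def T_def)
  have x'X: "x' \<in> X" using ranked_source[OF t(2)] by simp
  obtain k where k: "k \<le> len x" "nth_node x k \<in> E" "prefix (nth_node x k) t"
    using h unfolding hits_def ex_nth_node_iff[OF xX, of E "\<lambda>z y. prefix z t"] by blast
  have xt: "prefix x t" using prefix_nth_node[OF xX] k(3) by (rule prefix_order.trans)
  have x't: "prefix x' t" unfolding t(1) using x'X by (rule prefix_label)
  have "\<not> strict_prefix x x'" using h t(2) x't by (auto simp: hits_def Z_def)
  moreover have "\<not> strict_prefix x' x"
    using ranked_less(2)[OF t(2) x] length_label_less[OF x'X t(4), of i'] prefix_length_le[OF xt] t(1) by auto
  moreover have "prefix x x' \<or> prefix x' x" using xt x't by (rule prefix_same_cases)
  ultimately have "x' = x" by (auto simp: strict_prefix_def)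
  then have "i' = i" using ranked_rank_unique x t(2) by blast
  have "k \<le> j" using k t \<open>x' = x\<close> by (simp add: nth_node_prefix_label_iff xX)
  with k t \<open>x' = x\<close> \<open>i' = i\<close>
  show "active x i \<and> (\<exists>j\<le>len x. t = label x i j \<and> (\<exists>k\<le>j. nth_node x k \<in> E))" by blast
next
  have xX: "x \<in> X" using ranked_source[OF x] by simp
  assume "active x i \<and> (\<exists>j\<le>len x. t = label x i j \<and> (\<exists>k\<le>j. nth_node x k \<in> E))"
  then obtain j k where *: "active x i" "j \<le> len x" "t = label x i j" "k \<le> j" "nth_node x k \<in> E" by blast
  have "t \<in> T" using * x by (auto simp: T_def)
  moreover have "\<exists>k\<le>len x. nth_node x k \<in> E \<and> prefix (nth_node x k) t"
    using * by (intro exI[of _ k]) (auto simp: nth_node_prefix_label_iff xX)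
  moreover have "\<not> prefix u t" if "u \<in> Z" "strict_prefix x u" for u
  proof -
    obtain k where "ranked u k" using \<open>u \<in> Z\<close> by (auto simp: Z_def)
    from ranked_less(2)[OF x this that(2)] show ?thesis
      using length_label_less[OF xX *(2), of i] prefix_length_le[of u t] *(3) by auto
  qed
  ultimately show "hits X Y Z T E x t"
    unfolding hits_def ex_nth_node_iff[OF xX, of E "\<lambda>z y. prefix z t"] by blast
qed

definition successors :: "node \<Rightarrow> nat \<Rightarrow> node set" where
  "successors x i = {w. ranked w (Suc i) \<and> strict_prefix x w}"

lemma hits_next_iff:
  assumes x: "ranked x i" "x \<in> A"
  shows "hits_next X Y A Z T E x t \<longleftrightarrow> (\<exists>w\<in>successors x i. hits X Y Z T E w t)"
proof -
  have "even i" using ranked_source[OF x(1)] x(2) by simp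
  then have not_A: "w \<notin> A" if "ranked w (Suc i)" for w using ranked_source[OF that] by simp
  have "w \<in> Z \<and> w \<notin> A \<and> strict_prefix x w \<and> (\<forall>u\<in>Z. strict_prefix x u \<longrightarrow> \<not> strict_prefix u w) \<longleftrightarrow>
      w \<in> successors x i" for w
  proof
    assume "w \<in> successors x i"
    then have w: "ranked w (Suc i)" "strict_prefix x w" by (auto simp: successors_def)
    then have "w \<in> Z" by (auto simp: Z_def)
    with w not_A next_iff[OF x(1)] show
      "w \<in> Z \<and> w \<notin> A \<and> strict_prefix x w \<and> (\<forall>u\<in>Z. strict_prefix x u \<longrightarrow> \<not> strict_prefix u w)" by blast
  qed (use next_iff[OF x(1)] in \<open>auto simp: successors_def\<close>)
  then show ?thesis
    unfolding hits_next_def by blast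
qed

lemma successors_disjoint: "disjoint_family_on cyl (successors x i)"
  unfolding disjoint_family_on_def
proof (intro ballI impI cyl_disjoint)
  fix v w assume vw: "v \<in> successors x i" "w \<in> successors x i" "v \<noteq> w"
  then show "\<not> prefix v w" using ranked_unique[of v "Suc i" w w] by (auto simp: successors_def)
  show "\<not> prefix w v" using vw ranked_unique[of v "Suc i" w v] by (auto simp: successors_def)
qed

definition hit :: "node set \<Rightarrow> node \<Rightarrow> branch set" where
  "hit E x = visit {t. hits X Y Z T E x t}"

definition hit_next :: "node set \<Rightarrow> node \<Rightarrow> branch set" where
  "hit_next E x = visit {t. hits_next X Y A Z T E x t}"

lemma hit_sets [simp]: "hit E x \<in> sets coin_measure" "hit_next E x \<in> sets coin_measure"
  by (simp_all add: hit_def hit_next_def)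

lemma hit_subset_cyl: "x \<in> X \<Longrightarrow> hit E x \<subseteq> cyl x"
  unfolding hit_def visit_def hits_def
  by (auto simp: cyl_def intro: prefix_in_nodes_of prefix_order.trans)

lemma hit_next_eq: "ranked x i \<Longrightarrow> x \<in> A \<Longrightarrow> hit_next E x = (\<Union>w\<in>successors x i. hit E w)"
  by (auto simp: hit_next_def hit_def visit_def hits_next_iff)

lemma settled_hit: "settled (Z \<inter> A) (hit E)"
  unfolding hit_def by (intro settled_visit) (auto simp: hits_def)

text \<open>A later source \<open>y\<close> in \<open>A\<close> differs from the next source
  \<open>w\<close>, which is outside \<open>A\<close>, and cannot precede it. So \<open>y\<close>
  comes after \<open>w\<close>, and labels counted at \<open>w\<close> do not lie below later
  selected sources.\<close>

lemma settled_hit_next: "settled (Z \<inter> A) (hit_next E)"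
  unfolding hit_next_def
proof (intro settled_visit)
  fix x y t assume *: "x \<in> Z \<inter> A" "y \<in> Z \<inter> A" "strict_prefix x y" "t \<in> {t. hits_next X Y A Z T E x t}"
  then obtain w where w: "w \<notin> A" "\<And>u. u \<in> Z \<Longrightarrow> strict_prefix x u \<Longrightarrow> \<not> strict_prefix u w" "hits X Y Z T E w t"
    by (auto simp: hits_next_def)
  show "\<not> prefix y t"
  proof
    assume yt: "prefix y t"
    have "prefix w t" using w(3) unfolding hits_def by (auto intro: prefix_order.trans)
    with yt have "prefix y w \<or> prefix w y" by (intro prefix_same_cases)
    moreover have "\<not> strict_prefix y w" using w(2) * by blast
    moreover have "y \<noteq> w" using w(1) * by blast
    ultimately have "strict_prefix w y" by (auto simp: strict_prefix_def)
    with w(3) * yt show False by (auto simp: hits_def)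
  qed
qed

lemma tame_iff:
  "tame X Y A Z T E \<longleftrightarrow> (AE \<pi> in coin_measure. \<exists>C\<ge>0.
    bsum (\<lambda>x. if x \<in> Z \<inter> A \<and> cprob x (hit_next E x) > C * cprob x (hit E x)
      then ennreal (cprob x (hit_next E x)) else 0) \<pi> < \<infinity>)"
  unfolding tame_def
  using hits_dominated_iff[OF hit_sets(1)[of E] settled_hit[of E] hit_sets(2)[of E] settled_hit_next[of E]]
  by (simp add: hit_def hit_next_def mem_visit_iff)

end

section \<open>Probabilities of hits and closure under advancing\<close>

context marking
begin

definition chosen :: "node set \<Rightarrow> node \<Rightarrow> bool" where
  "chosen E x \<longleftrightarrow> (\<exists>k\<le>len x. nth_node x k \<in> E)"

definition first :: "node set \<Rightarrow> node \<Rightarrow> nat" where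
  "first E x = (LEAST k. nth_node x k \<in> E)"

text \<open>The probability of a hit at an active source, up to a factor 2.\<close>

definition weight :: "node set \<Rightarrow> node \<Rightarrow> nat \<Rightarrow> real" where
  "weight E x i = (if chosen E x then (1/2) ^ (first E x * Suc (\<nu> (i div 2))) else 0)"

lemma chosen_first:
  assumes "chosen E x"
  shows "nth_node x (first E x) \<in> E" "first E x \<le> len x"
proof -
  obtain k where "k \<le> len x" "nth_node x k \<in> E" using assms by (auto simp: chosen_def)
  then show "nth_node x (first E x) \<in> E" "first E x \<le> len x"
    unfolding first_def by (auto intro: LeastI order_trans[OF Least_le])
qed

lemma first_le: "nth_node x k \<in> E \<Longrightarrow> first E x \<le> k"
  unfolding first_def by (rule Least_le)

lemma weight_nonneg [simp]: "0 \<le> weight E x i"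
  by (simp add: weight_def)

lemma prob_label:
  assumes "x \<in> X" "j \<le> len x"
  shows "cprob x (cyl (label x i j)) = (1/2) ^ Suc j * (1/2) ^ (j * \<nu> (i div 2))"
proof -
  have "cyl x \<inter> cyl (label x i j) = cyl (label x i j)"
    using cyl_mono[OF prefix_label[OF assms(1), of i j]] by blast
  then show ?thesis
    by (simp add: cprob_def prob_cyl length_label[OF assms] power_add power_one_over field_simps)
qed

lemma hit_inactive: "ranked x i \<Longrightarrow> \<not> active x i \<Longrightarrow> cprob x (hit E x) = 0"
  by (simp add: hit_def hits_iff visit_def cprob_empty)

text \<open>Only labels with index at least \<open>first E x\<close> count. Their padding costs at
  least as much as that of the first one, and the probabilities of the exits form a geometric
  series.\<close>

lemma hit_upper:
  assumes "ranked x i"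
  shows "cprob x (hit E x) \<le> weight E x i"
proof (cases "chosen E x")
  case False
  then have "hit E x = {}" using hits_iff[OF assms, of E] by (auto simp: hit_def visit_def chosen_def)
  then show ?thesis by (simp add: cprob_empty)
next
  case True
  let ?f = "first E x" and ?N = "\<nu> (i div 2)"
  have xX: "x \<in> X" using ranked_source[OF assms] by simp
  have "hit E x \<subseteq> (\<Union>j\<in>{?f..len x}. cyl (label x i j))"
  proof
    fix \<pi> assume "\<pi> \<in> hit E x"
    then obtain j k where j: "\<pi> \<in> cyl (label x i j)" "j \<le> len x" "k \<le> j" "nth_node x k \<in> E"
      using hits_iff[OF assms] by (auto simp: hit_def visit_def)
    have "?f \<le> j" using first_le[OF j(4)] j(3) by simp
    with j show "\<pi> \<in> (\<Union>j\<in>{?f..len x}. cyl (label x i j))" by auto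
  qed
  then have "measure coin_measure (cyl x \<inter> hit E x) \<le>
      measure coin_measure (\<Union>j\<in>{?f..len x}. cyl x \<inter> cyl (label x i j))"
    by (intro coin.finite_measure_mono) auto
  also have "\<dots> \<le> (\<Sum>j\<in>{?f..len x}. measure coin_measure (cyl x \<inter> cyl (label x i j)))"
    by (intro coin.finite_measure_subadditive_finite) auto
  finally have "cprob x (hit E x) \<le> (\<Sum>j\<in>{?f..len x}. measure coin_measure (cyl x \<inter> cyl (label x i j))) * 2 ^ length x"
    by (simp add: cprob_def)
  also have "\<dots> = (\<Sum>j=?f..len x. cprob x (cyl (label x i j)))"
    by (simp add: cprob_def sum_distrib_right)
  also have "\<dots> = (\<Sum>j=?f..len x. (1/2) ^ Suc j * (1/2) ^ (j * ?N))"
    using xX by (intro sum.cong refl prob_label) auto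
  also have "\<dots> \<le> (\<Sum>j=?f..len x. (1/2) ^ Suc j * (1/2) ^ (?f * ?N))"
    by (intro sum_mono mult_left_mono power_decreasing mult_right_mono) auto
  also have "\<dots> = (\<Sum>j=?f..len x. (1/2) ^ Suc j) * (1/2) ^ (?f * ?N)"
    by (rule sum_distrib_right[symmetric])
  also have "\<dots> \<le> (1/2) ^ ?f * (1/2) ^ (?f * ?N)"
    by (intro mult_right_mono sum_half_powers_from) auto
  also have "\<dots> = weight E x i" using True by (simp add: weight_def power_add)
  finally show ?thesis .
qed

text \<open>The label at the pick itself suffices; its exit bit accounts for the factor 1/2.\<close>

lemma hit_lower:
  assumes "ranked x i" "active x i"
  shows "weight E x i / 2 \<le> cprob x (hit E x)"
proof (cases "chosen E x")
  case True
  let ?f = "first E x"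
  have xX: "x \<in> X" using ranked_source[OF assms(1)] by simp
  have "cyl (label x i ?f) \<subseteq> hit E x"
    using hits_iff[OF assms(1)] assms(2) chosen_first[OF True] by (auto simp: hit_def visit_def)
  then have "cprob x (cyl (label x i ?f)) \<le> cprob x (hit E x)"
    by (intro cprob_mono) auto
  moreover have "cprob x (cyl (label x i ?f)) = weight E x i / 2"
    using True chosen_first(2)[OF True] by (simp add: prob_label[OF xX] weight_def power_add)
  ultimately show ?thesis by simp
qed (simp add: weight_def)

lemma chosen_advance:
  assumes "x \<in> Z"
  shows "chosen (advance X Y Z E) x \<longleftrightarrow> chosen E x"
    and "chosen E x \<Longrightarrow> first (advance X Y Z E) x = min (Suc (first E x)) (len x)"
proof -
  note adv = advance_iff[OF Z_subset assms]
  show iff: "chosen (advance X Y Z E) x \<longleftrightarrow> chosen E x"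
  proof
    assume "chosen (advance X Y Z E) x"
    then show "chosen E x" unfolding chosen_def using adv by (metis le_trans less_imp_le_nat)
  next
    assume c: "chosen E x"
    then have "nth_node x (len x) \<in> advance X Y Z E"
      using chosen_first[OF c] adv[of "len x" E] by (cases "first E x = len x") auto
    then show "chosen (advance X Y Z E) x" by (auto simp: chosen_def)
  qed
  assume c: "chosen E x"
  note f = chosen_first[OF c]
  have c': "chosen (advance X Y Z E) x" using c iff by simp
  note f' = chosen_first[OF c']
  show "first (advance X Y Z E) x = min (Suc (first E x)) (len x)"
  proof (rule antisym)
    show "first (advance X Y Z E) x \<le> min (Suc (first E x)) (len x)"
    proof (cases "first E x < len x")
      case True
      then have "nth_node x (Suc (first E x)) \<in> advance X Y Z E" using f adv[of "Suc (first E x)" E] by auto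
      from first_le[OF this] show ?thesis using True by simp
    next
      case False
      then show ?thesis using f'(2) f(2) by simp
    qed
    show "min (Suc (first E x)) (len x) \<le> first (advance X Y Z E) x"
      using f' adv[of "first (advance X Y Z E) x" E] first_le[of x _ E] by fastforce
  qed
qed

lemma weight_advance_le: "x \<in> Z \<Longrightarrow> weight (advance X Y Z E) x i \<le> weight E x i"
proof (cases "chosen E x")
  case True
  assume x: "x \<in> Z"
  have "first E x \<le> first (advance X Y Z E) x"
    using chosen_advance(2)[OF x True] chosen_first(2)[OF True] by simp
  then have "(1/2 :: real) ^ (first (advance X Y Z E) x * Suc (\<nu> (i div 2))) \<le> (1/2) ^ (first E x * Suc (\<nu> (i div 2)))"
    by (intro power_decreasing mult_right_mono) auto
  then show ?thesis using True chosen_advance(1)[OF x, of E] by (simp only: weight_def if_True)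
qed (simp add: weight_def chosen_advance(1))

text \<open>The first summand covers a pick that moves, the second one a pick that ends at the last
  position.\<close>

lemma weight_advance_le':
  assumes "x \<in> Z"
  shows "weight (advance X Y Z E) x i \<le>
    (1/2) ^ Suc (\<nu> (i div 2)) * weight E x i + (1/2) ^ (len x * Suc (\<nu> (i div 2)))"
proof (cases "chosen E x")
  case True
  let ?M = "Suc (\<nu> (i div 2))"
  have "(1/2 :: real) ^ (min (Suc (first E x)) (len x) * ?M) \<le> (1/2) ^ (Suc (first E x) * ?M) + (1/2) ^ (len x * ?M)"
    by (auto simp: min_def)
  then show ?thesis using True chosen_advance[OF assms, of E] by (simp add: weight_def power_add mult_ac)
qed (use chosen_advance(1)[OF assms, of E] in \<open>simp add: weight_def\<close>)

lemma successor_facts: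
  assumes "ranked x i" "x \<in> A" "w \<in> successors x i"
  shows "ranked w (Suc i)" "w \<in> Z" "Suc i div 2 = i div 2" "active w (Suc i) \<longleftrightarrow> len w = len x"
proof -
  show w: "ranked w (Suc i)" and "w \<in> Z" using assms(3) by (auto simp: successors_def Z_def)
  have "even i" using ranked_source[OF assms(1)] assms(2) by simp
  then show "Suc i div 2 = i div 2" by simp
  have "w \<notin> A" using ranked_source[OF w] \<open>even i\<close> by simp
  show "active w (Suc i) \<longleftrightarrow> len w = len x"
  proof
    assume "active w (Suc i)"
    then obtain p j where p: "Suc i = Suc j" "ranked p j" "strict_prefix p w" "len p = len w"
      using \<open>w \<notin> A\<close> unfolding active_def by (elim disjE exE conjE) simp_all
    have "p = x"
    proof (rule ranked_unique)
      show "ranked p i" "ranked x i" using p(1,2) assms(1) by simp_all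
      show "prefix p w" "prefix x w" using p(3) assms(3) by (simp_all add: successors_def strict_prefix_def)
    qed
    with p(4) show "len w = len x" by simp
  next
    assume "len w = len x"
    then have "Suc i = Suc i \<and> ranked x i \<and> strict_prefix x w \<and> len x = len w"
      using assms(1,3) by (simp add: successors_def)
    then show "active w (Suc i)" unfolding active_def by blast
  qed
qed

lemma successor_prefix: "w \<in> successors x i \<Longrightarrow> prefix x w"
  by (simp add: successors_def strict_prefix_def)

lemma hit_successor_subset: "w \<in> successors x i \<Longrightarrow> hit E w \<subseteq> cyl w"
  using ranked_source hit_subset_cyl unfolding successors_def by blast

text \<open>Active successors share the length and the value of \<nu> with \<open>x\<close>, so the
  bounds on weights are uniform in \<open>w\<close> and pass to \<open>x\<close> by averaging;
  inactive successors contribute nothing. The factor 2 is the loss between \<open>hit_lower\<close>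
  and \<open>hit_upper\<close>.\<close>

lemma hit_next_advance_le:
  assumes x: "ranked x i" "x \<in> A"
  defines "M \<equiv> Suc (\<nu> (i div 2))"
  shows "cprob x (hit_next (advance X Y Z E) x) \<le> 2 * cprob x (hit_next E x)" (is ?thesis1)
    and "cprob x (hit_next (advance X Y Z E) x) \<le> 2 * (1/2) ^ M * cprob x (hit_next E x) + (1/2) ^ (len x * M)"
      (is ?thesis2)
proof -
  have *: "cprob w (hit (advance X Y Z E) w) \<le> 2 * cprob w (hit E w) \<and>
      cprob w (hit (advance X Y Z E) w) \<le> 2 * (1/2) ^ M * cprob w (hit E w) + (1/2) ^ (len x * M)"
    if w: "w \<in> successors x i" for w
  proof (cases "active w (Suc i)")
    case True
    note sf = successor_facts[OF x w]
    have len: "len w = len x" using True sf(4) by simp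
    have up: "cprob w (hit (advance X Y Z E) w) \<le> weight (advance X Y Z E) w (Suc i)"
      by (rule hit_upper[OF sf(1)])
    have low: "weight E w (Suc i) \<le> 2 * cprob w (hit E w)"
      using hit_lower[OF sf(1) True, of E] by simp
    have "(1/2) ^ M * weight E w (Suc i) \<le> (1/2) ^ M * (2 * cprob w (hit E w))"
      using low by (intro mult_left_mono) auto
    also have "\<dots> = 2 * (1/2) ^ M * cprob w (hit E w)" by simp
    finally show ?thesis
      using up low weight_advance_le[OF sf(2), of E "Suc i"]
        weight_advance_le'[OF sf(2), of E "Suc i", unfolded sf(3) len, folded M_def] by linarith
  next
    case False
    then show ?thesis using hit_inactive successor_facts(1)[OF x w] by simp
  qed
  note eq = hit_next_eq[OF x]
  show ?thesis1
    unfolding eq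
    using cprob_UN_le[of "successors x i" x "hit (advance X Y Z E)" "hit E" 2 0]
      * successor_prefix successors_disjoint hit_successor_subset hit_sets(1) by simp
  show ?thesis2
    unfolding eq
    using cprob_UN_le[of "successors x i" x "hit (advance X Y Z E)" "hit E" "2 * (1/2) ^ M" "(1/2) ^ (len x * M)"]
      * successor_prefix successors_disjoint hit_successor_subset hit_sets(1) by simp
qed

lemma active_A: "x \<in> A \<Longrightarrow> active x i"
  by (simp add: active_def)

text \<open>If the pick at \<open>x\<close> moves, both sides shrink by the same power of 1/2, and
  the error from successors at their last position is at most the new weight at \<open>x\<close>. If
  it stalls, the right side keeps its weight while the left at most doubles. If there is none, both
  sides vanish. In \<open>4 * C\<close> one factor 2 comes from \<open>hit_next_advance_le\<close>
  and one from comparing hits with weights; the summand 2 absorbs the error.\<close>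

lemma advance_dominated:
  assumes x: "ranked x i" "x \<in> A" and C: "C \<ge> 0" and le: "cprob x (hit_next E x) \<le> C * cprob x (hit E x)"
  shows "cprob x (hit_next (advance X Y Z E) x) \<le> (4 * C + 2) * cprob x (hit (advance X Y Z E) x)"
proof -
  let ?M = "Suc (\<nu> (i div 2))"
  have xZ: "x \<in> Z" using x by (auto simp: Z_def)
  let ?a = "cprob x (hit E x)" and ?b = "cprob x (hit_next E x)"
  let ?a' = "cprob x (hit (advance X Y Z E) x)" and ?b' = "cprob x (hit_next (advance X Y Z E) x)"
  have a: "?a \<le> weight E x i" by (rule hit_upper[OF x(1)])
  have a': "weight (advance X Y Z E) x i \<le> 2 * ?a'"
    using hit_lower[OF x(1) active_A[OF x(2)], of "advance X Y Z E"] by simp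
  consider "\<not> chosen E x" | "chosen E x" "first E x = len x" | "chosen E x" "first E x < len x"
    using chosen_first(2)[of E x] by fastforce
  then show ?thesis
  proof cases
    case 1
    then have "?a = 0" using a by (simp add: weight_def antisym)
    then have "?b = 0" using le by (simp add: antisym)
    then have "?b' \<le> 0" using hit_next_advance_le(1)[OF x, of E] by simp
    also have "0 \<le> (4 * C + 2) * ?a'" using C by simp
    finally show ?thesis .
  next
    case 2
    then have "weight (advance X Y Z E) x i = weight E x i"
      using chosen_advance[OF xZ, of E] by (simp add: weight_def)
    then have "?a \<le> 2 * ?a'" using a a' by simp
    then have "C * ?a \<le> C * (2 * ?a')" using C by (rule mult_left_mono)
    moreover have "(4 * C + 2) * ?a' = 2 * (C * (2 * ?a')) + 2 * ?a'" by (simp add: algebra_simps)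
    moreover have "0 \<le> ?a'" by simp
    ultimately show ?thesis
      using hit_next_advance_le(1)[OF x, of E] le by linarith
  next
    case 3
    then have w': "weight (advance X Y Z E) x i = (1/2) ^ ?M * weight E x i"
      using chosen_advance[OF xZ, of E] by (simp add: weight_def power_add min_def)
    have "(1/2 :: real) ^ (len x * ?M) \<le> (1/2) ^ (Suc (first E x) * ?M)"
      using 3 by (intro power_decreasing mult_right_mono) auto
    also have "\<dots> = weight (advance X Y Z E) x i"
      using 3 w' by (simp add: weight_def power_add)
    finally have last: "(1/2) ^ (len x * ?M) \<le> 2 * ?a'" using a' by simp
    have "(1/2) ^ ?M * ?b \<le> (1/2) ^ ?M * (C * ?a)" using le by (intro mult_left_mono) auto
    also have "\<dots> \<le> (1/2) ^ ?M * (C * weight E x i)" using a C by (intro mult_left_mono) auto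
    also have "\<dots> = C * weight (advance X Y Z E) x i" by (simp add: w')
    also have "\<dots> \<le> C * (2 * ?a')" using a' C by (intro mult_left_mono) auto
    finally have "2 * (1/2) ^ ?M * ?b \<le> 2 * (C * (2 * ?a'))" by simp
    moreover have "(4 * C + 2) * ?a' = 2 * (C * (2 * ?a')) + 2 * ?a'" by (simp add: algebra_simps)
    ultimately show ?thesis
      using last hit_next_advance_le(2)[OF x, of E] by linarith
  qed
qed

text \<open>\<open>Z\<close> picks every selected source at position 0, which has weight 1. So a hit
  there has probability at least 1/2, and \<open>C = 2\<close> leaves no exceptional nodes.\<close>

lemma tame_Z: "tame X Y A Z T Z"
  unfolding tame_iff
proof (rule AE_I2, intro exI[of _ 2] conjI)
  fix \<pi>
  have "\<not> (x \<in> Z \<inter> A \<and> cprob x (hit_next Z x) > 2 * cprob x (hit Z x))" for x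
  proof
    assume *: "x \<in> Z \<inter> A \<and> cprob x (hit_next Z x) > 2 * cprob x (hit Z x)"
    then obtain i where i: "ranked x i" "x \<in> A" by (auto simp: Z_def)
    have "nth_node x 0 \<in> Z" using * ranked_source[OF i(1)] by (simp add: nth_node_0)
    then have "chosen Z x" "first Z x = 0" using first_le[of x 0 Z] by (auto simp: chosen_def)
    then have "1 \<le> 2 * cprob x (hit Z x)"
      using hit_lower[OF i(1) active_A[OF i(2)], of Z] by (simp add: weight_def)
    with * cprob_le_1[of x "hit_next Z x"] show False by linarith
  qed
  then show "bsum (\<lambda>x. if x \<in> Z \<inter> A \<and> cprob x (hit_next Z x) > 2 * cprob x (hit Z x)
      then ennreal (cprob x (hit_next Z x)) else 0) \<pi> < \<infinity>"
    by (simp only: if_False) (simp add: bsum_def)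
qed simp

text \<open>By \<open>advance_dominated\<close> a node exceptional for the advanced set with
  constant \<open>4 * C + 2\<close> was exceptional for \<open>E\<close> with \<open>C\<close>, and
  its term at most doubles.\<close>

lemma tame_advance:
  assumes "tame X Y A Z T E"
  shows "tame X Y A Z T (advance X Y Z E)"
  using assms unfolding tame_iff
proof eventually_elim
  case (elim \<pi>)
  then obtain C where C: "C \<ge> 0" "bsum (\<lambda>x. if x \<in> Z \<inter> A \<and> cprob x (hit_next E x) > C * cprob x (hit E x)
      then ennreal (cprob x (hit_next E x)) else 0) \<pi> < \<infinity>" (is "bsum ?f \<pi> < _") by blast
  let ?E = "advance X Y Z E"
  show ?case
  proof (intro exI[of _ "4 * C + 2"] conjI)
    have "bsum (\<lambda>x. if x \<in> Z \<inter> A \<and> cprob x (hit_next ?E x) > (4 * C + 2) * cprob x (hit ?E x)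
        then ennreal (cprob x (hit_next ?E x)) else 0) \<pi> \<le> bsum (\<lambda>x. ennreal 2 * ?f x) \<pi>"
    proof (intro bsum_mono)
      fix x
      show "(if x \<in> Z \<inter> A \<and> cprob x (hit_next ?E x) > (4 * C + 2) * cprob x (hit ?E x)
        then ennreal (cprob x (hit_next ?E x)) else 0) \<le> ennreal 2 * ?f x"
      proof (cases "x \<in> Z \<inter> A \<and> cprob x (hit_next ?E x) > (4 * C + 2) * cprob x (hit ?E x)")
        case True
        then obtain i where i: "ranked x i" "x \<in> A" by (auto simp: Z_def)
        have "cprob x (hit_next E x) > C * cprob x (hit E x)"
          using advance_dominated[OF i C(1), of E] True by linarith
        then have "?f x = ennreal (cprob x (hit_next E x))" using True by simp
        then show ?thesis
          using True hit_next_advance_le(1)[OF i, of E]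
          by (simp add: ennreal_mult[symmetric] ennreal_leI del: ennreal_numeral)
      next
        case False
        then show ?thesis by (simp only: if_False) simp
      qed
    qed
    also have "\<dots> = ennreal 2 * bsum ?f \<pi>" by (rule bsum_cmult)
    also have "\<dots> < \<infinity>" using C(2) by (simp add: ennreal_mult_less_top)
    finally show "bsum (\<lambda>x. if x \<in> Z \<inter> A \<and> cprob x (hit_next ?E x) > (4 * C + 2) * cprob x (hit ?E x)
        then ennreal (cprob x (hit_next ?E x)) else 0) \<pi> < \<infinity>" .
  qed (use C in simp)
qed

end

section \<open>Tame sets do not separate\<close>

context marking
begin

lemma rank_le_length: "ranked x i \<Longrightarrow> i \<le> length x"
  by (induction rule: ranked.induct) (auto simp: follows_def gap_def)

lemma ranked_on_branch_if_io:
  assumes "io \<pi> (\<lambda>x. x \<in> Z)"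
  shows "\<exists>x\<in>nodes_of \<pi>. ranked x i"
proof -
  have below: "\<exists>x\<in>nodes_of \<pi>. ranked x j" if y: "y \<in> nodes_of \<pi>" "ranked y k" "j \<le> k" for y j k
  proof (cases "j = k")
    case False
    then obtain p where "ranked p j" "strict_prefix p y"
      using ranked_below[OF y(2), of j] y(3) by auto
    then show ?thesis
      using prefix_in_nodes_of[OF y(1), of p] by (auto simp: strict_prefix_def)
  qed (use y in blast)
  show ?thesis
  proof (induction i)
    case 0
    obtain n where "branch_node \<pi> n \<in> Z" using assms by (auto simp: io_iff)
    then obtain k where "ranked (branch_node \<pi> n) k" by (auto simp: Z_def)
    from below[OF branch_node_in_nodes_of this, of 0] show ?case by simp
  next
    case (Suc i)
    then obtain x where x: "x \<in> nodes_of \<pi>" "ranked x i" by blast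
    obtain n where n: "n \<ge> Suc (length x)" "branch_node \<pi> n \<in> Z" using assms unfolding io_iff by blast
    then obtain k where k: "ranked (branch_node \<pi> n) k" by (auto simp: Z_def)
    have "strict_prefix x (branch_node \<pi> n)" using n(1) by (intro strict_prefix_nodes_of[OF x(1)]) auto
    from ranked_less(1)[OF x(2) k this] below[OF branch_node_in_nodes_of k, of "Suc i"] show ?case by simp
  qed
qed

lemma ranked_less_on_branch:
  assumes "x \<in> nodes_of \<pi>" "y \<in> nodes_of \<pi>" "ranked x i" "ranked y j" "i < j"
  shows "strict_prefix x y"
proof -
  have "x \<noteq> y" using ranked_rank_unique[of x i j] assms by auto
  moreover have "\<not> strict_prefix y x" using ranked_less(1)[OF assms(4,3)] assms(5) by auto
  moreover have "prefix x y \<or> prefix y x"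
    using prefix_nodes_of[OF assms(1,2)] prefix_nodes_of[OF assms(2,1)] by linarith
  ultimately show ?thesis by (auto simp: strict_prefix_def)
qed

lemma weight_movable:
  assumes "w \<in> X" "movable X Y E w"
  shows "(1/2) ^ ((len w - 1) * Suc (\<nu> (i div 2))) \<le> weight E w i"
proof -
  obtain k where k: "k < len w" "nth_node w k \<in> E" using assms by (auto simp: movable_iff)
  then have "chosen E w" by (auto simp: chosen_def intro: less_imp_le)
  moreover have "first E w \<le> len w - 1" using first_le[OF k(2)] k(1) by simp
  then have "(1/2 :: real) ^ ((len w - 1) * Suc (\<nu> (i div 2))) \<le> (1/2) ^ (first E w * Suc (\<nu> (i div 2)))"
    by (intro power_decreasing mult_right_mono) auto
  ultimately show ?thesis by (simp only: weight_def if_True)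
qed

text \<open>Compared with \<open>weight_movable\<close> at equal length and equal \<nu>, the bounds
  differ by the factor \<open>2 ^ Suc (\<nu> (i div 2))\<close>, which eventually beats every
  constant.\<close>

lemma weight_not_movable:
  assumes "x \<in> X" "\<not> movable X Y E x"
  shows "weight E x i \<le> (1/2) ^ (len x * Suc (\<nu> (i div 2)))"
proof (cases "chosen E x")
  case True
  have "\<not> first E x < len x"
    using assms chosen_first(1)[OF True] by (auto simp: movable_iff)
  then have "first E x = len x" using chosen_first(2)[OF True] by simp
  then show ?thesis by (simp add: weight_def)
qed (simp add: weight_def)

text \<open>The successors of \<open>x\<close> at which a branch continues if \<open>E\<close> separates \<open>A\<close> from its complement.\<close>

definition bad_successors :: "node set \<Rightarrow> node \<Rightarrow> node set" where
  "bad_successors E x = {w. \<exists>i. ranked x i \<and> w \<in> successors x i \<and> len w = len x \<and> movable X Y E w}"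

lemma settled_bad_successors: "settled (Z \<inter> A) (\<lambda>x. - visit (bad_successors E x))"
proof (intro settled_compl settled_visit)
  fix x y t assume *: "x \<in> Z \<inter> A" "y \<in> Z \<inter> A" "strict_prefix x y" "t \<in> bad_successors E x"
  then obtain i where i: "ranked x i" "t \<in> successors x i" by (auto simp: bad_successors_def)
  obtain j where j: "ranked y j" using * by (auto simp: Z_def)
  have t: "ranked t (Suc i)" using i by (simp add: successors_def)
  have even: "even i" "even j" using ranked_source[OF i(1)] ranked_source[OF j] * by auto
  have "i < j" using ranked_less(1)[OF i(1) j *(3)] .
  show "\<not> prefix y t"
  proof
    assume "prefix y t"
    moreover have "y \<noteq> t" using ranked_rank_unique[of t j "Suc i"] j t even by auto
    ultimately have "strict_prefix y t" by (auto simp: strict_prefix_def)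
    from ranked_less(1)[OF j t this] \<open>i < j\<close> show False by simp
  qed
qed

text \<open>Of the factor 1/4, one half is the probability of reaching a bad successor and the other
  is the loss in \<open>hit_lower\<close>.\<close>

lemma bad_successor_bound:
  assumes x: "ranked x i" "x \<in> A" and half: "1/2 \<le> cprob x (visit (bad_successors E x))"
  shows "(1/4) * (1/2) ^ ((len x - 1) * Suc (\<nu> (i div 2))) \<le> cprob x (hit_next E x)"
proof -
  let ?c = "(1/2) * (1/2 :: real) ^ ((len x - 1) * Suc (\<nu> (i div 2)))"
  have "?c \<le> cprob w (hit E w)" if bad: "w \<in> bad_successors E x" for w
  proof -
    obtain j where "ranked x j" "w \<in> successors x j" "len w = len x" "movable X Y E w"
      using bad by (auto simp: bad_successors_def)
    then have w: "w \<in> successors x i" "len w = len x" "movable X Y E w"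
      using ranked_rank_unique[OF x(1)] by auto
    note sf = successor_facts[OF x w(1)]
    have "w \<in> X" using ranked_source[OF sf(1)] by simp
    from weight_movable[OF this w(3), of "Suc i"] hit_lower[OF sf(1), of E] sf(3,4) w(2)
    show ?thesis by simp
  qed
  moreover have "bad_successors E x \<subseteq> successors x i"
    using ranked_rank_unique[OF x(1)] by (auto simp: bad_successors_def)
  ultimately have "?c * cprob x (visit (bad_successors E x)) \<le> cprob x (\<Union>w\<in>successors x i. hit E w)"
    by (intro cprob_UN_ge successor_prefix successors_disjoint hit_successor_subset) auto
  moreover have "?c * (1/2) \<le> ?c * cprob x (visit (bad_successors E x))"
    using half by (intro mult_left_mono) auto
  ultimately have "?c * (1/2) \<le> cprob x (\<Union>w\<in>successors x i. hit E w)" by linarith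
  then show ?thesis by (simp add: hit_next_eq[OF x])
qed

text \<open>On a separating branch almost every selected source in \<open>A\<close> is followed by a
  bad successor. By conditional Borel-Cantelli, bad successors then have probability above 1/2 at
  almost all these sources, or the branch would avoid them infinitely often. This makes
  \<open>hit_next\<close> large while \<open>hit\<close> stays small, so these sources are
  exceptional for every \<open>C\<close>, and slowness of \<nu> makes their sum diverge.\<close>

lemma tame_not_separates:
  assumes settles: "AE \<pi> in coin_measure. settles X Y \<pi>" and tame: "tame X Y A Z T E"
  shows "AE \<pi> in coin_measure. \<not> separates X Y A Z E \<pi>"
proof -
  let ?H = "\<lambda>x. - visit (bad_successors E x)"
  define S where "S = {x \<in> Z \<inter> A. 1/2 \<le> cprob x (?H x)}"
  have "S \<subseteq> Z \<inter> A" by (auto simp: S_def)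
  have sets: "?H x \<in> sets coin_measure" for x
    using sets.compl_sets[OF visit_sets[of "bad_successors E x"]] by (simp add: Compl_eq_Diff_UNIV)
  have "AE \<pi> in coin_measure.
      bsum (\<lambda>x. if x \<in> S then ennreal (cprob x (?H x)) else 0) \<pi> = \<infinity> \<longrightarrow> io \<pi> (\<lambda>x. x \<in> S \<and> \<pi> \<in> ?H x)"
    using sets settled_subset[OF settled_bad_successors \<open>S \<subseteq> Z \<inter> A\<close>] by (rule borel_cantelli_infinite)
  with settles tame[unfolded tame_iff] show ?thesis
  proof eventually_elim
    case (elim \<pi>)
    show ?case
    proof
      assume sep: "separates X Y A Z E \<pi>"
      obtain c m1 where m1: "\<And>n. n \<ge> m1 \<Longrightarrow> \<not> (branch_node \<pi> n \<in> X \<and> len (branch_node \<pi> n) \<noteq> c)"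
        using elim(1) unfolding settles_def not_io_iff by blast
      obtain m2 where m2: "\<And>n. n \<ge> m2 \<Longrightarrow> \<not> (branch_node \<pi> n \<in> Z \<and> branch_node \<pi> n \<in> A \<and> movable X Y E (branch_node \<pi> n))"
        using sep unfolding separates_def not_io_iff by blast
      obtain m3 where m3: "\<And>n. n \<ge> m3 \<Longrightarrow> \<not> (branch_node \<pi> n \<in> Z \<and> branch_node \<pi> n \<notin> A \<and> \<not> movable X Y E (branch_node \<pi> n))"
        using sep unfolding separates_def not_io_iff by blast
      have io: "io \<pi> (\<lambda>x. x \<in> Z)" using sep by (simp add: separates_def)
      define m where "m = Max {m1, m2, m3}"
      have late: "len x = c" "x \<in> A \<Longrightarrow> \<not> movable X Y E x" "x \<notin> A \<Longrightarrow> movable X Y E x"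
        if "x \<in> nodes_of \<pi>" "x \<in> Z" "length x \<ge> m" for x
      proof -
        have x: "branch_node \<pi> (length x) = x" using that(1) by (simp add: in_nodes_of_eq)
        have le: "m1 \<le> length x" "m2 \<le> length x" "m3 \<le> length x" using that(3) by (auto simp: m_def)
        have "x \<in> X" using that(2) Z_subset by blast
        with that(2) m1[OF le(1), unfolded x] m2[OF le(2), unfolded x] m3[OF le(3), unfolded x]
        show "len x = c" "x \<in> A \<Longrightarrow> \<not> movable X Y E x" "x \<notin> A \<Longrightarrow> movable X Y E x" by blast+
      qed
      define z where "z i = (SOME x. x \<in> nodes_of \<pi> \<and> ranked x i)" for i
      have z: "z i \<in> nodes_of \<pi>" "ranked (z i) i" for i
        using someI_ex[of "\<lambda>x. x \<in> nodes_of \<pi> \<and> ranked x i"] ranked_on_branch_if_io[OF io, of i]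
        by (auto simp: z_def)
      have in_visit: "\<pi> \<in> visit (bad_successors E x)"
        if x: "x \<in> nodes_of \<pi>" "x \<in> Z" "x \<in> A" "length x \<ge> m" for x
      proof -
        obtain i where i: "ranked x i" using x(2) by (auto simp: Z_def)
        let ?w = "z (Suc i)"
        have xw: "strict_prefix x ?w" using ranked_less_on_branch[OF x(1) z(1) i z(2)] by simp
        then have len: "length ?w \<ge> m" using x(4) prefix_length_less[of x ?w] by simp
        have w: "?w \<in> successors x i" using xw z(2) by (simp add: successors_def)
        have "even i" using ranked_source[OF i] x(3) by simp
        then have "?w \<notin> A" using ranked_source[OF z(2)[of "Suc i"]] by simp
        moreover have "?w \<in> Z" using z(2) by (auto simp: Z_def)
        ultimately have "len ?w = len x" "movable X Y E ?w"
          using late[OF z(1) _ len] late(1)[OF x(1,2,4)] by auto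
        then have "?w \<in> bad_successors E x" using i w by (auto simp: bad_successors_def)
        then show ?thesis using z(1) by (auto simp: mem_visit_iff)
      qed
      have "\<not> (branch_node \<pi> n \<in> S \<and> \<pi> \<in> ?H (branch_node \<pi> n))" if "n \<ge> m" for n
        using in_visit[of "branch_node \<pi> n"] that \<open>S \<subseteq> Z \<inter> A\<close> by auto
      then have "\<not> io \<pi> (\<lambda>x. x \<in> S \<and> \<pi> \<in> ?H x)"
        unfolding not_io_iff by blast
      then have "bsum (\<lambda>x. if x \<in> S then ennreal (cprob x (?H x)) else 0) \<pi> \<noteq> \<infinity>"
        using elim(3) by blast
      then have "\<not> io \<pi> (\<lambda>x. ennreal (1/2) \<le> (if x \<in> S then ennreal (cprob x (?H x)) else 0))"
        by (rule contrapos_nn) (erule bsum_eq_top_io, simp)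
      then have "\<not> io \<pi> (\<lambda>x. x \<in> S)"
      proof (rule contrapos_nn)
        assume "io \<pi> (\<lambda>x. x \<in> S)"
        then show "io \<pi> (\<lambda>x. ennreal (1/2) \<le> (if x \<in> S then ennreal (cprob x (?H x)) else 0))"
        proof (rule io_mono)
          fix x assume "x \<in> S"
          then have "ennreal (1/2) \<le> ennreal (cprob x (?H x))" by (intro ennreal_leI) (simp add: S_def)
          with \<open>x \<in> S\<close> show "ennreal (1/2) \<le> (if x \<in> S then ennreal (cprob x (?H x)) else 0)"
            by (simp only: if_True)
        qed
      qed
      then obtain m4 where m4: "\<And>n. n \<ge> m4 \<Longrightarrow> branch_node \<pi> n \<notin> S" unfolding not_io_iff by blast
      obtain C where C: "C \<ge> 0" "bsum (\<lambda>x. if x \<in> Z \<inter> A \<and> cprob x (hit_next E x) > C * cprob x (hit E x)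
          then ennreal (cprob x (hit_next E x)) else 0) \<pi> < \<infinity>" (is "bsum ?f \<pi> < _") using elim(2) by blast
      \<comment> \<open>The lower bound on \<open>hit_next\<close> exceeds the upper bound on
        \<open>hit\<close> by the factor \<open>2 ^ Suc (\<nu> k) / 4\<close>, which is above
        \<open>C\<close> once \<nu> has reached \<open>K\<close>.\<close>
      obtain K where K: "4 * C < 2 ^ K" using real_arch_pow[of 2 "4 * C"] by auto
      obtain m5 where m5: "\<And>i. i \<ge> m5 \<Longrightarrow> K \<le> \<nu> i" using \<nu>_large by blast
      define m' where "m' = Max {m, m4, m5}"
      let ?g = "\<lambda>k. (1/4) * (1/2 :: real) ^ ((c - 1) * Suc (\<nu> k))"
      \<comment> \<open>The sources in \<open>A\<close> are those of even rank, and halving the rank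
        \<open>2 * k\<close> gives the index \<open>k\<close> for \<nu>.\<close>
      have large: "ennreal (?g k) \<le> ?f (z (2 * k))" if k: "k \<ge> m'" for k
      proof -
        let ?x = "z (2 * k)" and ?M = "Suc (\<nu> k)"
        have "2 * k \<le> length ?x" using rank_le_length[OF z(2)] .
        then have len: "m \<le> length ?x" "m4 \<le> length ?x" "m5 \<le> k" using k by (auto simp: m'_def)
        have x: "ranked ?x (2 * k)" "?x \<in> A" "?x \<in> X" "?x \<in> Z"
          using z(2)[of "2 * k"] ranked_source[OF z(2)[of "2 * k"]] by (auto simp: Z_def)
        have nx: "?x \<in> nodes_of \<pi>" by (rule z(1))
        have lc: "len ?x = c" and nm: "\<not> movable X Y E ?x" using late[OF nx x(4) len(1)] x(2) by auto
        \<comment> \<open>A bad successor has length \<open>c\<close> and a pick that can still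
          move, so there is room for one step; this makes the exponent \<open>c - 1\<close>
          genuine.\<close>
        have c: "0 < c"
        proof -
          obtain w where "w \<in> bad_successors E ?x"
            using in_visit[OF nx x(4,2) len(1)] by (auto simp: mem_visit_iff)
          then have "movable X Y E w" "len w = c" "w \<in> X"
            using lc ranked_source by (auto simp: bad_successors_def successors_def)
          then show ?thesis by (auto simp: movable_iff)
        qed
        have "?x \<notin> S" using m4[OF len(2)] nx by (simp add: in_nodes_of_eq)
        then have "cprob ?x (?H ?x) < 1/2" using x by (auto simp: S_def)
        then have "1/2 \<le> cprob ?x (visit (bad_successors E ?x))" by (simp add: cprob_compl)
        from bad_successor_bound[OF x(1,2) this]
        have b: "?g k \<le> cprob ?x (hit_next E ?x)" by (simp add: lc)
        have "C * cprob ?x (hit E ?x) \<le> C * (1/2) ^ (c * ?M)"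
          using hit_upper[OF x(1), of E] weight_not_movable[OF x(3) nm, of "2 * k"] C(1)
          by (intro mult_left_mono) (auto simp: lc)
        also have "\<dots> < (1/4) * 2 ^ ?M * (1/2) ^ (c * ?M)"
        proof (intro mult_strict_right_mono)
          have "(2 :: real) ^ K \<le> 2 ^ ?M" using m5[OF len(3)] by (intro power_increasing) auto
          with K show "C < (1/4) * 2 ^ ?M" by simp
        qed auto
        also have "\<dots> = ?g k"
        proof -
          have "c * ?M = ?M + (c - 1) * ?M" using c by (cases c) auto
          then show ?thesis by (simp add: power_add power_divide)
        qed
        finally have "C * cprob ?x (hit E ?x) < ?g k" .
        with b x show ?thesis by (auto intro!: ennreal_leI)
      qed
      have "bsum ?f \<pi> = \<infinity>"
      proof (rule bsum_eq_top[of m' "\<lambda>k. z (2 * k)" _ ?g])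
        show "inj_on (\<lambda>k. length (z (2 * k))) {m'..}"
        proof (rule linorder_inj_onI)
          fix k l :: nat assume "k < l"
          then have "strict_prefix (z (2 * k)) (z (2 * l))"
            using z by (intro ranked_less_on_branch[of _ \<pi> _ "2 * k" "2 * l"]) auto
          then show "length (z (2 * k)) \<noteq> length (z (2 * l))" using prefix_length_less by force
        qed auto
        show "\<not> summable ?g" using \<nu>_slow[of "c - 1"] by (subst summable_cmult_iff) simp
      qed (use z large in auto)
      with C(2) show False by simp
    qed
  qed
qed

end

section \<open>From settling lengths to recurrence and a certificate\<close>

context interval_nodes
begin

text \<open>Once the lengths on the branch equal \<open>c\<close>, each source in \<open>J\<close>
  contributes the fixed amount \<open>(1/2) ^ Suc c\<close>, so the sum diverges whenever
  \<open>J\<close> recurs. The events are settled because no interval contains a further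
  source.\<close>

lemma recurrent_if_settles:
  assumes "AE \<pi> in coin_measure. settles X Y \<pi>"
  shows "recurrent X Y"
  unfolding recurrent_def
proof (intro allI impI)
  fix J assume J: "J \<subseteq> X"
  have "settled J (\<lambda>x. visit {tgt x})"
    using no_source_inside J by (intro settled_visit) auto
  then have "AE \<pi> in coin_measure. bsum (\<lambda>x. if x \<in> J then ennreal (cprob x (visit {tgt x})) else 0) \<pi> = \<infinity> \<longrightarrow>
      io \<pi> (\<lambda>x. x \<in> J \<and> \<pi> \<in> visit {tgt x})"
    by (intro borel_cantelli_infinite) auto
  with assms show "AE \<pi> in coin_measure.
    io \<pi> (\<lambda>x. x \<in> J) \<longrightarrow> io \<pi> (\<lambda>x. x \<in> J \<and> (\<exists>y\<in>nodes_of \<pi>. matched X Y x y))"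
  proof eventually_elim
    case (elim \<pi>)
    show ?case
    proof
      assume io: "io \<pi> (\<lambda>x. x \<in> J)"
      obtain c m where m: "\<And>n. n \<ge> m \<Longrightarrow> \<not> (branch_node \<pi> n \<in> X \<and> len (branch_node \<pi> n) \<noteq> c)"
        using elim(1) unfolding settles_def not_io_iff by blast
      let ?f = "\<lambda>x. if x \<in> J then ennreal (cprob x (visit {tgt x})) else 0"
      have "io \<pi> (\<lambda>x. ennreal ((1/2) ^ Suc c) \<le> ?f x)"
        unfolding io_iff
      proof
        fix n
        obtain k where k: "k \<ge> max m n" "branch_node \<pi> k \<in> J" using io unfolding io_iff by blast
        then have "branch_node \<pi> k \<in> X" "len (branch_node \<pi> k) = c" using J m[of k] by auto
        then have "?f (branch_node \<pi> k) = ennreal ((1/2) ^ Suc c)"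
          using k cprob_cyl_tgt by (simp add: visit_def)
        with k show "\<exists>k\<ge>n. ennreal ((1/2) ^ Suc c) \<le> ?f (branch_node \<pi> k)"
          by (intro exI[of _ k]) auto
      qed
      then have "bsum ?f \<pi> = \<infinity>" by (rule bsum_eq_top_io) simp
      with elim(2) have "io \<pi> (\<lambda>x. x \<in> J \<and> \<pi> \<in> visit {tgt x})" by blast
      then show "io \<pi> (\<lambda>x. x \<in> J \<and> (\<exists>y\<in>nodes_of \<pi>. matched X Y x y))"
        by (rule io_mono) (use J in \<open>auto simp: match_iff mem_visit_iff\<close>)
    qed
  qed
qed

lemma certified_if_settles:
  assumes "AE \<pi> in coin_measure. settles X Y \<pi>"
  shows "certified X Y"
  unfolding certified_def
proof (intro allI impI)
  fix A assume A: "A \<subseteq> X"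
  obtain \<nu> :: "nat \<Rightarrow> nat" where \<nu>: "\<And>K. \<exists>m. \<forall>i\<ge>m. K \<le> \<nu> i"
      "\<And>d. \<not> summable (\<lambda>i. (1/2 :: real) ^ (d * Suc (\<nu> i)))"
    using ex_slow_sequence by blast
  interpret marking X Y A \<nu>
    by unfold_locales (use A \<nu> in auto)
  have "AE \<pi> in coin_measure. io \<pi> (\<lambda>x. x \<in> A) \<and> io \<pi> (\<lambda>x. x \<in> X \<and> x \<notin> A) \<longrightarrow> io \<pi> (\<lambda>x. x \<in> Z)"
    using io_Z by (intro AE_I2) blast
  with Z_subset tame_Z tame_advance tame_not_separates[OF assms]
  show "\<exists>Z\<subseteq>X. \<exists>T.
    (AE \<pi> in coin_measure. io \<pi> (\<lambda>x. x \<in> A) \<and> io \<pi> (\<lambda>x. x \<in> X \<and> x \<notin> A) \<longrightarrow> io \<pi> (\<lambda>x. x \<in> Z)) \<and>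
    tame X Y A Z T Z \<and>
    (\<forall>E. tame X Y A Z T E \<longrightarrow>
      tame X Y A Z T (advance X Y Z E) \<and> (AE \<pi> in coin_measure. \<not> separates X Y A Z E \<pi>))"
    by blast
qed

lemma settles_iff:
  "(AE \<pi> in coin_measure. settles X Y \<pi>) \<longleftrightarrow>
    (AE \<pi> in coin_measure. io \<pi> (\<lambda>x. x \<in> X)) \<and> recurrent X Y \<and> certified X Y"
proof
  assume *: "AE \<pi> in coin_measure. settles X Y \<pi>"
  then have "AE \<pi> in coin_measure. io \<pi> (\<lambda>x. x \<in> X)"
    by eventually_elim (simp add: settles_def)
  with * show "(AE \<pi> in coin_measure. io \<pi> (\<lambda>x. x \<in> X)) \<and> recurrent X Y \<and> certified X Y"
    using recurrent_if_settles certified_if_settles by blast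
qed (use settles_if_certified in blast)

end

section \<open>The formula\<close>

text \<open>The set variables \<open>0\<close> to \<open>7\<close> stand for \<open>X\<close>, \<open>Y\<close>, \<open>A\<close>, \<open>Z\<close>, \<open>T\<close>, \<open>E\<close>, the advanced
  \<open>E\<close> and \<open>P\<close>; the only branch variable is \<open>0\<close>.\<close>

definition f_imp :: "formula \<Rightarrow> formula \<Rightarrow> formula" where
  "f_imp \<phi> \<psi> = Disj (Neg \<phi>) \<psi>"

definition f_less :: "nat \<Rightarrow> nat \<Rightarrow> formula" where
  "f_less x y = Conj (Ancestor x y) (Neg (Ancestor y x))"

definition f_subset :: "nat \<Rightarrow> nat \<Rightarrow> formula" where
  "f_subset U W = AllNode 0 (f_imp (InSet 0 U) (InSet 0 W))"

text \<open>The bound variable 20 is kept apart from the variables of the surrounding formulas, so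
  there is no capture.\<close>

definition f_matched :: "nat \<Rightarrow> nat \<Rightarrow> formula" where
  "f_matched x y = Conj (InSet x 0) (Conj (InSet y 1) (Conj (f_less x y)
    (AllNode 20 (f_imp (InSet 20 0) (Neg (Conj (f_less x 20) (Ancestor 20 y)))))))"

definition f_family :: formula where
  "f_family = Conj (AllNode 0 (f_imp (InSet 0 0) (ExNode 1 (f_matched 0 1))))
    (Conj (AllNode 1 (f_imp (InSet 1 1) (ExNode 0 (f_matched 0 1))))
    (AllNode 0 (AllNode 1 (AllNode 2 (AllNode 3 (AllNode 4
      (f_imp (f_matched 0 1) (f_imp (f_matched 2 3)
      (f_imp (Ancestor 0 4) (f_imp (Ancestor 4 1) (f_imp (Ancestor 2 4) (f_imp (Ancestor 4 3)
      (Conj (Conj (Ancestor 0 2) (Ancestor 2 0)) (Conj (Ancestor 1 3) (Ancestor 3 1)))))))))))))))"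

text \<open>The argument speaks about node variable 1 and branch variable 0; node variable 0 is the
  bound prefix.\<close>

definition f_io :: "formula \<Rightarrow> formula" where
  "f_io \<phi> = AllNode 0 (f_imp (OnBranch 0 0) (ExNode 1 (Conj (OnBranch 1 0) (Conj (Ancestor 0 1) \<phi>))))"

definition f_hits :: "nat \<Rightarrow> nat \<Rightarrow> nat \<Rightarrow> formula" where
  "f_hits E x t = Conj (InSet t 4)
    (Conj (ExNode 3 (Conj (InSet 3 E) (ExNode 4 (Conj (f_matched x 4) (Conj (Ancestor x 3)
      (Conj (f_less 3 4) (Ancestor 3 t)))))))
    (AllNode 3 (f_imp (InSet 3 3) (f_imp (f_less x 3) (Neg (Ancestor 3 t))))))"

definition f_hits_next :: "nat \<Rightarrow> nat \<Rightarrow> nat \<Rightarrow> formula" where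
  "f_hits_next E x t = ExNode 5 (Conj (InSet 5 3) (Conj (Neg (InSet 5 2)) (Conj (f_less x 5)
    (Conj (AllNode 6 (f_imp (InSet 6 3) (f_imp (f_less x 6) (Neg (f_less 6 5))))) (f_hits E 5 t)))))"

definition f_tame :: "nat \<Rightarrow> formula" where
  "f_tame E = AllSet 7 (f_imp (Conj (f_subset 7 3) (f_subset 7 2)) (Nabla 0 (f_imp
    (f_io (Conj (InSet 1 7) (ExNode 2 (Conj (OnBranch 2 0) (f_hits_next E 1 2)))))
    (f_io (Conj (InSet 1 7) (ExNode 2 (Conj (OnBranch 2 0) (f_hits E 1 2))))))))"

text \<open>The function \<open>advance\<close> is expressed by its graph, relating set variables 5
  and 6. A universal quantifier over variable 6 in \<open>f_certified\<close> then stands for the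
  application.\<close>

definition f_advance :: formula where
  "f_advance = (let \<psi> = ExNode 1 (Conj (InSet 1 3) (ExNode 2 (Conj (f_matched 1 2) (Conj (Ancestor 1 0)
      (Conj (f_less 0 2) (Disj
        (ExNode 3 (Conj (InSet 3 5) (Conj (Ancestor 1 3) (f_less 3 0))))
        (Conj (InSet 0 5) (Neg (ExNode 3 (Conj (f_less 0 3) (f_less 3 2)))))))))))
    in AllNode 0 (Conj (f_imp (InSet 0 6) \<psi>) (f_imp \<psi> (InSet 0 6))))"

definition f_movable :: formula where
  "f_movable = ExNode 3 (Conj (InSet 3 5) (ExNode 4 (ExNode 5 (Conj (f_matched 1 4)
    (Conj (Ancestor 1 3) (Conj (f_less 3 5) (f_less 5 4)))))))"

definition f_separates :: formula where
  "f_separates = Conj (f_io (InSet 1 3))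
    (Conj (Neg (f_io (Conj (InSet 1 3) (Conj (InSet 1 2) f_movable))))
    (Neg (f_io (Conj (InSet 1 3) (Conj (Neg (InSet 1 2)) (Neg f_movable))))))"

definition f_certified :: formula where
  "f_certified = AllSet 2 (f_imp (f_subset 2 0) (ExSet 3 (Conj (f_subset 3 0) (ExSet 4
    (Conj (Nabla 0 (f_imp (Conj (f_io (InSet 1 2)) (f_io (Conj (InSet 1 0) (Neg (InSet 1 2)))))
      (f_io (InSet 1 3))))
    (Conj (f_tame 3)
    (AllSet 5 (f_imp (f_tame 5) (Conj (AllSet 6 (f_imp f_advance (f_tame 6)))
      (Nabla 0 (Neg f_separates)))))))))))"

definition f_recurrent :: formula where
  "f_recurrent = AllSet 2 (f_imp (f_subset 2 0) (Nabla 0 (f_imp (f_io (InSet 1 2))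
    (f_io (Conj (InSet 1 2) (ExNode 2 (Conj (OnBranch 2 0) (f_matched 1 2))))))))"

definition f_settles :: formula where
  "f_settles = Conj f_family (Conj (Nabla 0 (f_io (InSet 1 0))) (Conj f_recurrent f_certified))"

lemma sat_imp [simp]: "sat v V b (f_imp \<phi> \<psi>) \<longleftrightarrow> (sat v V b \<phi> \<longrightarrow> sat v V b \<psi>)"
  by (auto simp: f_imp_def)

lemma sat_less [simp]: "sat v V b (f_less x y) \<longleftrightarrow> strict_prefix (v x) (v y)"
  by (auto simp: f_less_def strict_prefix_def)

lemma sat_subset [simp]: "sat v V b (f_subset U W) \<longleftrightarrow> V U \<subseteq> V W"
  by (auto simp: f_subset_def)

lemma sat_Nabla: "sat v V b (Nabla p \<phi>) \<longleftrightarrow> (AE \<pi> in coin_measure. sat v V (b(p := \<pi>)) \<phi>)"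
  by (simp add: AE_coin_iff)

lemma sat_matched [simp]:
  "x \<noteq> 20 \<Longrightarrow> y \<noteq> 20 \<Longrightarrow> sat v V b (f_matched x y) \<longleftrightarrow> matched (V 0) (V 1) (v x) (v y)"
  by (auto simp: f_matched_def matched_def)

lemma prefix_antisym_iff: "prefix x y \<and> prefix y x \<longleftrightarrow> x = y"
  by auto

lemma sat_family [simp]: "sat v V b f_family \<longleftrightarrow> is_family (V 0) (V 1)"
  by (simp add: f_family_def is_family_def prefix_antisym_iff Ball_def)

lemma sat_io:
  assumes "\<And>u x. sat (v(0 := u, 1 := x)) V b \<phi> \<longleftrightarrow> Q x"
  shows "sat v V b (f_io \<phi>) \<longleftrightarrow> io (b 0) Q"
  using assms by (auto simp: f_io_def io_def)

lemma sat_hits [simp]: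
  "x \<notin> {3, 4, 20} \<Longrightarrow> t \<notin> {3, 4, 20} \<Longrightarrow>
    sat v V b (f_hits E x t) \<longleftrightarrow> hits (V 0) (V 1) (V 3) (V 4) (V E) (v x) (v t)"
  by (auto simp: f_hits_def hits_def)

lemma sat_hits_next [simp]:
  "x \<notin> {3, 4, 5, 6, 20} \<Longrightarrow> t \<notin> {3, 4, 5, 6, 20} \<Longrightarrow>
    sat v V b (f_hits_next E x t) \<longleftrightarrow> hits_next (V 0) (V 1) (V 2) (V 3) (V 4) (V E) (v x) (v t)"
  by (auto simp: f_hits_next_def hits_next_def)

lemma sat_tame [simp]:
  "E \<noteq> 7 \<Longrightarrow> sat v V b (f_tame E) \<longleftrightarrow> tame (V 0) (V 1) (V 2) (V 3) (V 4) (V E)"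
proof -
  assume E: "E \<noteq> 7"
  have 1: "sat v (V(7 := P)) b (f_io (Conj (InSet 1 7) (ExNode 2 (Conj (OnBranch 2 0) (f_hits_next E 1 2))))) \<longleftrightarrow>
      io (b 0) (\<lambda>x. x \<in> P \<and> (\<exists>t\<in>nodes_of (b 0). hits_next (V 0) (V 1) (V 2) (V 3) (V 4) (V E) x t))" for P b
    using E by (intro sat_io) auto
  have 2: "sat v (V(7 := P)) b (f_io (Conj (InSet 1 7) (ExNode 2 (Conj (OnBranch 2 0) (f_hits E 1 2))))) \<longleftrightarrow>
      io (b 0) (\<lambda>x. x \<in> P \<and> (\<exists>t\<in>nodes_of (b 0). hits (V 0) (V 1) (V 3) (V 4) (V E) x t))" for P b
    using E by (intro sat_io) auto
  show ?thesis
    unfolding f_tame_def tame_def by (simp add: sat_Nabla 1 2 del: sat.simps(13) One_nat_def)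
qed

lemma sat_advance [simp]:
  "sat v V b f_advance \<longleftrightarrow> V 6 = advance (V 0) (V 1) (V 3) (V 5)"
  unfolding f_advance_def advance_def Let_def set_eq_iff by (simp add: Bex_def) blast

lemma sat_movable [simp]: "sat v V b f_movable \<longleftrightarrow> movable (V 0) (V 1) (V 5) (v 1)"
  by (auto simp: f_movable_def movable_def)

lemma sat_separates [simp]:
  "sat v V b f_separates \<longleftrightarrow> separates (V 0) (V 1) (V 2) (V 3) (V 5) (b 0)"
proof -
  have 1: "sat v V b (f_io (InSet 1 3)) \<longleftrightarrow> io (b 0) (\<lambda>x. x \<in> V 3)"
    by (intro sat_io) auto
  have 2: "sat v V b (f_io (Conj (InSet 1 3) (Conj (InSet 1 2) f_movable))) \<longleftrightarrow>
      io (b 0) (\<lambda>x. x \<in> V 3 \<and> x \<in> V 2 \<and> movable (V 0) (V 1) (V 5) x)"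
    by (intro sat_io) auto
  have 3: "sat v V b (f_io (Conj (InSet 1 3) (Conj (Neg (InSet 1 2)) (Neg f_movable)))) \<longleftrightarrow>
      io (b 0) (\<lambda>x. x \<in> V 3 \<and> x \<notin> V 2 \<and> \<not> movable (V 0) (V 1) (V 5) x)"
    by (intro sat_io) auto
  show ?thesis by (simp add: f_separates_def separates_def 1 2 3 del: One_nat_def)
qed

lemma sat_certified [simp]: "sat v V b f_certified \<longleftrightarrow> certified (V 0) (V 1)"
proof -
  have 1: "sat v V b (f_io (InSet 1 U)) \<longleftrightarrow> io (b 0) (\<lambda>x. x \<in> V U)" for U V b
    by (intro sat_io) auto
  have 2: "sat v V b (f_io (Conj (InSet 1 U) (Neg (InSet 1 W)))) \<longleftrightarrow> io (b 0) (\<lambda>x. x \<in> V U \<and> x \<notin> V W)" for U W V b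
    by (intro sat_io) auto
  show ?thesis
    unfolding f_certified_def certified_def by (simp add: sat_Nabla 1 2 del: sat.simps(13) One_nat_def)
qed

lemma sat_recurrent [simp]: "sat v V b f_recurrent \<longleftrightarrow> recurrent (V 0) (V 1)"
proof -
  have 1: "sat v V b (f_io (InSet 1 U)) \<longleftrightarrow> io (b 0) (\<lambda>x. x \<in> V U)" for U V b
    by (intro sat_io) auto
  have 2: "sat v V b (f_io (Conj (InSet 1 2) (ExNode 2 (Conj (OnBranch 2 0) (f_matched 1 2))))) \<longleftrightarrow>
      io (b 0) (\<lambda>x. x \<in> V 2 \<and> (\<exists>y\<in>nodes_of (b 0). matched (V 0) (V 1) x y))" for V b
    by (intro sat_io) auto
  show ?thesis
    unfolding f_recurrent_def recurrent_def by (simp add: sat_Nabla 1 2 del: sat.simps(13) One_nat_def)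
qed

lemma sat_settles:
  "sat v V b f_settles \<longleftrightarrow> is_family (V 0) (V 1) \<and> (AE \<pi> in coin_measure. settles (V 0) (V 1) \<pi>)"
proof -
  have 1: "sat v V b (f_io (InSet 1 0)) \<longleftrightarrow> io (b 0) (\<lambda>x. x \<in> V 0)" for b
    by (intro sat_io) auto
  have "sat v V b f_settles \<longleftrightarrow> is_family (V 0) (V 1) \<and>
      (AE \<pi> in coin_measure. io \<pi> (\<lambda>x. x \<in> V 0)) \<and> recurrent (V 0) (V 1) \<and> certified (V 0) (V 1)"
    unfolding f_settles_def by (simp add: sat_Nabla 1 del: sat.simps(13) One_nat_def)
  also have "\<dots> \<longleftrightarrow> is_family (V 0) (V 1) \<and> (AE \<pi> in coin_measure. settles (V 0) (V 1) \<pi>)"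
    using interval_nodes.settles_iff[OF interval_nodes.intro] by blast
  finally show ?thesis .
qed

lemmas formula_defs = f_settles_def f_certified_def f_recurrent_def f_separates_def f_movable_def
  f_advance_def f_tame_def f_hits_next_def f_hits_def f_io_def f_family_def f_matched_def
  f_subset_def f_less_def f_imp_def

lemma free_vars_settles:
  "free_node_vars f_settles = {}" "free_branch_vars f_settles = {}" "free_set_vars f_settles = {0, 1}"
  by (auto simp: formula_defs Let_def)

theorem theorem2:
  shows "\<exists>\<phi>. free_node_vars \<phi> = {} \<and> free_branch_vars \<phi> = {} \<and> free_set_vars \<phi> = {0, 1} \<and>
    (\<forall>(X :: node set) (Y :: node set) v V b.
      sat v (V(0 := X, 1 := Y)) b \<phi> \<longleftrightarrow>
      (\<exists>\<I>. interval_family \<I> \<and> X = sources \<I> \<and> Y = targets \<I> \<and>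
        {\<pi>. eventually_constant (lengths_along \<I> \<pi>)} \<in> sets coin_measure \<and>
        measure coin_measure {\<pi>. eventually_constant (lengths_along \<I> \<pi>)} = 1))"
proof (intro exI[of _ f_settles] conjI allI free_vars_settles)
  fix X Y :: "node set" and v V b
  have "sat v (V(0 := X, 1 := Y)) b f_settles \<longleftrightarrow> is_family X Y \<and> (AE \<pi> in coin_measure. settles X Y \<pi>)"
    by (simp add: sat_settles)
  also have "\<dots> \<longleftrightarrow> (\<exists>\<I>. interval_family \<I> \<and> X = sources \<I> \<and> Y = targets \<I> \<and>
      (AE \<pi> in coin_measure. eventually_constant (lengths_along \<I> \<pi>)))"
    unfolding is_family_iff by (auto simp: eventually_constant_iff_settles)
  finally show "sat v (V(0 := X, 1 := Y)) b f_settles \<longleftrightarrow>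
      (\<exists>\<I>. interval_family \<I> \<and> X = sources \<I> \<and> Y = targets \<I> \<and>
        {\<pi>. eventually_constant (lengths_along \<I> \<pi>)} \<in> sets coin_measure \<and>
        measure coin_measure {\<pi>. eventually_constant (lengths_along \<I> \<pi>)} = 1)"
    by (simp only: AE_coin_iff_prob_1)
qed

end
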